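(* Let $\mathcal{F}$ be a saturated fusion system on a finite $p$-group $S$. If the restriction map $H^1(\mathcal{F};\mathbb{F}_p)\to H^1(S;\mathbb{F}_p)$ is an isomorphism, then $\mathcal{F}=\mathcal{F}_S(S)$.
   Context: $p$ is a prime. A fusion system $\mathcal{F}$ on a finite $p$-group $S$ is a category whose objects are the subgroups of $S$ and whose morphism sets consist of injective group homomorphisms, with $\mathrm{Hom}_S(P,Q)\subseteq \mathrm{Hom}_{\mathcal{F}}(P,Q)$ (where $\mathrm{Hom}_S(P,Q)$ is the set of maps induced by conjugation by elements of $S$), such that every morphism is the composite of an isomorphism in $\mathcal{F}$ and an inclusion. Saturation is in the sense of Broto–Levi–Oliver: call $P\le S$ fully normalized (resp. fully centralized) if $|N_S(P)|\ge|N_S(Q)|$ (resp. $|C_S(P)|\ge |C_S(Q)|$) for all $Q$ that are $\mathcal{F}$-isomorphic to $P$; then $\mathcal{F}$ is saturated if (I) every fully normalized $P$ is fully centralized and $\mathrm{Aut}_S(P)$ is a Sylow $p$-subgroup of $\mathrm{Aut}_{\mathcal{F}}(P)$, and (II) every $\varphi\in \mathrm{Hom}_{\mathcal{F}}(P,S)$ with $\varphi(P)$ fully centralized extends to a morphism in $\mathcal{F}$ on $N_\varphi=\{g\in N_S(P)\mid \varphi c_g\varphi^{-1}\in \mathrm{Aut}_S(\varphi(P))\}$. $\mathcal{F}_S(S)$ is the trivial fusion system on $S$, with $\mathrm{Hom}_{\mathcal{F}_S(S)}(P,Q)=\mathrm{Hom}_S(P,Q)$. For an abelian $p$-group $A$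 with trivial $S$-action, $H^*(\mathcal{F};A)=\{z\in H^*(S;A)\mid \varphi^*(z)=\mathrm{res}^S_P(z)\text{ for all }P\le S,\ \varphi\in\mathrm{Hom}_{\mathcal{F}}(P,S)\}$, and the restriction map $H^1(\mathcal{F};\mathbb{F}_p)\to H^1(S;\mathbb{F}_p)$ is the inclusion. *)

theory Defs
  imports "HOL-Algebra.Algebra"
begin

section \<open>Fusion systems\<close>

definition conj_map :: "('a, 'b) monoid_scheme \<Rightarrow> 'a \<Rightarrow> 'a set \<Rightarrow> 'a \<Rightarrow> 'a" where
  "conj_map S g P = (\<lambda>x\<in>P. g \<otimes>\<^bsub>S\<^esub> x \<otimes>\<^bsub>S\<^esub> inv\<^bsub>S\<^esub> g)"

text \<open>Morphisms are encoded as functions that are \<^const>\<open>extensional\<close> on their domain, so that equality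
  of functions is equality of maps; an inclusion \<open>P \<subseteq> Q\<close> is \<open>\<lambda>x\<in>P. x\<close>. A system of morphism sets is
  a function \<open>F\<close>, where \<open>F P Q\<close> is the set of morphisms from \<open>P\<close> to \<open>Q\<close>, empty unless \<open>P\<close> and \<open>Q\<close>
  are objects, i.e. subgroups of \<open>S\<close>.\<close>

type_synonym 'a hom_sets = "'a set \<Rightarrow> 'a set \<Rightarrow> ('a \<Rightarrow> 'a) set"

definition trivial_fusion :: "('a, 'b) monoid_scheme \<Rightarrow> 'a hom_sets" where
  "trivial_fusion S P Q =
     {\<phi>. subgroup P S \<and> subgroup Q S \<and> (\<exists>g\<in>carrier S. conj_map S g P ` P \<subseteq> Q \<and> \<phi> = conj_map S g P)}"

definition isomorphisms :: "'a hom_sets \<Rightarrow> 'a hom_sets" where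
  "isomorphisms F P Q =
     {\<phi> \<in> F P Q. \<exists>\<psi>\<in>F Q P. compose P \<psi> \<phi> = (\<lambda>x\<in>P. x) \<and> compose Q \<phi> \<psi> = (\<lambda>x\<in>Q. x)}"

locale fusion_system = group S for S (structure) +
  fixes p :: nat and F :: "'a hom_sets"
  assumes prime: "Factorial_Ring.prime p"
    and p_group: "\<exists>n. order S = p ^ n"
    and objects: "\<phi> \<in> F P Q \<Longrightarrow> subgroup P S \<and> subgroup Q S"
    and injective_hom:
      "\<phi> \<in> F P Q \<Longrightarrow> \<phi> \<in> mon (S\<lparr>carrier := P\<rparr>) (S\<lparr>carrier := Q\<rparr>) \<inter> extensional P"
    and composition: "\<phi> \<in> F P Q \<Longrightarrow> \<psi> \<in> F Q R \<Longrightarrow> compose P \<psi> \<phi> \<in> F P R"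
    and contains_trivial: "trivial_fusion S P Q \<subseteq> F P Q"
    and factorization:
      "\<phi> \<in> F P Q \<Longrightarrow>
        \<exists>R \<psi>. subgroup R S \<and> R \<subseteq> Q \<and> \<psi> \<in> isomorphisms F P R \<and> \<phi> = compose P (\<lambda>x\<in>R. x) \<psi>"

definition centralizer :: "('a, 'b) monoid_scheme \<Rightarrow> 'a set \<Rightarrow> 'a set" where
  "centralizer S P = {g \<in> carrier S. \<forall>x\<in>P. g \<otimes>\<^bsub>S\<^esub> x = x \<otimes>\<^bsub>S\<^esub> g}"

definition fully_normalized :: "('a, 'b) monoid_scheme \<Rightarrow> 'a hom_sets \<Rightarrow> 'a set \<Rightarrow> bool" where
  "fully_normalized S F P \<longleftrightarrow> subgroup P S \<and>
     (\<forall>Q. isomorphisms F P Q \<noteq> {} \<longrightarrow> card (normalizer S Q) \<le> card (normalizer S P))"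

definition fully_centralized :: "('a, 'b) monoid_scheme \<Rightarrow> 'a hom_sets \<Rightarrow> 'a set \<Rightarrow> bool" where
  "fully_centralized S F P \<longleftrightarrow> subgroup P S \<and>
     (\<forall>Q. isomorphisms F P Q \<noteq> {} \<longrightarrow> card (centralizer S Q) \<le> card (centralizer S P))"

definition aut_group :: "'a hom_sets \<Rightarrow> 'a set \<Rightarrow> ('a \<Rightarrow> 'a) monoid" where
  "aut_group F P = (BijGroup P)\<lparr>carrier := isomorphisms F P P\<rparr>"

definition sylow_subgroup :: "nat \<Rightarrow> ('a, 'b) monoid_scheme \<Rightarrow> 'a set \<Rightarrow> bool" where
  "sylow_subgroup p G H \<longleftrightarrow> subgroup H G \<and> card H = p ^ multiplicity p (order G)"

definition extension_domain ::
    "('a, 'b) monoid_scheme \<Rightarrow> 'a set \<Rightarrow> ('a \<Rightarrow> 'a) \<Rightarrow> 'a set" where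
  "extension_domain S P \<phi> =
     {g \<in> normalizer S P.
        (\<lambda>y\<in>\<phi> ` P. \<phi> (conj_map S g P (inv_into P \<phi> y)))
          \<in> carrier (aut_group (trivial_fusion S) (\<phi> ` P))}"

locale saturated_fusion_system = fusion_system +
  assumes fully_normalized_centralized:
      "fully_normalized S F P \<Longrightarrow> fully_centralized S F P"
    and fully_normalized_sylow:
      "fully_normalized S F P \<Longrightarrow>
        sylow_subgroup p (aut_group F P) (carrier (aut_group (trivial_fusion S) P))"
    and extension:
      "\<phi> \<in> F P (carrier S) \<Longrightarrow> fully_centralized S F (\<phi> ` P) \<Longrightarrow>
        \<exists>\<psi>\<in>F (extension_domain S P \<phi>) (carrier S). restrict \<psi> P = \<phi>"


section \<open>Cohomology with trivial coefficients\<close>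

text \<open>Inhomogeneous cochains. The coefficient group \<open>A\<close> is an abelian group in the multiplicative
  notation of HOL-Algebra, so the alternating sum of faces becomes a product of powers.\<close>

definition tuples :: "('a, 'b) monoid_scheme \<Rightarrow> nat \<Rightarrow> 'a list set" where
  "tuples G n = {xs. set xs \<subseteq> carrier G \<and> length xs = n}"

definition cochains ::
    "('a, 'b) monoid_scheme \<Rightarrow> ('c, 'd) monoid_scheme \<Rightarrow> nat \<Rightarrow> ('a list \<Rightarrow> 'c) monoid" where
  "cochains G A n = product_group (tuples G n) (\<lambda>_. A)"

text \<open>For \<open>xs = [g\<^sub>1, \<dots>, g\<^sub>m]\<close>: face \<open>0\<close> drops \<open>g\<^sub>1\<close>, face \<open>m\<close> drops \<open>g\<^sub>m\<close>, and face \<open>i\<close> with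
  \<open>0 < i < m\<close> replaces \<open>g\<^sub>i, g\<^sub>i\<^sub>+\<^sub>1\<close> by their product; list positions are counted from \<open>0\<close>.\<close>

definition face :: "('a, 'b) monoid_scheme \<Rightarrow> nat \<Rightarrow> 'a list \<Rightarrow> 'a list" where
  "face G i xs =
     (if i = 0 then tl xs
      else if i = length xs then butlast xs
      else take (i - 1) xs @ [xs ! (i - 1) \<otimes>\<^bsub>G\<^esub> xs ! i] @ drop (i + 1) xs)"

definition coboundary ::
    "('a, 'b) monoid_scheme \<Rightarrow> ('c, 'd) monoid_scheme \<Rightarrow> nat \<Rightarrow> ('a list \<Rightarrow> 'c) \<Rightarrow> 'a list \<Rightarrow> 'c" where
  "coboundary G A n c =
     (\<lambda>xs\<in>tuples G (n + 1). \<Otimes>\<^bsub>A\<^esub>i\<in>{0..n + 1}. c (face G i xs) [^]\<^bsub>A\<^esub> ((-1) ^ i :: int))"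

definition cocycles ::
    "('a, 'b) monoid_scheme \<Rightarrow> ('c, 'd) monoid_scheme \<Rightarrow> nat \<Rightarrow> ('a list \<Rightarrow> 'c) set" where
  "cocycles G A n = kernel (cochains G A n) (cochains G A (n + 1)) (coboundary G A n)"

fun coboundaries ::
    "('a, 'b) monoid_scheme \<Rightarrow> ('c, 'd) monoid_scheme \<Rightarrow> nat \<Rightarrow> ('a list \<Rightarrow> 'c) set" where
  "coboundaries G A 0 = {\<one>\<^bsub>cochains G A 0\<^esub>}"
| "coboundaries G A (Suc n) = coboundary G A n ` carrier (cochains G A n)"

definition cohomology ::
    "('a, 'b) monoid_scheme \<Rightarrow> ('c, 'd) monoid_scheme \<Rightarrow> nat \<Rightarrow> ('a list \<Rightarrow> 'c) set monoid" where
  "cohomology G A n = (cochains G A n)\<lparr>carrier := cocycles G A n\<rparr> Mod coboundaries G A n"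

text \<open>The map \<open>H\<^sup>n(H; A) \<rightarrow> H\<^sup>n(G; A)\<close> induced by \<open>\<phi> : G \<rightarrow> H\<close>, which does not depend on the group
  structure of \<open>H\<close>. A class is a coset; the union ranges over representatives, all of which yield
  the same coset.\<close>

definition pullback ::
    "('a, 'b) monoid_scheme \<Rightarrow> ('c, 'd) monoid_scheme \<Rightarrow> nat \<Rightarrow> ('a \<Rightarrow> 'e)
      \<Rightarrow> ('e list \<Rightarrow> 'c) set \<Rightarrow> ('a list \<Rightarrow> 'c) set" where
  "pullback G A n \<phi> z =
     (\<Union>c\<in>z. coboundaries G A n #>\<^bsub>cochains G A n\<^esub> (\<lambda>xs\<in>tuples G n. c (map \<phi> xs)))"

definition fusion_cohomology ::
    "('a, 'b) monoid_scheme \<Rightarrow> 'a hom_sets \<Rightarrow> ('c, 'd) monoid_scheme \<Rightarrow> nat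
      \<Rightarrow> ('a list \<Rightarrow> 'c) set monoid" where
  "fusion_cohomology S F A n = (cohomology S A n)
     \<lparr>carrier := {z \<in> carrier (cohomology S A n).
        \<forall>P \<phi>. subgroup P S \<longrightarrow> \<phi> \<in> F P (carrier S) \<longrightarrow>
          pullback (S\<lparr>carrier := P\<rparr>) A n \<phi> z = pullback (S\<lparr>carrier := P\<rparr>) A n (\<lambda>x\<in>P. x) z}\<rparr>"

definition fusion_restriction ::
    "('a, 'b) monoid_scheme \<Rightarrow> 'a hom_sets \<Rightarrow> ('c, 'd) monoid_scheme \<Rightarrow> nat
      \<Rightarrow> ('a list \<Rightarrow> 'c) set \<Rightarrow> ('a list \<Rightarrow> 'c) set" where
  "fusion_restriction S F A n = (\<lambda>z\<in>carrier (fusion_cohomology S F A n). z)"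

end

theory Submission
  imports Defs "HOL-Number_Theory.Cong"
begin

text \<open>By Alperin's fusion theorem every morphism of F is a composite of restrictions of conjugations and
  of automorphisms of order prime to p. The product s of the conjugating elements is a label of the
  morphism, and one proves, for smaller and smaller normal subgroups N of S, that a morphism agrees
  modulo N with conjugation by its label and that the labels of an identity map lie in N C(Q).
  For N = S this is trivial, and for N = 1 it says that every morphism is a conjugation.

  To pass from N to M, where N/M is central of order p in S/M, consider the group D of pairs that
  agree modulo N. As for characteristic bisets, there is a finite D-set Y whose stabilizers are graphs
  of morphisms with label in N, whose marks are invariant under F, and which consists of a
  number prime to p of free N-orbits. Equality of marks makes each morphism f with label s extend to a
  bijection g of Y that is semilinear with respect to (f, conjugation by s). The transfer to N/M gives
  an additive invariant of such bijections with values in Z/p. On the diagonal of S it is a homomorphism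
  from S to Z/p, which all morphisms respect by the hypothesis on cohomology, and comparing its values
  at u and f u shows that f agrees modulo M with conjugation by s.\<close>

section \<open>Finite group actions\<close>

text \<open>Homomorphisms to Z/p do not see automorphisms of order prime to p, so these must be
  labelled by one; as a price, a morphism has many labels. This is the obstacle that shapes the
  proof: saturation extends a morphism but gives no control over the label of the extension. The
  descent therefore carries along a bound for the labels of identity maps, which permits a label to
  be corrected by an element that centralizes the image and so leaves the map unchanged. The D-set
  is built from copies of transitive sets, by decreasing order of stabilizers. Marks at one order
  can be made invariant only if they satisfy congruences of the Burnside ring, and saturation
  provides these, because a graph can be straightened to a diagonal by a map defined on its whole
  normalizer. Working in D rather than in S x S brings the number of N-orbits down to one prime to
  p, so that the transfer of an element of N is a unit times its image in N/M. The hypothesis on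
  cohomology enters as invariance under F of all homomorphisms from S to Z/p.\<close>

context group
begin

lemma finite_subgroups: "finite (carrier G) \<Longrightarrow> finite {H. subgroup H G}"
  by (rule finite_subset[of _ "Pow (carrier G)"]) (auto dest: subgroup.mem_carrier)

lemma finite_mult_closed_subgroup:
  assumes fin: "finite (carrier G)" and H: "H \<subseteq> carrier G" "H \<noteq> {}"
    and closed: "\<And>a b. a \<in> H \<Longrightarrow> b \<in> H \<Longrightarrow> a \<otimes> b \<in> H"
  shows "subgroup H G"
proof (rule subgroupI[OF H])
  fix a assume a: "a \<in> H"
  then have ac: "a \<in> carrier G" using H by blast
  have pow: "a [^] Suc n \<in> H" for n
  proof (induction n)
    case 0 then show ?case using a ac by simp
  next
    case (Suc n) then show ?case using closed[OF Suc a] by simp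
  qed
  have o: "order G > 0" using order_gt_0_iff_finite fin by blast
  \<comment> \<open>The inverse of \<open>a\<close> is its power with exponent
    \<open>2 * order G - 1\<close>, which unlike \<open>order G - 1\<close> is positive also for the
    trivial group, so that \<open>pow\<close> applies.\<close>
  then obtain m where "2 * order G - 1 = Suc m" by (cases "2 * order G - 1") auto
  then have m: "Suc (Suc m) = order G * 2" using o by simp
  have "a [^] Suc m \<otimes> a = a [^] Suc (Suc m)" by simp
  also have "\<dots> = a [^] (order G * 2)" by (simp only: m)
  also have "\<dots> = \<one>" using pow_order_eq_1[OF ac] ac by (simp flip: nat_pow_pow)
  finally have "inv a = a [^] Suc m" using ac by (intro inv_equality) auto
  then show "inv a \<in> H" using pow by simp
qed (rule closed)

end

lemma sylow_index:
  assumes G: "group G" "finite (carrier G)" and p: "Factorial_Ring.prime p" and H: "sylow_subgroup p G H"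
  shows "\<not> p dvd order G div card H"
proof
  let ?m = "multiplicity p (order G)"
  have H': "card H = p ^ ?m" using H by (simp add: sylow_subgroup_def)
  assume "p dvd order G div card H"
  moreover have "p ^ ?m dvd order G" by (rule multiplicity_dvd)
  ultimately have "p ^ Suc ?m dvd order G"
    unfolding H' by (metis dvd_mult_div_cancel mult_dvd_mono dvd_refl mult.commute power_Suc)
  moreover have "order G > 0" using monoid.order_gt_0_iff_finite[OF group.is_monoid[OF G(1)]] G(2) by blast
  ultimately show False using p by (metis Suc_n_not_le_n multiplicity_geI not_prime_unit not_gr0)
qed

section \<open>Orbits, stabilizers, fixed points and marks of finite actions\<close>

locale finite_action = group G for G (structure) +
  fixes Y :: "'y set" and act :: "'a \<Rightarrow> 'y \<Rightarrow> 'y"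
  assumes finite_carrier: "finite (carrier G)"
    and finite_points: "finite Y"
    and act_closed [simp]: "\<lbrakk>g \<in> carrier G; y \<in> Y\<rbrakk> \<Longrightarrow> act g y \<in> Y"
    and act_one [simp]: "y \<in> Y \<Longrightarrow> act \<one> y = y"
    and act_mult: "\<lbrakk>g \<in> carrier G; h \<in> carrier G; y \<in> Y\<rbrakk> \<Longrightarrow> act (g \<otimes> h) y = act g (act h y)"
begin

definition stab :: "'y \<Rightarrow> 'a set" where
  "stab y = {g \<in> carrier G. act g y = y}"

definition orb :: "'y \<Rightarrow> 'y set" where
  "orb y = (\<lambda>g. act g y) ` carrier G"

definition fixed :: "'a set \<Rightarrow> 'y set" where
  "fixed K = {y \<in> Y. \<forall>k\<in>K. act k y = y}"

lemma act_inv_act [simp]: "\<lbrakk>g \<in> carrier G; y \<in> Y\<rbrakk> \<Longrightarrow> act (inv g) (act g y) = y"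
  and act_act_inv [simp]: "\<lbrakk>g \<in> carrier G; y \<in> Y\<rbrakk> \<Longrightarrow> act g (act (inv g) y) = y"
  by (simp_all flip: act_mult)

lemma bij_betw_act: "g \<in> carrier G \<Longrightarrow> bij_betw (act g) Y Y"
  by (rule bij_betwI[where g = "act (inv g)"]) auto

lemma subgroup_stab: "y \<in> Y \<Longrightarrow> subgroup (stab y) G"
proof (rule subgroupI)
  assume y: "y \<in> Y"
  show "stab y \<noteq> {}" using y by (auto simp: stab_def intro: exI[of _ \<one>])
  fix a assume a: "a \<in> stab y"
  then have "act (inv a) y = y" using y act_inv_act[of a y] by (simp add: stab_def)
  then show "inv a \<in> stab y" using a by (simp add: stab_def)
  fix b assume "b \<in> stab y"
  then show "a \<otimes> b \<in> stab y" using a y by (auto simp: stab_def act_mult)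
qed (auto simp: stab_def)

lemma orbE: "z \<in> orb y \<Longrightarrow> (\<And>g. g \<in> carrier G \<Longrightarrow> z = act g y \<Longrightarrow> thesis) \<Longrightarrow> thesis"
  by (auto simp: orb_def)

lemma orb_subset: "y \<in> Y \<Longrightarrow> orb y \<subseteq> Y"
  by (auto simp: orb_def)

lemma orb_refl: "y \<in> Y \<Longrightarrow> y \<in> orb y"
  by (force simp: orb_def intro: image_eqI[of _ _ \<one>])

lemma orb_eq: assumes "y \<in> Y" "z \<in> orb y" shows "orb z = orb y"
proof -
  obtain g where g: "g \<in> carrier G" "z = act g y" using assms by (auto simp: orb_def)
  show ?thesis
  proof
    show "orb z \<subseteq> orb y"
      using g assms by (auto simp: orb_def simp flip: act_mult)
    show "orb y \<subseteq> orb z"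
    proof
      fix w assume "w \<in> orb y"
      then obtain h where h: "h \<in> carrier G" "w = act h y" by (auto simp: orb_def)
      then have "w = act (h \<otimes> inv g) z" using g assms by (simp add: act_mult)
      then show "w \<in> orb z" using g h by (auto simp: orb_def)
    qed
  qed
qed

lemma act_mem_orb:
  assumes "g \<in> carrier G" "y \<in> Y" "z \<in> Y"
  shows "act g y \<in> orb z \<longleftrightarrow> y \<in> orb z"
proof -
  have "act g y \<in> orb y" using assms by (auto simp: orb_def)
  then have e: "orb (act g y) = orb y" using orb_eq assms by blast
  show ?thesis
  proof
    assume "act g y \<in> orb z"
    then have "orb z = orb y" using orb_eq[OF assms(3)] e by simp
    then show "y \<in> orb z" using orb_refl[OF assms(2)] by simp
  next
    assume "y \<in> orb z"
    then have "orb y = orb z" using orb_eq[OF assms(3)] by simp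
    then show "act g y \<in> orb z" using \<open>act g y \<in> orb y\<close> by simp
  qed
qed

lemma orb_disjoint:
  assumes "Z \<subseteq> Y"
  shows "\<forall>A\<in>orb ` Z. \<forall>B\<in>orb ` Z. A \<noteq> B \<longrightarrow> A \<inter> B = {}"
proof (intro ballI impI)
  fix A B assume "A \<in> orb ` Z" "B \<in> orb ` Z" and ne: "A \<noteq> B"
  then obtain a b where ab: "a \<in> Y" "b \<in> Y" "A = orb a" "B = orb b" using assms by blast
  show "A \<inter> B = {}"
  proof (rule ccontr)
    assume "A \<inter> B \<noteq> {}"
    then obtain c where "c \<in> orb a" "c \<in> orb b" using ab by blast
    then have "orb a = orb b" using orb_eq[OF ab(1)] orb_eq[OF ab(2)] by blast
    then show False using ab ne by simp
  qed
qed

lemma card_orb: assumes "y \<in> Y" shows "card (orb y) * card (stab y) = order G"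
proof -
  have sg: "subgroup (stab y) G" using subgroup_stab assms .
  have fib: "card {g \<in> carrier G. act g y = z} = card (stab y)" if zO: "z \<in> orb y" for z
  proof -
    obtain h where h: "h \<in> carrier G" "z = act h y" using zO by (rule orbE)
    have "bij_betw ((\<otimes>) h) (stab y) {g \<in> carrier G. act g y = z}"
    proof (rule bij_betwI[where g = "(\<otimes>) (inv h)"])
      show "(\<otimes>) h \<in> stab y \<rightarrow> {g \<in> carrier G. act g y = z}"
        using h assms by (auto simp: stab_def act_mult)
      show "(\<otimes>) (inv h) \<in> {g \<in> carrier G. act g y = z} \<rightarrow> stab y"
        using h assms by (auto simp: stab_def act_mult)
    qed (use h in \<open>auto simp: stab_def simp flip: m_assoc\<close>)
    then show ?thesis by (metis bij_betw_same_card)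
  qed
  have "order G = (\<Sum>z\<in>orb y. card {g \<in> carrier G. act g y = z})"
    unfolding order_def
    by (subst card_eq_sum, subst sum.group[symmetric, where T = "orb y" and g = "\<lambda>g. act g y"])
      (auto simp: orb_def finite_carrier)
  also have "\<dots> = card (orb y) * card (stab y)" using fib by simp
  finally show ?thesis by simp
qed

lemma stab_act: assumes "y \<in> Y" "g \<in> carrier G"
  shows "h \<in> stab (act g y) \<longleftrightarrow> h \<in> carrier G \<and> inv g \<otimes> h \<otimes> g \<in> stab y"
proof -
  { assume h: "h \<in> carrier G"
    have "act (inv g \<otimes> h \<otimes> g) y = act (inv g) (act h (act g y))"
      using assms h by (simp add: act_mult)
    then have "act (inv g \<otimes> h \<otimes> g) y = y \<longleftrightarrow> act h (act g y) = act g y"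
      using assms h by (metis act_act_inv act_closed act_inv_act) }
  then show ?thesis using assms by (auto simp: stab_def)
qed

text \<open>An orbit of a p-group that is not a single point has length divisible by p, and
  \<open>h\<close> is constant modulo p along it, so its contribution vanishes. A general weight
  \<open>h\<close> is allowed because the transfer sum in \<open>label_in_M\<close> is reduced to
  fixed orbits in this way; the constant weight one gives the usual count.\<close>

lemma sum_cong_fixed:
  assumes p: "Factorial_Ring.prime p" "order G = p ^ n"
    and h: "\<And>g y. g \<in> carrier G \<Longrightarrow> y \<in> Y \<Longrightarrow> [h (act g y) = h y] (mod int p)"
  shows "[(\<Sum>y\<in>Y. h y) = (\<Sum>y\<in>fixed (carrier G). h y)] (mod int p)"
proof -
  let ?Z = "Y - fixed (carrier G)" and ?C = "orb ` (Y - fixed (carrier G))"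
  have sub: "B \<subseteq> ?Z" if "B \<in> ?C" for B
  proof -
    obtain y where y: "y \<in> Y" "y \<notin> fixed (carrier G)" "B = orb y" using \<open>B \<in> ?C\<close> by blast
    have "z \<notin> fixed (carrier G)" if z: "z \<in> orb y" for z
    proof
      assume fz: "z \<in> fixed (carrier G)"
      then have "orb z = {z}" by (auto simp: orb_def fixed_def)
      then have "orb y = {z}" using orb_eq[OF y(1) z] by simp
      then have "y = z" using orb_refl[OF y(1)] by simp
      then show False using fz y by simp
    qed
    then show ?thesis using orb_subset[OF y(1)] y by auto
  qed
  have un: "\<Union>?C = ?Z" using sub orb_refl by blast
  have "(\<Sum>y\<in>\<Union>?C. h y) = (\<Sum>B\<in>?C. \<Sum>y\<in>B. h y)"
  proof (rule sum.Union_disjoint[THEN trans])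
    show "\<forall>A\<in>?C. finite A" using sub finite_subset[OF _ finite_Diff[OF finite_points]] by blast
    show "\<forall>A\<in>?C. \<forall>B\<in>?C. A \<noteq> B \<longrightarrow> A \<inter> B = {}"
      by (rule orb_disjoint) auto
    show "(sum \<circ> sum) h ?C = (\<Sum>B\<in>?C. \<Sum>y\<in>B. h y)" by simp
  qed
  then have "(\<Sum>y\<in>?Z. h y) = (\<Sum>B\<in>?C. \<Sum>y\<in>B. h y)" by (simp only: un)
  moreover have "[(\<Sum>B\<in>?C. \<Sum>y\<in>B. h y) = (\<Sum>B\<in>?C. 0)] (mod int p)"
  proof (rule cong_sum)
    fix B assume "B \<in> ?C"
    then obtain y where y: "y \<in> Y" "y \<notin> fixed (carrier G)" "B = orb y" by blast
    have "[(\<Sum>z\<in>B. h z) = (\<Sum>z\<in>B. h y)] (mod int p)"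
      using h y by (intro cong_sum) (auto simp: orb_def)
    moreover have "p dvd card (orb y)"
    proof -
      have "card (orb y) dvd p ^ n" using card_orb[OF y(1)] p(2) by (metis dvd_triv_left)
      then obtain j where j: "card (orb y) = p ^ j"
        using divides_primepow_nat p(1) by blast
      have "card (orb y) \<noteq> 1"
      proof
        assume "card (orb y) = 1"
        then obtain z where "orb y = {z}" using card_1_singletonE by blast
        then have "orb y = {y}" using orb_refl[OF y(1)] by auto
        then have "\<forall>g\<in>carrier G. act g y = y" by (auto simp: orb_def)
        then show False using y by (auto simp: fixed_def)
      qed
      then show ?thesis using j by (cases j) auto
    qed
    then have "[(\<Sum>z\<in>B. h y) = 0] (mod int p)"
      using y by (simp add: cong_0_iff)
    ultimately show "[(\<Sum>z\<in>B. h z) = 0] (mod int p)" using cong_trans by blast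
  qed
  ultimately have "[(\<Sum>y\<in>?Z. h y) = 0] (mod int p)" by simp
  moreover have "(\<Sum>y\<in>Y. h y) = (\<Sum>y\<in>?Z. h y) + (\<Sum>y\<in>fixed (carrier G). h y)"
    by (rule sum.subset_diff) (auto simp: fixed_def finite_points)
  ultimately show ?thesis
    by (metis add_0 cong_add cong_refl)
qed

lemma card_cong_fixed:
  assumes "Factorial_Ring.prime p" "order G = p ^ n"
  shows "[card Y = card (fixed (carrier G))] (mod p)"
  using sum_cong_fixed[OF assms, of "\<lambda>_. 1"] by (simp add: cong_int_iff)

lemma fixed_iff: "K \<subseteq> carrier G \<Longrightarrow> y \<in> fixed K \<longleftrightarrow> y \<in> Y \<and> K \<subseteq> stab y"
  by (auto simp: fixed_def stab_def)

lemma finite_fixed [simp]: "finite (fixed K)"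
  using finite_points by (auto simp: fixed_def)

text \<open>Sorting the fixed points of \<open>K\<close> by their stabilizers gives a triangular
  system between marks and numbers of points with a given stabilizer. This is how marks determine
  those numbers.\<close>

lemma card_fixed_sum:
  assumes K: "subgroup K G"
  shows "card (fixed K) = (\<Sum>H | subgroup H G \<and> K \<subseteq> H. card {y \<in> Y. stab y = H})"
proof -
  have "fixed K = (\<Union>H \<in> {H. subgroup H G \<and> K \<subseteq> H}. {y \<in> Y. stab y = H})"
    using fixed_iff[OF subgroup.subset[OF K]] subgroup_stab by auto
  moreover have "card \<dots> = (\<Sum>H | subgroup H G \<and> K \<subseteq> H. card {y \<in> Y. stab y = H})"
    by (rule card_UN_disjoint) (use finite_subgroups[OF finite_carrier] finite_points in auto)
  ultimately show ?thesis by simp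
qed

text \<open>Normality makes all points in the orbit of such a point have the same stabilizer, so
  these points fill complete orbits, each as long as the index of \<open>L\<close>.\<close>

lemma dvd_card_stab_eq:
  assumes L: "L \<lhd> G"
  shows "order G div card L dvd card {y \<in> Y. stab y = L}"
proof -
  let ?Z = "{y \<in> Y. stab y = L}"
  interpret L: normal L G by (rule L)
  have inv: "orb y \<subseteq> ?Z" if "y \<in> ?Z" for y
  proof
    fix z assume "z \<in> orb y"
    then obtain g where g: "g \<in> carrier G" "z = act g y" by (auto simp: orb_def)
    have y: "y \<in> Y" "stab y = L" using that by auto
    have "h \<in> stab z \<longleftrightarrow> h \<in> L" for h
    proof -
      have "inv g \<otimes> h \<otimes> g \<in> L \<longleftrightarrow> h \<in> L" if h: "h \<in> carrier G"
      proof
        assume "inv g \<otimes> h \<otimes> g \<in> L"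
        then have "g \<otimes> (inv g \<otimes> h \<otimes> g) \<otimes> inv g \<in> L"
          using L.inv_op_closed2 g by blast
        moreover have "g \<otimes> (inv g \<otimes> h \<otimes> g) \<otimes> inv g = h"
          using g h by (simp add: m_assoc) (simp flip: m_assoc)
        ultimately show "h \<in> L" by simp
      qed (use L.inv_op_closed1 g in blast)
      then show ?thesis using stab_act[OF y(1) g(1)] g y L.subset by auto
    qed
    then show "z \<in> ?Z" using g y by auto
  qed
  have c: "card (orb y) = order G div card L" if "y \<in> ?Z" for y
  proof -
    have "card L > 0" using finite_carrier L.subset L.one_closed by (metis card_gt_0_iff empty_iff finite_subset)
    then show ?thesis using card_orb[of y] that
      by (metis (mono_tags, lifting) mem_Collect_eq nonzero_mult_div_cancel_right not_gr0)
  qed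
  have un: "\<Union>(orb ` ?Z) = ?Z" using inv orb_refl by blast
  have "order G div card L dvd card (\<Union>(orb ` ?Z))"
  proof (rule dvd_partition)
    show "finite (\<Union> (orb ` ?Z))" using finite_points un by simp
    show "\<forall>c1\<in>orb ` ?Z. \<forall>c2\<in>orb ` ?Z. c1 \<noteq> c2 \<longrightarrow> c1 \<inter> c2 = {}"
      by (rule orb_disjoint) auto
  qed (use c in auto)
  then show ?thesis using un by simp
qed

lemma restrict_action:
  assumes "subgroup H G" shows "finite_action (G\<lparr>carrier := H\<rparr>) Y act"
proof -
  interpret H: group "G\<lparr>carrier := H\<rparr>" using subgroup.subgroup_is_group[OF assms] group_axioms by blast
  show ?thesis
    by unfold_locales
      (use subgroup.subset[OF assms] finite_subset[OF subgroup.subset[OF assms] finite_carrier] finite_points in \<open>auto simp: act_mult subsetD\<close>)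
qed

lemma invariant_action:
  assumes "Z \<subseteq> Y" "\<And>g y. g \<in> carrier G \<Longrightarrow> y \<in> Z \<Longrightarrow> act g y \<in> Z"
  shows "finite_action G Z act"
  by unfold_locales (use assms finite_subset[OF assms(1) finite_points] finite_carrier in \<open>auto simp: act_mult subsetD\<close>)

text \<open>A function that changes along the action by \<open>\<kappa>\<close> is fixed by its
  values at one base point per orbit; it is well defined modulo \<open>m\<close> because
  \<open>\<kappa>\<close> vanishes on stabilizers. It serves three times: for \<open>N\<close> and
  for \<open>D\<close> acting on the same set, and for \<open>N\<close> acting on partial
  stabilizers.\<close>

lemma exists_potential:
  fixes \<kappa> :: "'a \<Rightarrow> int"
  assumes hom: "\<And>g h. g \<in> carrier G \<Longrightarrow> h \<in> carrier G \<Longrightarrow> [\<kappa> (g \<otimes> h) = \<kappa> g + \<kappa> h] (mod m)"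
    and stab: "\<And>y g. y \<in> Y \<Longrightarrow> g \<in> stab y \<Longrightarrow> [\<kappa> g = 0] (mod m)"
  shows "\<exists>\<omega> :: 'y \<Rightarrow> int. \<forall>g\<in>carrier G. \<forall>y\<in>Y. [\<omega> (act g y) = \<omega> y + \<kappa> g] (mod m)"
proof -
  \<comment> \<open>\<open>r\<close> chooses a base point that depends on the orbit alone,
    \<open>e y\<close> carries it to \<open>y\<close>, and \<open>\<kappa> (e y)\<close> is the
    potential.\<close>
  define r where "r y = (SOME z. z \<in> orb y)" for y
  define e where "e y = (SOME g. g \<in> carrier G \<and> act g (r y) = y)" for y
  have r: "r y \<in> orb y" if "y \<in> Y" for y
    unfolding r_def by (rule someI[of _ y]) (rule orb_refl[OF that])
  have e: "e y \<in> carrier G \<and> act (e y) (r y) = y" if y: "y \<in> Y" for y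
  proof -
    have "y \<in> orb (r y)" using orb_eq[OF y r[OF y]] orb_refl[OF y] by simp
    then obtain g where "g \<in> carrier G" "y = act g (r y)" by (rule orbE)
    then have "g \<in> carrier G \<and> act g (r y) = y" by simp
    then show ?thesis unfolding e_def by (rule someI)
  qed
  have "[\<kappa> (e (act g y)) = \<kappa> (e y) + \<kappa> g] (mod m)"
    if g: "g \<in> carrier G" and y: "y \<in> Y" for g y
  proof -
    have gy: "act g y \<in> Y" using g y by simp
    have "orb (act g y) = orb y" using orb_eq[OF y] g by (auto simp: orb_def)
    then have req: "r (act g y) = r y" by (simp add: r_def)
    have rY: "r y \<in> Y" using r[OF y] orb_subset[OF y] by (rule subsetD[rotated])
    let ?a = "e (act g y)" and ?b = "e y"
    have a: "?a \<in> carrier G" "act ?a (r y) = act g y" using e[OF gy] req by auto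
    have b: "?b \<in> carrier G" "act ?b (r y) = y" using e[OF y] by auto
    have s: "inv ?a \<otimes> (g \<otimes> ?b) \<in> stab (r y)"
    proof -
      have "act (inv ?a \<otimes> (g \<otimes> ?b)) (r y) = act (inv ?a) (act ?a (r y))"
        using a b g rY by (simp add: act_mult)
      also have "\<dots> = r y" using a(1) rY by (rule act_inv_act)
      finally show ?thesis using a(1) b(1) g by (simp add: stab_def)
    qed
    have "[\<kappa> (?a \<otimes> (inv ?a \<otimes> (g \<otimes> ?b))) = \<kappa> ?a + \<kappa> (inv ?a \<otimes> (g \<otimes> ?b))] (mod m)"
      using a b g by (intro hom) auto
    moreover have "?a \<otimes> (inv ?a \<otimes> (g \<otimes> ?b)) = g \<otimes> ?b"
      using a b g by (simp flip: m_assoc)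
    ultimately have "[\<kappa> (g \<otimes> ?b) = \<kappa> ?a + 0] (mod m)"
      using cong_trans[OF _ cong_add[OF cong_refl stab[OF rY s]]] by simp
    moreover have "[\<kappa> (g \<otimes> ?b) = \<kappa> g + \<kappa> ?b] (mod m)" using g b by (intro hom)
    ultimately show ?thesis using cong_trans[OF cong_sym] by (simp add: add.commute)
  qed
  then show ?thesis by (intro exI[of _ "\<lambda>y. \<kappa> (e y)"] ballI)
qed

end

text \<open>In the sum of \<open>card_fixed_sum\<close> all terms with \<open>H\<close> larger than
  \<open>K\<close> agree by induction from the top, so equality of marks leaves equality at
  \<open>K\<close>. The mark at \<open>L\<close> itself stays free, since \<open>marks_cong\<close>
  compares two actions exactly there.\<close>

lemma stab_card_eq_of_marks:
  assumes 1: "finite_action G Y1 act1" and 2: "finite_action G Y2 act2"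
    and m: "\<And>K. \<lbrakk>subgroup K G; L \<subset> K\<rbrakk> \<Longrightarrow>
      card (finite_action.fixed Y1 act1 K) = card (finite_action.fixed Y2 act2 K)"
    and K: "subgroup K G" "L \<subset> K"
  shows "card {y \<in> Y1. finite_action.stab G act1 y = K} = card {y \<in> Y2. finite_action.stab G act2 y = K}"
  using K
proof (induction "card (carrier G) - card K" arbitrary: K rule: less_induct)
  case (less K)
  interpret A: finite_action G Y1 act1 by (rule 1)
  interpret B: finite_action G Y2 act2 by (rule 2)
  let ?S = "{H. subgroup H G \<and> K \<subseteq> H}"
  have fS: "finite ?S" using A.finite_subgroups[OF A.finite_carrier] by (rule rev_finite_subset) auto
  have KS: "K \<in> ?S" using less by simp
  have "(\<Sum>H\<in>?S - {K}. card {y \<in> Y1. A.stab y = H}) = (\<Sum>H\<in>?S - {K}. card {y \<in> Y2. B.stab y = H})"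
  proof (rule sum.cong[OF refl])
    fix H assume H: "H \<in> ?S - {K}"
    have Hc: "H \<subseteq> carrier G" using H subgroup.subset by blast
    then have "finite H" using A.finite_carrier finite_subset by blast
    then have "card K < card H" using H by (intro psubset_card_mono) auto
    moreover have "card H \<le> card (carrier G)" using Hc A.finite_carrier by (rule card_mono[rotated])
    ultimately show "card {y \<in> Y1. A.stab y = H} = card {y \<in> Y2. B.stab y = H}"
      using H less.prems by (intro less.hyps) auto
  qed
  moreover have "(\<Sum>H\<in>?S. card {y \<in> Y1. A.stab y = H}) = (\<Sum>H\<in>?S. card {y \<in> Y2. B.stab y = H})"
    using m[OF less.prems] A.card_fixed_sum[OF less.prems(1)] B.card_fixed_sum[OF less.prems(1)] by simp
  ultimately show ?case using sum.remove[OF fS KS, of "\<lambda>H. card {y \<in> Y1. A.stab y = H}"]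
      sum.remove[OF fS KS, of "\<lambda>H. card {y \<in> Y2. B.stab y = H}"] by linarith
qed

text \<open>A congruence of the Burnside ring: points with stabilizer larger than \<open>L\<close>
  are equally many on both sides, and those with stabilizer \<open>L\<close> form free orbits of the
  quotient by \<open>L\<close>, hence are counted by multiples of its order.\<close>

lemma marks_cong:
  assumes 1: "finite_action G Y1 act1" and 2: "finite_action G Y2 act2" and L: "L \<lhd> G"
    and m: "\<And>K. \<lbrakk>subgroup K G; L \<subset> K\<rbrakk> \<Longrightarrow>
      card (finite_action.fixed Y1 act1 K) = card (finite_action.fixed Y2 act2 K)"
  shows "[card (finite_action.fixed Y1 act1 L) = card (finite_action.fixed Y2 act2 L)] (mod (order G div card L))"
proof -
  interpret A: finite_action G Y1 act1 by (rule 1)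
  interpret B: finite_action G Y2 act2 by (rule 2)
  let ?S = "{H. subgroup H G \<and> L \<subseteq> H}" and ?d = "order G div card L"
  have sL: "subgroup L G" using L by (rule normal_imp_subgroup)
  have fS: "finite ?S" using A.finite_subgroups[OF A.finite_carrier] by (rule rev_finite_subset) auto
  have KS: "L \<in> ?S" using sL by simp
  have "(\<Sum>H\<in>?S - {L}. card {y \<in> Y1. A.stab y = H}) = (\<Sum>H\<in>?S - {L}. card {y \<in> Y2. B.stab y = H})"
  proof (rule sum.cong[OF refl])
    fix H assume "H \<in> ?S - {L}"
    then show "card {y \<in> Y1. A.stab y = H} = card {y \<in> Y2. B.stab y = H}"
      by (intro stab_card_eq_of_marks[OF 1 2 m, where L = L]) auto
  qed
  moreover have "[card {y \<in> Y1. A.stab y = L} = card {y \<in> Y2. B.stab y = L}] (mod ?d)"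
    using cong_trans[OF iffD2[OF cong_0_iff A.dvd_card_stab_eq[OF L]]
      cong_sym[OF iffD2[OF cong_0_iff B.dvd_card_stab_eq[OF L]]]] .
  ultimately show ?thesis
    unfolding A.card_fixed_sum[OF sL] B.card_fixed_sum[OF sL] sum.remove[OF fS KS]
    by (simp add: cong_add)
qed

text \<open>Burnside's theorem. A stabilizer \<open>K\<close> of largest order among both sets has a
  fixed point in each, because the marks agree, and maximality makes \<open>K\<close> the full
  stabilizer of both points. Their orbits are isomorphic; removing them preserves equality of marks,
  and induction on the size applies.\<close>

lemma isomorphic_of_marks:
  assumes "finite_action G Y1 act1" "finite_action G Y2 act2"
    and "\<And>K. subgroup K G \<Longrightarrow>
      card (finite_action.fixed Y1 act1 K) = card (finite_action.fixed Y2 act2 K)"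
  shows "\<exists>f. bij_betw f Y1 Y2 \<and> (\<forall>g\<in>carrier G. \<forall>y\<in>Y1. f (act1 g y) = act2 g (f y))"
  using assms
proof (induction "card Y1" arbitrary: Y1 Y2 rule: less_induct)
  case (less Y1 Y2)
  interpret A: finite_action G Y1 act1 by (rule less.prems)
  interpret B: finite_action G Y2 act2 by (rule less.prems)
  note marks = less.prems(3)
  have one: "subgroup {\<one>\<^bsub>G\<^esub>} G" by (rule A.triv_subgroup)
  have Y1: "A.fixed {\<one>\<^bsub>G\<^esub>} = Y1" and Y2: "B.fixed {\<one>\<^bsub>G\<^esub>} = Y2"
    by (auto simp: A.fixed_def B.fixed_def)
  have cardY: "card Y1 = card Y2" using marks[OF one] Y1 Y2 by simp
  show ?case
  proof (cases "Y1 = {}")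
    case True
    then have "Y2 = {}" using cardY B.finite_points by simp
    then show ?thesis using True by (intro exI[of _ undefined]) (simp add: bij_betw_def)
  next
    case False
    let ?K = "A.stab ` Y1 \<union> B.stab ` Y2"
    have fK: "finite (card ` ?K)" "card ` ?K \<noteq> {}" using False A.finite_points B.finite_points by auto
    obtain K where K0: "K \<in> ?K" "card K = Max (card ` ?K)" using Max_in[OF fK] by (metis imageE)
    then have K: "K \<in> ?K" "\<And>K'. K' \<in> ?K \<Longrightarrow> card K' \<le> card K"
      using Max_ge[OF fK(1)] by auto
    have sK: "subgroup K G" using K(1) A.subgroup_stab B.subgroup_stab by auto
    have Kc: "K \<subseteq> carrier G" using sK subgroup.subset by blast
    have "A.fixed K \<noteq> {} \<or> B.fixed K \<noteq> {}"
      using K(1) A.fixed_iff[OF Kc] B.fixed_iff[OF Kc] by auto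
    then have "A.fixed K \<noteq> {}" "B.fixed K \<noteq> {}"
      using marks[OF sK] by (metis A.finite_fixed B.finite_fixed card_eq_0_iff)+
    then obtain y1 y2 where y: "y1 \<in> Y1" "K \<subseteq> A.stab y1" "y2 \<in> Y2" "K \<subseteq> B.stab y2"
      using A.fixed_iff[OF Kc] B.fixed_iff[OF Kc] by blast
    have "finite (A.stab y1)" "finite (B.stab y2)"
      using A.finite_carrier by (auto simp: A.stab_def B.stab_def)
    then have s1: "A.stab y1 = K" and s2: "B.stab y2 = K"
      using y K(2) by (metis UnI1 UnI2 card_seteq image_eqI)+
    have eq: "act1 g y1 = act1 h y1 \<longleftrightarrow> act2 g y2 = act2 h y2"
      if "g \<in> carrier G" "h \<in> carrier G" for g h
    proof -
      have "act1 g y1 = act1 h y1 \<longleftrightarrow> inv\<^bsub>G\<^esub> g \<otimes>\<^bsub>G\<^esub> h \<in> A.stab y1"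
        using that y(1) by (simp add: A.stab_def A.act_mult) (metis A.act_act_inv A.act_inv_act A.act_closed)
      moreover have "act2 g y2 = act2 h y2 \<longleftrightarrow> inv\<^bsub>G\<^esub> g \<otimes>\<^bsub>G\<^esub> h \<in> B.stab y2"
        using that y(3) by (simp add: B.stab_def B.act_mult) (metis B.act_act_inv B.act_inv_act B.act_closed)
      ultimately show ?thesis using s1 s2 by simp
    qed
    \<comment> \<open>The chosen \<open>g\<close> does not matter by \<open>eq\<close>, since both
      points have stabilizer \<open>K\<close>.\<close>
    define f0 where "f0 z = act2 (SOME g. g \<in> carrier G \<and> act1 g y1 = z) y2" for z
    have f0: "f0 (act1 g y1) = act2 g y2" if "g \<in> carrier G" for g
    proof -
      let ?h = "SOME h. h \<in> carrier G \<and> act1 h y1 = act1 g y1"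
      have "?h \<in> carrier G \<and> act1 ?h y1 = act1 g y1" by (rule someI[of _ g]) (use that in simp)
      then show ?thesis using eq[of ?h g] that by (simp add: f0_def)
    qed
    have bij0: "bij_betw f0 (A.orb y1) (B.orb y2)"
      unfolding bij_betw_def
    proof
      show "inj_on f0 (A.orb y1)" by (rule inj_onI) (auto simp: A.orb_def f0 eq)
      show "f0 ` A.orb y1 = B.orb y2" by (auto simp: A.orb_def B.orb_def f0 image_image)
    qed
    let ?Z1 = "Y1 - A.orb y1" and ?Z2 = "Y2 - B.orb y2"
    have inv1: "act1 g y \<in> A.orb y1 \<longleftrightarrow> y \<in> A.orb y1"
      if "g \<in> carrier G" "y \<in> Y1" for g y
      by (rule A.act_mem_orb[OF that y(1)])
    have inv2: "act2 g y \<in> B.orb y2 \<longleftrightarrow> y \<in> B.orb y2"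
      if "g \<in> carrier G" "y \<in> Y2" for g y
      by (rule B.act_mem_orb[OF that y(3)])
    interpret A': finite_action G ?Z1 act1 by (rule A.invariant_action) (auto simp: inv1)
    interpret B': finite_action G ?Z2 act2 by (rule B.invariant_action) (auto simp: inv2)
    have f0fix: "(\<forall>k\<in>H. act1 k z = z) \<longleftrightarrow> (\<forall>k\<in>H. act2 k (f0 z) = f0 z)"
      if z: "z \<in> A.orb y1" and H: "subgroup H G" for z H
    proof -
      obtain g where g: "g \<in> carrier G" "z = act1 g y1" using z by (auto simp: A.orb_def)
      have "act1 k z = z \<longleftrightarrow> act2 k (f0 z) = f0 z" if k: "k \<in> carrier G" for k
        using g k y eq[of "k \<otimes>\<^bsub>G\<^esub> g" g] by (simp add: f0 A.act_mult B.act_mult)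
      then show ?thesis using subgroup.subset[OF H] by blast
    qed
    have marks': "card (A'.fixed H) = card (B'.fixed H)" if H: "subgroup H G" for H
    proof -
      have fx: "z \<in> A.fixed H \<longleftrightarrow> f0 z \<in> B.fixed H" if z: "z \<in> A.orb y1" for z
      proof -
        have "f0 z \<in> B.orb y2" using bij0 z by (auto simp: bij_betw_def)
        then show ?thesis using f0fix[OF z H] A.orb_subset[OF y(1)] B.orb_subset[OF y(3)] z
          by (auto simp: A.fixed_def B.fixed_def)
      qed
      have "f0 ` (A.fixed H \<inter> A.orb y1) = B.fixed H \<inter> B.orb y2"
      proof (intro equalityI subsetI)
        fix w assume w: "w \<in> B.fixed H \<inter> B.orb y2"
        then obtain z where "z \<in> A.orb y1" "w = f0 z" using bij0 by (auto simp: bij_betw_def)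
        then show "w \<in> f0 ` (A.fixed H \<inter> A.orb y1)" using fx w by auto
      qed (use fx bij0 in \<open>auto simp: bij_betw_def\<close>)
      moreover have "inj_on f0 (A.fixed H \<inter> A.orb y1)"
        using bij0 by (auto simp: bij_betw_def intro: inj_on_subset)
      ultimately have "bij_betw f0 (A.fixed H \<inter> A.orb y1) (B.fixed H \<inter> B.orb y2)"
        by (simp add: bij_betw_def)
      then have "card (A.fixed H \<inter> A.orb y1) = card (B.fixed H \<inter> B.orb y2)"
        by (rule bij_betw_same_card)
      moreover have "A'.fixed H = A.fixed H - A.fixed H \<inter> A.orb y1" "B'.fixed H = B.fixed H - B.fixed H \<inter> B.orb y2"
        by (auto simp: A'.fixed_def B'.fixed_def A.fixed_def B.fixed_def)
      ultimately show ?thesis using marks[OF H] by (simp add: card_Diff_subset)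
    qed
    have "card ?Z1 < card Y1"
      using A.orb_refl[OF y(1)] y(1) A.finite_points by (intro psubset_card_mono) auto
    from less.hyps[OF this A'.finite_action_axioms B'.finite_action_axioms marks']
    obtain f1 where f1: "bij_betw f1 ?Z1 ?Z2"
      "\<And>g z. g \<in> carrier G \<Longrightarrow> z \<in> ?Z1 \<Longrightarrow> f1 (act1 g z) = act2 g (f1 z)"
        by blast
    define f where "f z = (if z \<in> A.orb y1 then f0 z else f1 z)" for z
    have "bij_betw f (A.orb y1 \<union> ?Z1) (B.orb y2 \<union> ?Z2)"
    proof (rule bij_betw_combine)
      show "bij_betw f (A.orb y1) (B.orb y2)" using bij0 by (rule bij_betw_cong[THEN iffD1, rotated]) (simp add: f_def)
      show "bij_betw f ?Z1 ?Z2" using f1(1) by (rule bij_betw_cong[THEN iffD1, rotated]) (simp add: f_def)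
    qed auto
    moreover have "A.orb y1 \<union> ?Z1 = Y1" "B.orb y2 \<union> ?Z2 = Y2"
      using A.orb_subset[OF y(1)] B.orb_subset[OF y(3)] by auto
    moreover have "f (act1 g z) = act2 g (f z)" if g: "g \<in> carrier G" and z: "z \<in> Y1" for g z
    proof (cases "z \<in> A.orb y1")
      case True
      then obtain h where h: "h \<in> carrier G" "z = act1 h y1" by (auto simp: A.orb_def)
      have "f0 (act1 (g \<otimes>\<^bsub>G\<^esub> h) y1) = act2 g (f0 z)"
        using g h y(3) by (subst f0) (auto simp: f0 B.act_mult)
      then show ?thesis using True inv1[OF g z] g h y(1) by (simp add: f_def A.act_mult)
    next
      case False
      then show ?thesis using inv1[OF g z] f1(2)[OF g] z by (simp add: f_def)
    qed
    ultimately show ?thesis by (intro exI[of _ f] conjI ballI) simp_all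
  qed
qed

context finite_action
begin

lemma card_fixed_conj:
  assumes g: "g \<in> carrier G" and K: "K \<subseteq> carrier G"
  shows "card (fixed ((\<lambda>k. g \<otimes> k \<otimes> inv g) ` K)) = card (fixed K)"
proof -
  have "bij_betw (act g) (fixed K) (fixed ((\<lambda>k. g \<otimes> k \<otimes> inv g) ` K))"
  proof (rule bij_betwI[where g = "act (inv g)"])
    show "act g \<in> fixed K \<rightarrow> fixed ((\<lambda>k. g \<otimes> k \<otimes> inv g) ` K)"
      using g K by (auto simp: fixed_def act_mult subsetD)
    show "act (inv g) \<in> fixed ((\<lambda>k. g \<otimes> k \<otimes> inv g) ` K) \<rightarrow> fixed K"
    proof
      fix y assume y: "y \<in> fixed ((\<lambda>k. g \<otimes> k \<otimes> inv g) ` K)"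
      then have yY: "y \<in> Y" by (simp add: fixed_def)
      have "act k (act (inv g) y) = act (inv g) y" if k: "k \<in> K" for k
      proof -
        have kc: "k \<in> carrier G" using k K by blast
        have "act (g \<otimes> k \<otimes> inv g) y = y" using y k by (simp add: fixed_def)
        then have "act g (act k (act (inv g) y)) = y" using g kc yY by (simp add: act_mult)
        then show ?thesis using act_inv_act[of g "act k (act (inv g) y)"] g kc yY by simp
      qed
      then show "act (inv g) y \<in> fixed K" using g yY by (simp add: fixed_def)
    qed
  qed (use g in \<open>auto simp: fixed_def\<close>)
  then show ?thesis by (metis bij_betw_same_card)
qed

text \<open>When all stabilizers have the same order, a point fixed by a member \<open>L\<close> of
  the family has stabilizer exactly \<open>L\<close>, so the fixed sets partition
  \<open>Y\<close>.\<close>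

lemma card_eq_sum_fixed:
  assumes stabs: "\<And>y. y \<in> Y \<Longrightarrow> stab y \<in> \<S>"
    and S: "finite \<S>" "\<And>L. L \<in> \<S> \<Longrightarrow> L \<subseteq> carrier G \<and> card L = k"
  shows "card Y = (\<Sum>L\<in>\<S>. card (fixed L))"
proof -
  have "Y = (\<Union>L\<in>\<S>. fixed L)"
    using stabs S(2) by (auto simp: fixed_def stab_def)
  moreover have "card (\<Union>L\<in>\<S>. fixed L) = (\<Sum>L\<in>\<S>. card (fixed L))"
  proof (rule card_UN_disjoint)
    have eq: "stab y = L" if "L \<in> \<S>" "y \<in> fixed L" for L y
    proof -
      have "y \<in> Y" "L \<subseteq> stab y" using that S(2) fixed_iff[of L y] by auto
      moreover have "finite (stab y)" by (simp add: stab_def finite_carrier)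
      ultimately show ?thesis using card_subset_eq[of "stab y" L] S(2) stabs that(1) by auto
    qed
    show "\<forall>i\<in>\<S>. \<forall>j\<in>\<S>. i \<noteq> j \<longrightarrow> fixed i \<inter> fixed j = {}"
    proof (intro ballI impI)
      fix i j assume "i \<in> \<S>" "j \<in> \<S>" "i \<noteq> j"
      then show "fixed i \<inter> fixed j = {}" using eq[of i] eq[of j] by blast
    qed
  qed (use S in auto)
  ultimately show ?thesis by simp
qed

end

section \<open>Conjugate subgroups, transitive sets and Sylow-type arguments\<close>

context group
begin

definition conjugate :: "'a \<Rightarrow> 'a set \<Rightarrow> 'a set" where
  "conjugate g K = (\<lambda>k. g \<otimes> k \<otimes> inv g) ` K"

definition setwise_normalizer :: "'a set \<Rightarrow> 'a set" where
  "setwise_normalizer K = {g \<in> carrier G. conjugate g K = K}"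

text \<open>An entry of the table of marks: the fixed points of \<open>K\<close> on the transitive
  set with stabilizer \<open>L\<close>. Multiplying by inverses on the right makes the right cosets
  a set with left action.\<close>

definition mark :: "'a set \<Rightarrow> 'a set \<Rightarrow> nat" where
  "mark L K = card {C \<in> rcosets L. \<forall>k\<in>K. C #> inv k = C}"

lemma conj_inj: "g \<in> carrier G \<Longrightarrow> inj_on (\<lambda>k. g \<otimes> k \<otimes> inv g) (carrier G)"
  by (rule inj_onI) simp

lemma conjugate_conjugate:
  "\<lbrakk>g \<in> carrier G; h \<in> carrier G; K \<subseteq> carrier G\<rbrakk> \<Longrightarrow> conjugate g (conjugate h K) = conjugate (g \<otimes> h) K"
  by (auto simp: conjugate_def image_image inv_mult_group m_assoc subsetD intro!: image_cong)

lemma conjugate_one [simp]: "K \<subseteq> carrier G \<Longrightarrow> conjugate \<one> K = K"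
  by (auto simp: conjugate_def subsetD)

lemma conjugate_subset: "\<lbrakk>g \<in> carrier G; K \<subseteq> carrier G\<rbrakk> \<Longrightarrow> conjugate g K \<subseteq> carrier G"
  by (auto simp: conjugate_def)

lemma card_conjugate: "\<lbrakk>g \<in> carrier G; K \<subseteq> carrier G\<rbrakk> \<Longrightarrow> card (conjugate g K) = card K"
  unfolding conjugate_def by (rule card_image) (rule inj_on_subset[OF conj_inj])

lemma subgroup_conjugate:
  assumes g: "g \<in> carrier G" and K: "subgroup K G" shows "subgroup (conjugate g K) G"
proof (rule subgroupI)
  show "conjugate g K \<subseteq> carrier G" using g subgroup.subset[OF K] by (rule conjugate_subset)
  show "conjugate g K \<noteq> {}" using subgroup.one_closed[OF K] by (auto simp: conjugate_def)
  fix a assume "a \<in> conjugate g K"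
  then obtain k where k: "k \<in> K" "a = g \<otimes> k \<otimes> inv g" by (auto simp: conjugate_def)
  have kc: "k \<in> carrier G" using K k(1) by (rule subgroup.mem_carrier)
  have "inv a = g \<otimes> inv k \<otimes> inv g" using k kc g by (simp add: inv_mult_group m_assoc)
  then show "inv a \<in> conjugate g K" using subgroup.m_inv_closed[OF K k(1)] by (auto simp: conjugate_def)
  fix b assume "b \<in> conjugate g K"
  then obtain l where l: "l \<in> K" "b = g \<otimes> l \<otimes> inv g" by (auto simp: conjugate_def)
  have lc: "l \<in> carrier G" using K l(1) by (rule subgroup.mem_carrier)
  have "a \<otimes> b = g \<otimes> (k \<otimes> l) \<otimes> inv g"
    using k l kc lc g by (simp add: m_assoc) (simp flip: m_assoc)
  then show "a \<otimes> b \<in> conjugate g K" using subgroup.m_closed[OF K k(1) l(1)] by (auto simp: conjugate_def)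
qed

lemma coset_action:
  assumes L: "subgroup L G" and fin: "finite (carrier G)"
  shows "finite_action G (rcosets L) (\<lambda>g C. C #> inv g)"
proof unfold_locales
  have Lc: "L \<subseteq> carrier G" using L by (rule subgroup.subset)
  show "finite (rcosets L)" using rcosets_subset_PowG[OF L] fin by (auto intro: finite_subset)
  fix g C assume g: "g \<in> carrier G" and "C \<in> rcosets L"
  then obtain x where x: "x \<in> carrier G" "C = L #> x" by (auto simp: RCOSETS_def)
  show "C #> inv g \<in> rcosets L" using x g Lc by (simp add: coset_mult_assoc rcosetsI)
  fix h assume h: "h \<in> carrier G"
  show "C #> inv (g \<otimes> h) = C #> inv h #> inv g"
    using x g h Lc by (simp add: inv_mult_group coset_mult_assoc r_coset_subset_G m_assoc)
next
  fix C assume "C \<in> rcosets L"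
  then have "C \<subseteq> carrier G" using L subgroup.rcosets_carrier is_group by blast
  then show "C #> inv \<one> = C" by simp
qed (rule fin)

lemma coset_fixed_iff:
  assumes L: "subgroup L G" and x: "x \<in> carrier G" and k: "k \<in> carrier G"
  shows "(L #> x) #> inv k = L #> x \<longleftrightarrow> x \<otimes> k \<otimes> inv x \<in> L"
proof -
  have Lc: "L \<subseteq> carrier G" using L by (rule subgroup.subset)
  have "(L #> x) #> inv k = L #> x \<longleftrightarrow> L #> (x \<otimes> inv k) = L #> x"
    using x k Lc by (simp add: coset_mult_assoc)
  also have "\<dots> \<longleftrightarrow> x \<in> L #> (x \<otimes> inv k)"
    using L x k by (metis inv_closed m_closed rcos_self repr_independence)
  also have "\<dots> \<longleftrightarrow> x \<otimes> k \<otimes> inv x \<in> L"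
  proof -
    have "x \<in> L #> (x \<otimes> inv k) \<longleftrightarrow> x \<otimes> inv (x \<otimes> inv k) \<in> L"
      using subgroup.rcos_module[OF L is_group, of "x \<otimes> inv k" x] x k by simp
    then show ?thesis using x k by (simp add: inv_mult_group m_assoc)
  qed
  finally show ?thesis .
qed

lemma mark_pos_conjugate:
  assumes L: "subgroup L G" and K: "K \<subseteq> carrier G" and pos: "mark L K \<noteq> 0"
  obtains x where "x \<in> carrier G" "conjugate x K \<subseteq> L"
proof -
  have "{C \<in> rcosets L. \<forall>k\<in>K. C #> inv k = C} \<noteq> {}"
    using pos unfolding mark_def by (intro notI) simp
  then obtain C where C: "C \<in> rcosets L" "\<forall>k\<in>K. C #> inv k = C" by blast
  then obtain x where x: "x \<in> carrier G" "C = L #> x" by (auto simp: RCOSETS_def)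
  have "conjugate x K \<subseteq> L"
    using C(2) coset_fixed_iff[OF L x(1)] K by (auto simp: conjugate_def x(2) subsetD)
  with x(1) show thesis by (rule that)
qed

lemma mark_pos_same_card:
  assumes L: "subgroup L G" and K: "K \<subseteq> carrier G" and pos: "mark L K \<noteq> 0"
    and fin: "finite (carrier G)" and c: "card L \<le> card K"
  obtains x where "x \<in> carrier G" "conjugate x K = L"
proof -
  obtain x where x: "x \<in> carrier G" "conjugate x K \<subseteq> L" using mark_pos_conjugate[OF L K pos] .
  have "finite L" using subgroup.subset[OF L] fin by (rule finite_subset)
  then have "conjugate x K = L"
    using x card_conjugate[OF x(1) K] c by (intro card_seteq) auto
  with x(1) show thesis by (rule that)
qed

text \<open>A coset \<open>L #> x\<close> is fixed by \<open>K\<close> exactly when \<open>x\<close>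
  conjugates \<open>K\<close> into \<open>L\<close>, so the transporter on the right is the disjoint
  union of the fixed cosets.\<close>

lemma mark_mult_card:
  assumes L: "subgroup L G" and K: "K \<subseteq> carrier G" and fin: "finite (carrier G)"
  shows "mark L K * card L = card {x \<in> carrier G. conjugate x K \<subseteq> L}"
proof -
  let ?C = "{C \<in> rcosets L. \<forall>k\<in>K. C #> inv k = C}"
  have Lc: "L \<subseteq> carrier G" using L by (rule subgroup.subset)
  interpret A: finite_action G "rcosets L" "\<lambda>g C. C #> inv g" by (rule coset_action[OF L fin])
  have fx: "(\<forall>k\<in>K. (L #> x) #> inv k = L #> x) \<longleftrightarrow> conjugate x K \<subseteq> L"
    if "x \<in> carrier G" for x
    using coset_fixed_iff[OF L that] K by (auto simp: conjugate_def subsetD)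
  have "{x \<in> carrier G. conjugate x K \<subseteq> L} = \<Union>?C"
  proof (intro equalityI subsetI)
    fix x assume x: "x \<in> {x \<in> carrier G. conjugate x K \<subseteq> L}"
    then have "L #> x \<in> ?C" using fx[of x] Lc by (simp add: rcosetsI)
    moreover have "x \<in> L #> x" using x L by (simp add: rcos_self)
    ultimately show "x \<in> \<Union>?C" by blast
  next
    fix x assume "x \<in> \<Union>?C"
    then obtain C where C: "C \<in> ?C" "x \<in> C" by blast
    then obtain y where y: "y \<in> carrier G" "C = L #> y" by (auto simp: RCOSETS_def)
    have xc: "x \<in> carrier G" using C(2) y Lc r_coset_subset_G by blast
    have "C = L #> x" using repr_independence[OF _ y(1) L] C(2) y(2) by simp
    then show "x \<in> {x \<in> carrier G. conjugate x K \<subseteq> L}" using C(1) fx[OF xc] xc by simp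
  qed
  moreover have "card L * card ?C = card (\<Union>?C)"
  proof (rule card_partition)
    show "finite ?C" using A.finite_points by simp
    show "finite (\<Union>?C)" using calculation fin by (metis (no_types, lifting) finite_subset mem_Collect_eq subsetI)
    show "card c = card L" if "c \<in> ?C" for c using that card_rcosets_equal[OF _ Lc, of c] by simp
    show "c1 \<inter> c2 = {}" if "c1 \<in> ?C" "c2 \<in> ?C" "c1 \<noteq> c2" for c1 c2
      using that rcos_disjoint[OF L] by (auto simp: pairwise_def disjnt_def)
  qed
  ultimately show ?thesis by (simp add: mark_def mult.commute)
qed

text \<open>Between subgroups of equal order inclusion is equality, so the elements conjugating
  \<open>K\<close> into \<open>conjugate x K\<close> form a coset of the normalizer of
  \<open>K\<close>. The mark is thus the index of \<open>K\<close> in its normalizer, the unit by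
  which \<open>prescribe_marks\<close> can change a mark.\<close>

lemma mark_conjugate_eq:
  assumes K: "subgroup K G" and x: "x \<in> carrier G" and fin: "finite (carrier G)"
  shows "mark (conjugate x K) K * card K = card (setwise_normalizer K)"
proof -
  have Kc: "K \<subseteq> carrier G" using K by (rule subgroup.subset)
  have fK: "finite (conjugate x K)" using finite_subset[OF conjugate_subset[OF x Kc] fin] .
  have iff: "conjugate y K \<subseteq> conjugate x K \<longleftrightarrow> inv x \<otimes> y \<in> setwise_normalizer K" if y: "y \<in> carrier G" for y
  proof -
    have "conjugate y K \<subseteq> conjugate x K \<longleftrightarrow> conjugate y K = conjugate x K"
      using card_seteq[OF fK, of "conjugate y K"] card_conjugate[OF x Kc] card_conjugate[OF y Kc] by auto
    also have "\<dots> \<longleftrightarrow> conjugate (inv x \<otimes> y) K = K"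
    proof
      assume "conjugate y K = conjugate x K"
      then have "conjugate (inv x) (conjugate y K) = conjugate (inv x) (conjugate x K)" by simp
      then show "conjugate (inv x \<otimes> y) K = K" using x y Kc by (simp add: conjugate_conjugate)
    next
      assume "conjugate (inv x \<otimes> y) K = K"
      then have "conjugate x (conjugate (inv x \<otimes> y) K) = conjugate x K" by simp
      then show "conjugate y K = conjugate x K" using x y Kc by (simp add: conjugate_conjugate flip: m_assoc)
    qed
    finally show ?thesis using x y by (simp add: setwise_normalizer_def)
  qed
  have "bij_betw ((\<otimes>) (inv x)) {y \<in> carrier G. conjugate y K \<subseteq> conjugate x K} (setwise_normalizer K)"
  proof (rule bij_betwI[where g = "(\<otimes>) x"])
    show "(\<otimes>) x \<in> setwise_normalizer K \<rightarrow> {y \<in> carrier G. conjugate y K \<subseteq> conjugate x K}"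
      using iff x by (auto simp: setwise_normalizer_def simp flip: m_assoc)
  qed (use iff x in \<open>auto simp: setwise_normalizer_def simp flip: m_assoc\<close>)
  then show ?thesis
    using mark_mult_card[OF subgroup_conjugate[OF x K] Kc fin] card_conjugate[OF x Kc]
    by (metis bij_betw_same_card)
qed

text \<open>The disjoint union of \<open>b L\<close> copies of the transitive set with stabilizer
  \<open>L\<close>; the number in the middle separates the copies. Weights are natural numbers, so
  that this is an actual set and a correction of marks can only add orbits.\<close>

definition weighted_cosets :: "('a set \<Rightarrow> nat) \<Rightarrow> ('a set \<times> nat \<times> 'a set) set" where
  "weighted_cosets b = (SIGMA L:{L. subgroup L G}. {..<b L} \<times> rcosets L)"

definition coset_act :: "'a \<Rightarrow> 'a set \<times> nat \<times> 'a set \<Rightarrow> 'a set \<times> nat \<times> 'a set" where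
  "coset_act g = (\<lambda>(L, i, C). (L, i, C #> inv g))"

definition total_mark :: "('a set \<Rightarrow> nat) \<Rightarrow> 'a set \<Rightarrow> nat" where
  "total_mark b K = (\<Sum>L | subgroup L G. b L * mark L K)"

lemma weighted_action:
  assumes fin: "finite (carrier G)"
  shows "finite_action G (weighted_cosets b) coset_act"
proof -
  have A: "finite_action G (rcosets L) (\<lambda>g C. C #> inv g)" if "subgroup L G" for L
    using coset_action[OF that fin] .
  show ?thesis
  proof unfold_locales
    show "finite (weighted_cosets b)" unfolding weighted_cosets_def
      using finite_subgroups[OF fin] finite_action.finite_points[OF A] by (intro finite_SigmaI) auto
    show "coset_act g y \<in> weighted_cosets b" if "g \<in> carrier G" "y \<in> weighted_cosets b" for g y
      using that finite_action.act_closed[OF A] by (auto simp: weighted_cosets_def coset_act_def)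
    show "coset_act \<one> y = y" if "y \<in> weighted_cosets b" for y
      using that finite_action.act_one[OF A] by (auto simp: weighted_cosets_def coset_act_def)
    show "coset_act (g \<otimes> h) y = coset_act g (coset_act h y)"
      if "g \<in> carrier G" "h \<in> carrier G" "y \<in> weighted_cosets b" for g h y
      using that finite_action.act_mult[OF A] by (auto simp: weighted_cosets_def coset_act_def)
  qed (rule fin)
qed

lemma card_weighted_fixed:
  assumes fin: "finite (carrier G)"
  shows "card (finite_action.fixed (weighted_cosets b) coset_act K) = total_mark b K"
proof -
  interpret finite_action G "weighted_cosets b" coset_act by (rule weighted_action[OF fin])
  have "fixed K = (SIGMA L:{L. subgroup L G}. {..<b L} \<times> {C \<in> rcosets L. \<forall>k\<in>K. C #> inv k = C})"
    unfolding fixed_def by (auto simp: weighted_cosets_def coset_act_def)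
  moreover have "finite {C \<in> rcosets L. \<forall>k\<in>K. C #> inv k = C}" if "subgroup L G" for L
    using finite_action.finite_points[OF coset_action[OF that fin]] by simp
  ultimately show ?thesis
    using finite_subgroups[OF fin] by (simp add: total_mark_def mark_def)
qed

lemma card_weighted:
  assumes fin: "finite (carrier G)"
  shows "card (weighted_cosets b) = (\<Sum>L | subgroup L G. b L * (order G div card L))"
proof -
  have "card (weighted_cosets b) = (\<Sum>L | subgroup L G. b L * card (rcosets L))"
    unfolding weighted_cosets_def
    using finite_subgroups[OF fin] finite_action.finite_points[OF coset_action[OF _ fin]]
    by (subst card_SigmaI) auto
  also have "\<dots> = (\<Sum>L | subgroup L G. b L * (order G div card L))"
  proof (rule sum.cong[OF refl])
    fix L assume "L \<in> {L. subgroup L G}"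
    then have L: "subgroup L G" by simp
    have "card L > 0" using finite_subset[OF subgroup.subset[OF L] fin] subgroup.one_closed[OF L]
      by (auto simp: card_gt_0_iff)
    then show "b L * card (rcosets L) = b L * (order G div card L)"
      by (simp flip: lagrange[OF L])
  qed
  finally show ?thesis .
qed

lemma weighted_stab:
  assumes fin: "finite (carrier G)" and y: "y \<in> weighted_cosets b"
  shows "\<exists>L x. subgroup L G \<and> b L \<noteq> 0 \<and> x \<in> carrier G \<and>
    finite_action.stab G coset_act y = conjugate x L"
proof -
  interpret finite_action G "weighted_cosets b" coset_act by (rule weighted_action[OF fin])
  obtain L i x where L: "subgroup L G" "i < b L" and x: "x \<in> carrier G" "y = (L, i, L #> x)"
    using y by (auto simp: weighted_cosets_def RCOSETS_def)
  have "stab y = conjugate (inv x) L"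
  proof (intro equalityI subsetI)
    fix k assume "k \<in> stab y"
    then have k: "k \<in> carrier G" "x \<otimes> k \<otimes> inv x \<in> L"
      using coset_fixed_iff[OF L(1) x(1), of k] by (auto simp: stab_def x(2) coset_act_def)
    have "k = inv x \<otimes> (x \<otimes> k \<otimes> inv x) \<otimes> inv (inv x)"
      using k(1) x(1) by (simp add: m_assoc) (simp flip: m_assoc)
    then show "k \<in> conjugate (inv x) L" using k(2) unfolding conjugate_def by (rule image_eqI)
  next
    fix k assume "k \<in> conjugate (inv x) L"
    then obtain l where l: "l \<in> L" "k = inv x \<otimes> l \<otimes> x" using x(1) by (auto simp: conjugate_def)
    have lc: "l \<in> carrier G" using L(1) l(1) by (rule subgroup.mem_carrier)
    have "x \<otimes> k \<otimes> inv x = l" using l(2) lc x(1) by (simp add: m_assoc) (simp flip: m_assoc)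
    then show "k \<in> stab y"
      using coset_fixed_iff[OF L(1) x(1), of k] l lc x(1) by (simp add: stab_def x(2) coset_act_def)
  qed
  then show ?thesis using L x(1) by (intro exI[of _ L] exI[of _ "inv x"]) auto
qed

lemma total_mark_conjugate:
  assumes "finite (carrier G)" "x \<in> carrier G" "K \<subseteq> carrier G"
  shows "total_mark b (conjugate x K) = total_mark b K"
  using finite_action.card_fixed_conj[OF weighted_action[OF assms(1)] assms(2,3), of b]
  by (simp add: card_weighted_fixed[OF assms(1)] conjugate_def)

lemma setwise_normalizer_conjugate:
  assumes x: "x \<in> carrier G" and K: "K \<subseteq> carrier G"
  shows "setwise_normalizer (conjugate x K) = conjugate x (setwise_normalizer K)"
proof -
  have iff: "conjugate g (conjugate x K) = conjugate x K \<longleftrightarrow> conjugate (inv x \<otimes> g \<otimes> x) K = K"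
    if g: "g \<in> carrier G" for g
  proof
    assume "conjugate g (conjugate x K) = conjugate x K"
    then have "conjugate (inv x) (conjugate g (conjugate x K)) = conjugate (inv x) (conjugate x K)" by simp
    then show "conjugate (inv x \<otimes> g \<otimes> x) K = K" using x g K by (simp add: conjugate_conjugate m_assoc)
  next
    assume "conjugate (inv x \<otimes> g \<otimes> x) K = K"
    then have "conjugate x (conjugate (inv x \<otimes> g \<otimes> x) K) = conjugate x K" by simp
    moreover have "x \<otimes> (inv x \<otimes> g \<otimes> x) = g \<otimes> x" using x g by (simp flip: m_assoc)
    ultimately show "conjugate g (conjugate x K) = conjugate x K" using x g K by (simp add: conjugate_conjugate)
  qed
  show ?thesis
  proof (intro equalityI subsetI)
    fix g assume g: "g \<in> setwise_normalizer (conjugate x K)"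
    then have gc: "g \<in> carrier G" by (simp add: setwise_normalizer_def)
    have "inv x \<otimes> g \<otimes> x \<in> setwise_normalizer K"
      using g iff[OF gc] x gc by (simp add: setwise_normalizer_def)
    moreover have "g = x \<otimes> (inv x \<otimes> g \<otimes> x) \<otimes> inv x"
      using x gc by (simp add: m_assoc) (simp flip: m_assoc)
    ultimately show "g \<in> conjugate x (setwise_normalizer K)" unfolding conjugate_def by (rule image_eqI[rotated])
  next
    fix g assume "g \<in> conjugate x (setwise_normalizer K)"
    then obtain h where h: "h \<in> setwise_normalizer K" "g = x \<otimes> h \<otimes> inv x"
      by (auto simp: conjugate_def)
    have hc: "h \<in> carrier G" using h by (simp add: setwise_normalizer_def)
    have "inv x \<otimes> g \<otimes> x = h" using h(2) hc x by (simp add: m_assoc) (simp flip: m_assoc)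
    then show "g \<in> setwise_normalizer (conjugate x K)"
      using iff[of g] h hc x by (simp add: setwise_normalizer_def)
  qed
qed

text \<open>The weights are changed at one representative of each class in \<open>\<S>\<close> only. The added cosets have
  no points fixed by other subgroups of order at least \<open>k\<close>.\<close>

lemma prescribe_marks:
  assumes fin: "finite (carrier G)"
    and S: "\<And>K. K \<in> \<S> \<Longrightarrow> subgroup K G \<and> card K = k"
    and S_conj: "\<And>K x. K \<in> \<S> \<Longrightarrow> x \<in> carrier G \<Longrightarrow> conjugate x K \<in> \<S>"
    and V_conj: "\<And>K x. K \<in> \<S> \<Longrightarrow> x \<in> carrier G \<Longrightarrow> V (conjugate x K) = V K"
    and le: "\<And>K. K \<in> \<S> \<Longrightarrow> total_mark b0 K \<le> V K"
    and dvd: "\<And>K. K \<in> \<S> \<Longrightarrow> card (setwise_normalizer K) div k dvd V K - total_mark b0 K"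
  shows "\<exists>b. (\<forall>K\<in>\<S>. total_mark b K = V K) \<and> (\<forall>L. b0 L \<le> b L) \<and> (\<forall>L. L \<notin> \<S> \<longrightarrow> b L = b0 L) \<and>
    (\<forall>K. subgroup K G \<longrightarrow> k \<le> card K \<longrightarrow> K \<notin> \<S> \<longrightarrow> total_mark b K = total_mark b0 K)"
proof -
  define r where "r K = (SOME K'. \<exists>x\<in>carrier G. K' = conjugate x K)" for K
  \<comment> \<open>One further copy of the transitive set at a representative \<open>L\<close>
    raises its own mark by the index of \<open>L\<close> in its normalizer, so the number of copies
    is the deficit divided by this index.\<close>
  define c where "c L = (if L \<in> r ` \<S> then (V L - total_mark b0 L) div (card (setwise_normalizer L) div k) else 0)" for L
  have Sc: "K \<subseteq> carrier G" if "K \<in> \<S>" for K using S[OF that] subgroup.subset by blast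
  have r: "\<exists>x\<in>carrier G. r K = conjugate x K" for K
    unfolding r_def by (rule someI_ex) auto
  have rS: "r K \<in> \<S>" if "K \<in> \<S>" for K using r[of K] S_conj that by auto
  have r_conj: "r (conjugate x K) = r K" if K: "K \<in> \<S>" and x: "x \<in> carrier G" for K x
  proof -
    have "(\<exists>y\<in>carrier G. K' = conjugate y (conjugate x K)) \<longleftrightarrow> (\<exists>y\<in>carrier G. K' = conjugate y K)" for K'
    proof
      assume "\<exists>y\<in>carrier G. K' = conjugate y (conjugate x K)"
      then show "\<exists>y\<in>carrier G. K' = conjugate y K" using x Sc[OF K] by (auto simp: conjugate_conjugate)
    next
      assume "\<exists>y\<in>carrier G. K' = conjugate y K"
      then obtain y where y: "y \<in> carrier G" "K' = conjugate y K" by blast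
      then have "K' = conjugate (y \<otimes> inv x) (conjugate x K)"
        using x Sc[OF K] by (simp add: conjugate_conjugate m_assoc)
      then show "\<exists>y\<in>carrier G. K' = conjugate y (conjugate x K)" using x y by blast
    qed
    then show ?thesis by (simp add: r_def)
  qed
  have finS: "finite {L. subgroup L G}" by (rule finite_subgroups[OF fin])
  have zero: "c L * mark L K = 0"
    if L: "subgroup L G" and K: "subgroup K G" "k \<le> card K" and ne: "K \<notin> \<S> \<or> L \<noteq> r K" for L K
  proof (rule ccontr)
    assume a: "c L * mark L K \<noteq> 0"
    then have "L \<in> r ` \<S>" by (auto simp: c_def split: if_splits)
    then obtain K0 where K0: "K0 \<in> \<S>" "L = r K0" by blast
    have LS: "L \<in> \<S>" using K0 rS by simp
    have "mark L K \<noteq> 0" using a by simp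
    then obtain x where x: "x \<in> carrier G" "conjugate x K = L"
      using mark_pos_same_card[OF L subgroup.subset[OF K(1)] _ fin] S[OF LS] K(2) by auto
    have "conjugate (inv x) L = K" using x subgroup.subset[OF K(1)] by (auto simp: conjugate_conjugate)
    then have KS: "K \<in> \<S>" using S_conj[OF LS, of "inv x"] x(1) by simp
    have "r K = r L" using r_conj[OF KS x(1)] x(2) by simp
    also have "\<dots> = L"
    proof -
      obtain z where "z \<in> carrier G" "r K0 = conjugate z K0" using r by blast
      then have "r (r K0) = r K0" using r_conj[OF K0(1)] by simp
      then show ?thesis using K0(2) by simp
    qed
    finally show False using ne KS by simp
  qed
  have add: "total_mark (\<lambda>L. b0 L + c L) K = total_mark b0 K + (\<Sum>L | subgroup L G. c L * mark L K)" for K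
    by (simp add: total_mark_def sum.distrib algebra_simps)
  show ?thesis
  proof (intro exI[of _ "\<lambda>L. b0 L + c L"] conjI ballI allI impI)
    fix K assume K: "K \<in> \<S>"
    have sK: "subgroup K G" "card K = k" using S[OF K] by auto
    obtain x where x: "x \<in> carrier G" "r K = conjugate x K" using r by blast
    have "(\<Sum>L | subgroup L G. c L * mark L K) = (\<Sum>L\<in>{r K}. c L * mark L K)"
      by (rule sum.mono_neutral_right[OF finS]) (use zero sK S[OF rS[OF K]] in auto)
    also have "\<dots> = (V K - total_mark b0 K) div (card (setwise_normalizer K) div k) * mark (conjugate x K) K"
    proof -
      have "card (setwise_normalizer (conjugate x K)) = card (setwise_normalizer K)"
        unfolding setwise_normalizer_conjugate[OF x(1) Sc[OF K]]
        by (rule card_conjugate[OF x(1)]) (auto simp: setwise_normalizer_def)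
      then show ?thesis
        using x K V_conj[OF K x(1)] total_mark_conjugate[OF fin x(1) Sc[OF K], of b0]
        by (auto simp: c_def)
    qed
    also have "mark (conjugate x K) K = card (setwise_normalizer K) div k"
    proof -
      have "k > 0" using sK subgroup.one_closed[OF sK(1)] finite_subset[OF Sc[OF K] fin] by (auto simp: card_gt_0_iff)
      then show ?thesis using mark_conjugate_eq[OF sK(1) x(1) fin] sK(2)
        by (metis nonzero_mult_div_cancel_right not_gr0)
    qed
    also have "(V K - total_mark b0 K) div (card (setwise_normalizer K) div k) * (card (setwise_normalizer K) div k)
        = V K - total_mark b0 K"
      using dvd[OF K] by simp
    finally show "total_mark (\<lambda>L. b0 L + c L) K = V K" using le[OF K] add by simp
  next
    fix L assume "L \<notin> \<S>"
    then show "b0 L + c L = b0 L" using rS by (auto simp: c_def)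
  next
    fix K assume K: "subgroup K G" "k \<le> card K" "K \<notin> \<S>"
    have "(\<Sum>L | subgroup L G. c L * mark L K) = 0" using zero K by (intro sum.neutral) auto
    then show "total_mark (\<lambda>L. b0 L + c L) K = total_mark b0 K" using add by simp
  qed simp
qed

text \<open>The p-group \<open>K\<close> acts on the cosets of \<open>P\<close>, whose number is
  prime to p, so it fixes one, and a representative of a fixed coset conjugates \<open>K\<close>
  into \<open>P\<close>.\<close>

lemma p_subgroup_conjugate:
  assumes fin: "finite (carrier G)" and p: "Factorial_Ring.prime p"
    and P: "subgroup P G" "\<not> p dvd order G div card P"
    and K: "subgroup K G" "card K = p ^ j"
  obtains x where "x \<in> carrier G" "conjugate x K \<subseteq> P"
proof -
  interpret A: finite_action G "rcosets P" "\<lambda>g C. C #> inv g" by (rule coset_action[OF P(1) fin])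
  interpret B: finite_action "G\<lparr>carrier := K\<rparr>" "rcosets P" "\<lambda>g C. C #> inv g"
    by (rule A.restrict_action[OF K(1)])
  have "card P > 0" using finite_subset[OF subgroup.subset[OF P(1)] fin] subgroup.one_closed[OF P(1)]
    by (auto simp: card_gt_0_iff)
  then have "order G div card P = card (rcosets P)" by (simp flip: lagrange[OF P(1)])
  moreover have "[card (rcosets P) = card (B.fixed K)] (mod p)"
    using B.card_cong_fixed[OF p, of j] K(2) by (simp add: order_def)
  ultimately have "B.fixed K \<noteq> {}" using P(2) by (auto simp: cong_0_iff)
  then have "mark P K \<noteq> 0" using A.finite_points by (auto simp: mark_def B.fixed_def)
  then show thesis using mark_pos_conjugate[OF P(1) subgroup.subset[OF K(1)]] that by blast
qed

text \<open>\<open>P\<close> acts on its own cosets. Their number is divisible by p, hence so is the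
  number of fixed ones, and the coset \<open>P\<close> is fixed. Another fixed coset consists of
  normalizing elements outside \<open>P\<close>.\<close>

lemma normalizer_grows:
  assumes fin: "finite (carrier G)" and p: "Factorial_Ring.prime p" "order G = p ^ n"
    and P: "subgroup P G" "P \<noteq> carrier G"
  obtains x where "x \<in> carrier G" "x \<notin> P" "conjugate x P = P"
proof -
  have Pc: "P \<subseteq> carrier G" using P(1) by (rule subgroup.subset)
  interpret A: finite_action G "rcosets P" "\<lambda>g C. C #> inv g" by (rule coset_action[OF P(1) fin])
  interpret B: finite_action "G\<lparr>carrier := P\<rparr>" "rcosets P" "\<lambda>g C. C #> inv g"
    by (rule A.restrict_action[OF P(1)])
  have lag: "card (rcosets P) * card P = p ^ n" using lagrange[OF P(1)] p(2) by simp
  obtain j where j: "card P = p ^ j" using lag p(1) by (metis divides_primepow_nat dvd_triv_right)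
  obtain i where i: "card (rcosets P) = p ^ i" using lag p(1) by (metis divides_primepow_nat dvd_triv_left)
  have "i \<noteq> 0"
  proof
    assume "i = 0"
    then have "card P = card (carrier G)" using lag i p(2) by (simp add: order_def)
    then show False using P(2) card_subset_eq[OF fin Pc] by simp
  qed
  then have "[card (rcosets P) = 0] (mod p)" using i by (cases i) (auto simp: cong_0_iff)
  moreover have "[card (rcosets P) = card (B.fixed P)] (mod p)"
    using B.card_cong_fixed[OF p(1), of j] j by (simp add: order_def)
  ultimately have "p dvd card (B.fixed P)" by (metis cong_0_iff cong_sym cong_trans)
  moreover have "P \<in> B.fixed P"
    using subgroup.subgroup_in_rcosets[OF P(1) is_group] subgroup.m_inv_closed[OF P(1)] coset_join2[OF _ P(1)] Pc
    by (auto simp: B.fixed_def)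
  ultimately have "B.fixed P \<noteq> {P}" using p(1) by auto
  then obtain C where C: "C \<in> rcosets P" "\<forall>k\<in>P. C #> inv k = C" "C \<noteq> P"
    using \<open>P \<in> B.fixed P\<close> by (auto simp: B.fixed_def)
  then obtain x where x: "x \<in> carrier G" "C = P #> x" by (auto simp: RCOSETS_def)
  have "conjugate x P \<subseteq> P"
    using C(2) coset_fixed_iff[OF P(1) x(1)] Pc by (auto simp: conjugate_def x(2) subsetD)
  then have "conjugate x P = P"
    using finite_subset[OF Pc fin] card_conjugate[OF x(1) Pc] by (intro card_subset_eq) auto
  moreover have "x \<notin> P" using C(3) x coset_join2[OF x(1) P(1)] by auto
  ultimately show thesis using x(1) by (intro that)
qed

text \<open>The number of fixed points of conjugation is divisible by p, so there is a central
  \<open>x\<close> other than one. Its last nontrivial iterated p-th power is central as well and is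
  killed by p.\<close>

lemma p_group_central_element:
  assumes fin: "finite (carrier G)" and p: "Factorial_Ring.prime p" "order G = p ^ n" "n > 0"
  obtains y where "y \<in> carrier G" "y \<noteq> \<one>" "y [^] p = \<one>" "\<And>x. x \<in> carrier G \<Longrightarrow> x \<otimes> y \<otimes> inv x = y"
proof -
  interpret A: finite_action G "carrier G" "\<lambda>g x. g \<otimes> x \<otimes> inv g"
    by unfold_locales (auto simp: fin m_assoc inv_mult_group)
  have "[order G = card (A.fixed (carrier G))] (mod p)" using A.card_cong_fixed[OF p(1,2)] by (simp add: order_def)
  moreover have "[order G = 0] (mod p)" using p by (cases n) (auto simp: cong_0_iff)
  ultimately have "p dvd card (A.fixed (carrier G))" by (metis cong_0_iff cong_sym cong_trans)
  moreover have "\<one> \<in> A.fixed (carrier G)" by (simp add: A.fixed_def)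
  ultimately have "A.fixed (carrier G) \<noteq> {\<one>}" using p(1) by auto
  then obtain x where x: "x \<in> carrier G" "x \<noteq> \<one>" "\<And>g. g \<in> carrier G \<Longrightarrow> g \<otimes> x \<otimes> inv g = x"
    using \<open>\<one> \<in> A.fixed (carrier G)\<close> by (auto simp: A.fixed_def)
  define i where "i = (LEAST i. x [^] (p ^ i) = \<one>)"
  have "x [^] (p ^ n) = \<one>" using pow_order_eq_1[OF x(1)] p(2) by simp
  then have i: "x [^] (p ^ i) = \<one>" unfolding i_def by (rule LeastI)
  have "i \<noteq> 0" using i x(1,2) by (intro notI) simp
  then obtain j where j: "i = Suc j" by (cases i) auto
  have "x [^] (p ^ j) \<noteq> \<one>"
    using not_less_Least[of j "\<lambda>i. x [^] (p ^ i) = \<one>"] j by (simp add: i_def)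
  moreover have "(x [^] (p ^ j)) [^] p = \<one>" using i x(1) by (simp add: j nat_pow_pow mult.commute)
  moreover have "g \<otimes> x [^] m \<otimes> inv g = x [^] m" if g: "g \<in> carrier G" for g and m :: nat
  proof (induction m)
    case (Suc m)
    have "g \<otimes> x [^] Suc m \<otimes> inv g = (g \<otimes> x [^] m \<otimes> inv g) \<otimes> (g \<otimes> x \<otimes> inv g)"
      using g x(1) by (simp add: m_assoc) (simp flip: m_assoc)
    then show ?case using Suc x(3)[OF g] by simp
  qed (use g in simp)
  ultimately show thesis using x(1) by (intro that[of "x [^] (p ^ j)"]) auto
qed

text \<open>The index of \<open>J\<close> has no prime divisor: p is excluded because
  \<open>J\<close> contains \<open>P\<close>, and a prime q other than p because all elements of a
  Sylow q-subgroup have order prime to p and so lie in \<open>J\<close>.\<close>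

lemma generated_by_sylow_and_p':
  assumes fin: "finite (carrier G)" and p: "Factorial_Ring.prime p"
    and P: "subgroup P G" "\<not> p dvd order G div card P"
    and J: "subgroup J G" "P \<subseteq> J"
    and p': "\<And>g k. \<lbrakk>g \<in> carrier G; 0 < k; coprime k p; g [^] k = \<one>\<rbrakk> \<Longrightarrow> g \<in> J"
  shows "J = carrier G"
proof -
  have lagJ: "card (rcosets J) * card J = order G" by (rule lagrange[OF J(1)])
  have pos: "order G > 0" using fin one_closed by (auto simp: order_def card_gt_0_iff)
  have "card (rcosets J) = 1"
  proof (rule ccontr)
    assume "card (rcosets J) \<noteq> 1"
    then obtain q where q: "Factorial_Ring.prime q" "q dvd card (rcosets J)" using prime_factor_nat by blast
    show False
    proof (cases "q = p")
      case True
      have "card P dvd card J"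
      proof -
        have "subgroup P (G\<lparr>carrier := J\<rparr>)" using subgroup_incl[OF P(1) J(1) J(2)] .
        then show ?thesis
          using group.lagrange[OF subgroup.subgroup_is_group[OF J(1) is_group]]
            by (metis dvd_triv_right order_def partial_object.select_convs(1) partial_object.surjective partial_object.update_convs(1))
      qed
      then obtain c where c: "card J = card P * c" by blast
      have "card P > 0" using lagrange[OF P(1)] pos by (metis mult_0_right not_gr0)
      then have "order G div card P = card (rcosets J) * c"
        using lagJ c by (metis mult.assoc mult.commute nonzero_mult_div_cancel_left not_gr0)
      then show False using P(2) q True by simp
    next
      case False
      let ?a = "multiplicity q (order G)"
      have "q ^ ?a dvd order G" by (rule multiplicity_dvd)
      then obtain m where "order G = q ^ ?a * m" by blast
      then obtain Q where Q: "subgroup Q G" "card Q = q ^ ?a"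
        using sylow_thm[OF q(1) is_group _ fin] by blast
      have "Q \<subseteq> J"
      proof
        fix g assume g: "g \<in> Q"
        have gc: "g \<in> carrier G" using Q(1) g by (rule subgroup.mem_carrier)
        have "g [^]\<^bsub>G\<lparr>carrier := Q\<rparr>\<^esub> order (G\<lparr>carrier := Q\<rparr>) = \<one>\<^bsub>G\<lparr>carrier := Q\<rparr>\<^esub>"
          using group.pow_order_eq_1[OF subgroup.subgroup_is_group[OF Q(1) is_group]] g by simp
        then have "g [^] (q ^ ?a) = \<one>" using Q(2) by (simp add: order_def nat_pow_def)
        moreover have "coprime (q ^ ?a) p" using False p q(1) primes_coprime by auto
        moreover have "0 < q ^ ?a" using q(1) by (simp add: prime_gt_0_nat)
        ultimately show "g \<in> J" using p' gc by blast
      qed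
      then have "subgroup Q (G\<lparr>carrier := J\<rparr>)" using subgroup_incl[OF Q(1) J(1)] by blast
      then have "card Q dvd card J"
        using group.lagrange[OF subgroup.subgroup_is_group[OF J(1) is_group]]
          by (metis dvd_triv_right order_def partial_object.select_convs(1) partial_object.surjective partial_object.update_convs(1))
      then have "q * q ^ ?a dvd card (rcosets J) * card J" using q(2) Q(2) mult_dvd_mono by metis
      then have "q ^ Suc ?a dvd order G" using lagJ by simp
      then show False using pos q(1) by (metis Suc_n_not_le_n multiplicity_geI not_prime_unit not_gr0)
    qed
  qed
  then have "card J = card (carrier G)" using lagJ by (simp add: order_def)
  then show ?thesis using card_subset_eq[OF fin subgroup.subset[OF J(1)]] by simp
qed

lemma subgroup_setwise_normalizer:
  assumes K: "K \<subseteq> carrier G" shows "subgroup (setwise_normalizer K) G"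
proof (rule subgroupI)
  show "setwise_normalizer K \<noteq> {}" using K by (auto simp: setwise_normalizer_def intro!: exI[of _ \<one>])
  fix a assume a: "a \<in> setwise_normalizer K"
  then show "inv a \<in> setwise_normalizer K"
    using K conjugate_conjugate[of "inv a" a K] by (simp add: setwise_normalizer_def)
  fix b assume "b \<in> setwise_normalizer K"
  then show "a \<otimes> b \<in> setwise_normalizer K"
    using a K by (simp add: setwise_normalizer_def conjugate_conjugate[symmetric])
qed (auto simp: setwise_normalizer_def)

lemma normalizer_eq: assumes "K \<subseteq> carrier G" shows "normalizer G K = setwise_normalizer K"
proof -
  have "g <# K #> inv g = conjugate g K" for g
    by (auto simp: l_coset_def r_coset_def conjugate_def)
  then show ?thesis using assms by (auto simp: normalizer_def stabilizer_def setwise_normalizer_def)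
qed

lemma subset_setwise_normalizer:
  assumes K: "subgroup K G" shows "K \<subseteq> setwise_normalizer K"
proof
  fix a assume a: "a \<in> K"
  have ac: "a \<in> carrier G" using K a by (rule subgroup.mem_carrier)
  have sub: "conjugate b K \<subseteq> K" if "b \<in> K" for b
    using that subgroup.m_closed[OF K] subgroup.m_inv_closed[OF K] by (auto simp: conjugate_def)
  have "K = conjugate a (conjugate (inv a) K)" using ac subgroup.subset[OF K] by (simp add: conjugate_conjugate)
  also have "\<dots> \<subseteq> conjugate a K"
    using sub[OF subgroup.m_inv_closed[OF K a]] by (auto simp: conjugate_def)
  finally show "a \<in> setwise_normalizer K" using sub[OF a] ac by (auto simp: setwise_normalizer_def)
qed

lemma conjugate_eqI:
  assumes "finite K" "K \<subseteq> carrier G" "g \<in> carrier G" "conjugate g K \<subseteq> K"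
  shows "conjugate g K = K"
  using assms card_conjugate by (intro card_subset_eq) auto

end

section \<open>Morphisms of fusion systems\<close>

text \<open>The source acts on the image by left translation and the image is the orbit of one, so
  its size divides the order of the source.\<close>

lemma hom_image_p_group:
  assumes "group_hom G H h" and fin: "finite (carrier G)" and p: "Factorial_Ring.prime p" "order G = p ^ n"
  shows "\<exists>j. card (h ` carrier G) = p ^ j"
proof -
  interpret group_hom G H h by fact
  interpret A: finite_action G "h ` carrier G" "\<lambda>g y. h g \<otimes>\<^bsub>H\<^esub> y"
  proof unfold_locales
    fix g y assume "g \<in> carrier G" "y \<in> h ` carrier G"
    then show "h g \<otimes>\<^bsub>H\<^esub> y \<in> h ` carrier G" by (auto simp flip: hom_mult)
  next
    fix g h' y assume "g \<in> carrier G" "h' \<in> carrier G" "y \<in> h ` carrier G"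
    then show "h (g \<otimes>\<^bsub>G\<^esub> h') \<otimes>\<^bsub>H\<^esub> y = h g \<otimes>\<^bsub>H\<^esub> (h h' \<otimes>\<^bsub>H\<^esub> y)" by (auto simp: H.m_assoc)
  qed (use fin in auto)
  have one: "\<one>\<^bsub>H\<^esub> \<in> h ` carrier G" using hom_one by (metis G.one_closed image_eqI)
  have "A.orb \<one>\<^bsub>H\<^esub> = h ` carrier G" by (auto simp: A.orb_def)
  then have "card (h ` carrier G) dvd p ^ n" using A.card_orb[OF one] p(2) by (metis dvd_triv_left)
  then show ?thesis using divides_primepow_nat p(1) by blast
qed

section \<open>Elementary properties of morphisms and conjugacy in F\<close>

context fusion_system
begin

lemma finite_S: "finite (carrier S)"
proof -
  have "order S > 0" using p_group prime by (auto simp: prime_gt_0_nat)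
  then show ?thesis by (simp add: order_def card_gt_0_iff)
qed

lemma finite_sub: "subgroup P S \<Longrightarrow> finite P"
  using finite_subset[OF subgroup.subset finite_S] .

lemma p_subgroup: assumes "subgroup P S" shows "\<exists>j. card P = p ^ j"
proof -
  obtain n where "order S = p ^ n" using p_group by blast
  then have "card P dvd p ^ n" using lagrange[OF assms] by (metis dvd_triv_right)
  then show ?thesis using divides_primepow_nat prime by blast
qed

lemma F_dom: "\<phi> \<in> F P Q \<Longrightarrow> subgroup P S"
  and F_cod: "\<phi> \<in> F P Q \<Longrightarrow> subgroup Q S"
  using objects by auto

lemma F_mult: "\<phi> \<in> F P Q \<Longrightarrow> x \<in> P \<Longrightarrow> y \<in> P \<Longrightarrow> \<phi> (x \<otimes> y) = \<phi> x \<otimes> \<phi> y"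
  using injective_hom[of \<phi> P Q] by (auto simp: mon_def hom_def)

lemma F_inj: "\<phi> \<in> F P Q \<Longrightarrow> inj_on \<phi> P"
  using injective_hom[of \<phi> P Q] by (auto simp: mon_def)

lemma F_into: "\<phi> \<in> F P Q \<Longrightarrow> \<phi> ` P \<subseteq> Q"
  using injective_hom[of \<phi> P Q] by (auto simp: mon_def hom_def)

lemma F_ext: "\<phi> \<in> F P Q \<Longrightarrow> \<phi> \<in> extensional P"
  using injective_hom[of \<phi> P Q] by auto

lemma conj_map_image: "conj_map S g P ` P = conjugate g P"
  by (auto simp: conj_map_def conjugate_def)

lemma conj_in_F:
  "\<lbrakk>subgroup P S; subgroup Q S; g \<in> carrier S; conjugate g P \<subseteq> Q\<rbrakk> \<Longrightarrow> conj_map S g P \<in> F P Q"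
  using contains_trivial[of P Q] by (auto simp: trivial_fusion_def conj_map_image)

lemma incl_in_F:
  assumes "subgroup P S" "subgroup Q S" "P \<subseteq> Q" shows "(\<lambda>x\<in>P. x) \<in> F P Q"
proof -
  have "conj_map S \<one> P = (\<lambda>x\<in>P. x)"
    using subgroup.mem_carrier[OF assms(1)] by (auto simp: conj_map_def intro!: restrict_ext)
  then show ?thesis using conj_in_F[OF assms(1,2), of \<one>] assms(3) subgroup.subset[OF assms(1)] by simp
qed

lemma F_restrict:
  assumes "\<phi> \<in> F P Q" "subgroup R S" "R \<subseteq> P" shows "restrict \<phi> R \<in> F R Q"
proof -
  have "compose R \<phi> (\<lambda>x\<in>R. x) \<in> F R Q"
    using composition[OF incl_in_F[OF assms(2) F_dom[OF assms(1)] assms(3)] assms(1)] .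
  moreover have "compose R \<phi> (\<lambda>x\<in>R. x) = restrict \<phi> R"
    by (auto simp: compose_def intro!: restrict_ext)
  ultimately show ?thesis by simp
qed

text \<open>The inclusion in a factorization leaves values unchanged, so a morphism equals its
  isomorphism part, whose target must be the image. The inverse morphism is then forced to be
  \<open>inv_into\<close>.\<close>

lemma F_iso:
  assumes \<phi>: "\<phi> \<in> F P Q"
  shows "subgroup (\<phi> ` P) S" "\<phi> \<in> F P (\<phi> ` P)" "(\<lambda>y\<in>\<phi> ` P. inv_into P \<phi> y) \<in> F (\<phi> ` P) P"
    "\<phi> \<in> isomorphisms F P (\<phi> ` P)"
proof -
  obtain R \<psi> where R: "subgroup R S" "R \<subseteq> Q" "\<psi> \<in> isomorphisms F P R"
    and e: "\<phi> = compose P (\<lambda>x\<in>R. x) \<psi>"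
    using factorization[OF \<phi>] by blast
  have \<psi>F: "\<psi> \<in> F P R" using R(3) by (simp add: isomorphisms_def)
  have "\<phi> x = \<psi> x" if "x \<in> P" for x
    using that e F_into[OF \<psi>F] by (auto simp: compose_def)
  then have eq: "\<phi> = \<psi>" using extensionalityI[OF F_ext[OF \<phi>] F_ext[OF \<psi>F]] by blast
  obtain \<chi> where \<chi>: "\<chi> \<in> F R P" "compose P \<chi> \<phi> = (\<lambda>x\<in>P. x)" "compose R \<phi> \<chi> = (\<lambda>x\<in>R. x)"
    using R(3) eq by (auto simp: isomorphisms_def)
  have im: "\<phi> ` P = R"
  proof
    show "\<phi> ` P \<subseteq> R" using F_into \<psi>F eq by blast
    show "R \<subseteq> \<phi> ` P"
    proof
      fix y assume y: "y \<in> R"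
      then have "\<phi> (\<chi> y) = y" using \<chi>(3) by (metis compose_eq restrict_apply')
      moreover have "\<chi> y \<in> P" using F_into[OF \<chi>(1)] y by blast
      ultimately show "y \<in> \<phi> ` P" by (metis image_eqI)
    qed
  qed
  have "\<chi> = (\<lambda>y\<in>R. inv_into P \<phi> y)"
  proof (rule extensionalityI[OF F_ext[OF \<chi>(1)]])
    fix y assume y: "y \<in> R"
    then have "\<phi> (\<chi> y) = y" using \<chi>(3) by (metis compose_eq restrict_apply')
    moreover have "\<chi> y \<in> P" using F_into[OF \<chi>(1)] y by blast
    ultimately have "inv_into P \<phi> y = \<chi> y" using F_inj[OF \<phi>] by (metis inv_into_f_f)
    then show "\<chi> y = (\<lambda>y\<in>R. inv_into P \<phi> y) y" using y by simp
  qed auto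
  then show "subgroup (\<phi> ` P) S" "\<phi> \<in> F P (\<phi> ` P)" "(\<lambda>y\<in>\<phi> ` P. inv_into P \<phi> y) \<in> F (\<phi> ` P) P"
    "\<phi> \<in> isomorphisms F P (\<phi> ` P)"
    using R \<psi>F eq \<chi>(1) im by simp_all
qed

lemma F_corestrict:
  assumes "\<phi> \<in> F P Q" "subgroup R S" "\<phi> ` P \<subseteq> R" shows "\<phi> \<in> F P R"
proof -
  have "compose P (\<lambda>x\<in>\<phi> ` P. x) \<phi> \<in> F P R"
    using composition[OF F_iso(2)[OF assms(1)] incl_in_F[OF F_iso(1)[OF assms(1)] assms(2,3)]] .
  moreover have "compose P (\<lambda>x\<in>\<phi> ` P. x) \<phi> = \<phi>"
    by (rule extensionalityI[OF compose_extensional F_ext[OF assms(1)]]) (simp add: compose_def)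
  ultimately show ?thesis by simp
qed

definition fconj :: "'a set \<Rightarrow> 'a set \<Rightarrow> bool" where
  "fconj P Q \<longleftrightarrow> (\<exists>\<phi>\<in>F P (carrier S). \<phi> ` P = Q)"

lemma fconj_refl: "subgroup P S \<Longrightarrow> fconj P P"
  unfolding fconj_def by (rule bexI[OF _ incl_in_F[OF _ subgroup_self]]) (auto dest: subgroup.mem_carrier)

lemma fconj_sym: assumes "fconj P Q" shows "fconj Q P"
proof -
  obtain \<phi> where \<phi>: "\<phi> \<in> F P (carrier S)" "\<phi> ` P = Q" using assms by (auto simp: fconj_def)
  have i: "(\<lambda>y\<in>Q. inv_into P \<phi> y) \<in> F Q P" using F_iso(3)[OF \<phi>(1)] \<phi>(2) by simp
  then have "(\<lambda>y\<in>Q. inv_into P \<phi> y) \<in> F Q (carrier S)"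
    using F_into[OF i] by (intro F_corestrict[OF i]) (auto intro: subgroup_self subgroup.mem_carrier[OF F_dom[OF \<phi>(1)]])
  moreover have "(\<lambda>y\<in>Q. inv_into P \<phi> y) ` Q = P"
    using \<phi> F_inj[OF \<phi>(1)] by (auto simp: image_iff inv_into_into)
  ultimately show ?thesis unfolding fconj_def by (intro bexI[where x = "\<lambda>y\<in>Q. inv_into P \<phi> y"])
qed

lemma fconj_trans: assumes "fconj P Q" "fconj Q R" shows "fconj P R"
proof -
  obtain \<phi> \<psi> where \<phi>: "\<phi> \<in> F P (carrier S)" "\<phi> ` P = Q"
    and \<psi>: "\<psi> \<in> F Q (carrier S)" "\<psi> ` Q = R"
    using assms by (auto simp: fconj_def)
  have "compose P \<psi> \<phi> \<in> F P (carrier S)"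
    using composition[OF F_iso(2)[OF \<phi>(1)]] \<phi>(2) \<psi>(1) by simp
  moreover have "compose P \<psi> \<phi> ` P = R"
    using \<phi>(2) \<psi>(2) by (auto simp: compose_def image_image[symmetric])
  ultimately show ?thesis by (auto simp: fconj_def)
qed

lemma fconj_subgroup: "fconj P Q \<Longrightarrow> subgroup P S" "fconj P Q \<Longrightarrow> subgroup Q S"
  using F_dom F_iso(1) by (auto simp: fconj_def)

lemma fconj_iff: "isomorphisms F P Q \<noteq> {} \<longleftrightarrow> fconj P Q"
proof
  assume "isomorphisms F P Q \<noteq> {}"
  then obtain \<phi> \<psi>
    where \<phi>: "\<phi> \<in> F P Q" "\<psi> \<in> F Q P" "compose Q \<phi> \<psi> = (\<lambda>x\<in>Q. x)"
    by (auto simp: isomorphisms_def)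
  have "Q \<subseteq> \<phi> ` P"
  proof
    fix y assume y: "y \<in> Q"
    then have "\<phi> (\<psi> y) = y" using \<phi>(3) by (metis compose_eq restrict_apply')
    moreover have "\<psi> y \<in> P" using F_into[OF \<phi>(2)] y by blast
    ultimately show "y \<in> \<phi> ` P" by (metis image_eqI)
  qed
  then have "\<phi> ` P = Q" using F_into[OF \<phi>(1)] by blast
  moreover have "\<phi> \<in> F P (carrier S)"
    using F_into[OF \<phi>(1)] subgroup.subset[OF F_cod[OF \<phi>(1)]]
      by (intro F_corestrict[OF \<phi>(1) subgroup_self]) auto
  ultimately show "fconj P Q" by (auto simp: fconj_def)
next
  assume "fconj P Q"
  then show "isomorphisms F P Q \<noteq> {}" using F_iso(4) by (auto simp: fconj_def)
qed

lemma fconj_card: "fconj P Q \<Longrightarrow> card P = card Q"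
  unfolding fconj_def using card_image[OF F_inj] by metis

lemma exists_fully_normalized:
  assumes "subgroup P S"
  obtains Q where "fconj P Q" "fully_normalized S F Q"
proof -
  let ?C = "{Q. fconj P Q}"
  have "finite ?C"
    by (rule finite_subset[of _ "Pow (carrier S)"]) (use finite_S subgroup.mem_carrier[OF fconj_subgroup(2)] in auto)
  then have fin: "finite ((\<lambda>Q. card (normalizer S Q)) ` ?C)" by simp
  have ne: "(\<lambda>Q. card (normalizer S Q)) ` ?C \<noteq> {}" using fconj_refl[OF assms] by auto
  obtain Q where Q: "fconj P Q" "card (normalizer S Q) = Max ((\<lambda>Q. card (normalizer S Q)) ` ?C)"
    using Max_in[OF fin ne] by (metis (no_types, lifting) imageE mem_Collect_eq)
  have "card (normalizer S R) \<le> card (normalizer S Q)" if "fconj Q R" for R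
    using Max_ge[OF fin, of "card (normalizer S R)"] fconj_trans[OF Q(1) that] Q(2) by auto
  then have "fully_normalized S F Q"
    using fconj_subgroup(2)[OF Q(1)] by (simp add: fully_normalized_def fconj_iff)
  with Q(1) show thesis by (rule that)
qed

lemma F_self_bij: assumes "\<phi> \<in> F P P" shows "bij_betw \<phi> P P"
  using endo_inj_surj[OF finite_sub[OF F_dom[OF assms]] F_into[OF assms] F_inj[OF assms]] F_inj[OF assms]
  by (simp add: bij_betw_def)

lemma isomorphisms_self: "isomorphisms F P P = F P P"
proof
  show "F P P \<subseteq> isomorphisms F P P"
  proof
    fix \<phi> assume \<phi>: "\<phi> \<in> F P P"
    then have "\<phi> ` P = P" using F_self_bij by (simp add: bij_betw_def)
    then show "\<phi> \<in> isomorphisms F P P" using F_iso(4)[OF \<phi>] by simp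
  qed
qed (auto simp: isomorphisms_def)

lemma F_self_Bij: "\<phi> \<in> F P P \<Longrightarrow> \<phi> \<in> Bij P"
  using F_self_bij F_ext by (simp add: Bij_def)

lemma carrier_aut_group [simp]: "carrier (aut_group F P) = F P P"
  by (simp add: aut_group_def isomorphisms_self)

lemma mult_aut_group: "\<phi> \<in> F P P \<Longrightarrow> \<psi> \<in> F P P \<Longrightarrow> \<phi> \<otimes>\<^bsub>aut_group F P\<^esub> \<psi> = compose P \<phi> \<psi>"
  using F_self_Bij by (simp add: aut_group_def BijGroup_def)

lemma one_aut_group: "\<one>\<^bsub>aut_group F P\<^esub> = (\<lambda>x\<in>P. x)"
  by (simp add: aut_group_def BijGroup_def)

lemma group_aut_group:
  assumes P: "subgroup P S" shows "group (aut_group F P)"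
proof -
  have "subgroup (F P P) (BijGroup P)"
  proof (rule group.subgroupI[OF group_BijGroup])
    show "F P P \<subseteq> carrier (BijGroup P)" using F_self_Bij by (auto simp: BijGroup_def)
    show "F P P \<noteq> {}" using incl_in_F[OF P P] by blast
    fix \<phi> assume \<phi>: "\<phi> \<in> F P P"
    have "\<phi> ` P = P" using F_self_bij[OF \<phi>] by (simp add: bij_betw_def)
    then show "inv\<^bsub>BijGroup P\<^esub> \<phi> \<in> F P P"
      using F_iso(3)[OF \<phi>] inv_BijGroup[OF F_self_Bij[OF \<phi>]] by simp
    fix \<psi> assume \<psi>: "\<psi> \<in> F P P"
    show "\<phi> \<otimes>\<^bsub>BijGroup P\<^esub> \<psi> \<in> F P P"
      using composition[OF \<psi> \<phi>] F_self_Bij[OF \<phi>] F_self_Bij[OF \<psi>] by (simp add: BijGroup_def)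
  qed
  from subgroup.subgroup_is_group[OF this group_BijGroup] show ?thesis
    by (simp add: aut_group_def isomorphisms_self)
qed

lemma finite_aut: assumes "subgroup P S" shows "finite (F P P)"
proof (rule finite_subset)
  show "F P P \<subseteq> P \<rightarrow>\<^sub>E P"
  proof
    fix \<phi> assume "\<phi> \<in> F P P"
    then show "\<phi> \<in> P \<rightarrow>\<^sub>E P"
      using F_into[of \<phi> P P] F_ext[of \<phi> P P] by (auto simp: PiE_def)
  qed
  show "finite (P \<rightarrow>\<^sub>E P)" using finite_sub[OF assms] by (intro finite_PiE)
qed

text \<open>Finiteness turns conjugation into \<open>P\<close> into conjugation onto
  \<open>P\<close>. This translates the automizer that occurs in both saturation axioms into
  elements of the normalizer.\<close>

lemma carrier_aut_trivial:
  assumes P: "subgroup P S"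
  shows "carrier (aut_group (trivial_fusion S) P) = (\<lambda>g. conj_map S g P) ` setwise_normalizer P"
proof (intro equalityI subsetI)
  fix \<phi> assume "\<phi> \<in> carrier (aut_group (trivial_fusion S) P)"
  then obtain g where g: "g \<in> carrier S" "conjugate g P \<subseteq> P" "\<phi> = conj_map S g P"
    by (auto simp: aut_group_def isomorphisms_def trivial_fusion_def conj_map_image)
  then have "g \<in> setwise_normalizer P"
    using conjugate_eqI[OF finite_sub[OF P] subgroup.subset[OF P]] by (simp add: setwise_normalizer_def)
  then show "\<phi> \<in> (\<lambda>g. conj_map S g P) ` setwise_normalizer P" using g by blast
next
  fix \<phi> assume "\<phi> \<in> (\<lambda>g. conj_map S g P) ` setwise_normalizer P"
  then obtain g where g: "g \<in> setwise_normalizer P" "\<phi> = conj_map S g P" by blast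
  have gc: "g \<in> carrier S" using g(1) by (auto simp: setwise_normalizer_def)
  have g': "inv g \<in> setwise_normalizer P"
    using subgroup.m_inv_closed[OF subgroup_setwise_normalizer[OF subgroup.subset[OF P]] g(1)] .
  have t: "conj_map S h P \<in> trivial_fusion S P P" if "h \<in> setwise_normalizer P" for h
    using that P by (auto simp: trivial_fusion_def setwise_normalizer_def conj_map_image)
  have c: "compose P (conj_map S h P) (conj_map S k P) = (\<lambda>x\<in>P. x)"
    if "h \<in> carrier S" "k \<in> setwise_normalizer P" "h \<otimes> k = \<one>" for h k
  proof -
    have kc: "k \<in> carrier S" and kP: "conjugate k P = P" using that(2) by (auto simp: setwise_normalizer_def)
    have "h \<otimes> (k \<otimes> x \<otimes> inv k) \<otimes> inv h = x" if x: "x \<in> carrier S" for x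
    proof -
      have "h \<otimes> (k \<otimes> x \<otimes> inv k) \<otimes> inv h = (h \<otimes> k) \<otimes> x \<otimes> inv (h \<otimes> k)"
        using \<open>h \<in> carrier S\<close> kc x
          by (simp add: m_assoc inv_mult_group del: \<open>h \<otimes> k = \<one>\<close>)
      then show ?thesis using \<open>h \<otimes> k = \<one>\<close> x by simp
    qed
    moreover have "k \<otimes> x \<otimes> inv k \<in> P" if "x \<in> P" for x
      using kP that by (auto simp: conjugate_def)
    ultimately show ?thesis
      using subgroup.mem_carrier[OF P] by (auto simp: compose_def conj_map_def intro!: restrict_ext)
  qed
  show "\<phi> \<in> carrier (aut_group (trivial_fusion S) P)"
    using t[OF g(1)] t[OF g'] c[OF _ g(1), of "inv g"] c[OF gc g'] gc g(2)
    by (auto simp: aut_group_def isomorphisms_def intro!: bexI[of _ "conj_map S (inv g) P"])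
qed

end

section \<open>Extension of morphisms in saturated systems\<close>

context saturated_fusion_system
begin

text \<open>The second saturation axiom in terms of elements: to put \<open>a\<close> into the
  extension domain it suffices to exhibit \<open>b\<close> in S whose conjugation corresponds to
  that of \<open>a\<close> under \<open>\<phi>\<close>, and such a \<open>b\<close> normalizes the
  image by finiteness. For \<open>a\<close> in \<open>Q\<close> the witness is
  \<open>\<phi> a\<close>.\<close>

lemma extend:
  assumes \<phi>: "\<phi> \<in> F Q (carrier S)" and fc: "fully_centralized S F (\<phi> ` Q)"
  obtains E \<psi> where "\<psi> \<in> F E (carrier S)" "Q \<subseteq> E" "E \<subseteq> setwise_normalizer Q"
    "\<And>u. u \<in> Q \<Longrightarrow> \<psi> u = \<phi> u"
    "\<And>a b. \<lbrakk>a \<in> setwise_normalizer Q; b \<in> carrier S;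
       \<And>u. u \<in> Q \<Longrightarrow> \<phi> (a \<otimes> u \<otimes> inv a) = b \<otimes> \<phi> u \<otimes> inv b\<rbrakk> \<Longrightarrow> a \<in> E"
proof -
  let ?E = "extension_domain S Q \<phi>"
  obtain \<psi> where \<psi>: "\<psi> \<in> F ?E (carrier S)" "restrict \<psi> Q = \<phi>"
    using extension[OF \<phi> fc] by blast
  have Q: "subgroup Q S" by (rule F_dom[OF \<phi>])
  have N: "normalizer S Q = setwise_normalizer Q" by (rule normalizer_eq[OF subgroup.subset[OF Q]])
  have Q': "subgroup (\<phi> ` Q) S" by (rule F_iso(1)[OF \<phi>])
  have mem: "a \<in> ?E" if a: "a \<in> setwise_normalizer Q" and b: "b \<in> carrier S"
    and eq: "\<And>u. u \<in> Q \<Longrightarrow> \<phi> (a \<otimes> u \<otimes> inv a) = b \<otimes> \<phi> u \<otimes> inv b" for a b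
  proof -
    have aQ: "a \<otimes> u \<otimes> inv a \<in> Q" if "u \<in> Q" for u
      using a that by (auto simp: setwise_normalizer_def conjugate_def)
    have "(\<lambda>y\<in>\<phi> ` Q. \<phi> (conj_map S a Q (inv_into Q \<phi> y))) = conj_map S b (\<phi> ` Q)"
      unfolding conj_map_def[of S b]
    proof (rule restrict_ext)
      fix y assume "y \<in> \<phi> ` Q"
      then obtain u where "u \<in> Q" "y = \<phi> u" by blast
      then show "\<phi> (conj_map S a Q (inv_into Q \<phi> y)) = b \<otimes> y \<otimes> inv b"
        using eq F_inj[OF \<phi>] by (simp add: conj_map_def)
    qed
    moreover have "b \<in> setwise_normalizer (\<phi> ` Q)"
    proof -
      have "conjugate b (\<phi> ` Q) \<subseteq> \<phi> ` Q" using eq aQ by (auto simp: conjugate_def simp flip: eq)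
      then show ?thesis using b conjugate_eqI[OF finite_sub[OF Q'] subgroup.subset[OF Q'] b]
        by (simp add: setwise_normalizer_def)
    qed
    ultimately show ?thesis using a by (auto simp: extension_domain_def N carrier_aut_trivial[OF Q'])
  qed
  show thesis
  proof (rule that[OF \<psi>(1)])
    show "Q \<subseteq> ?E"
    proof
      fix a assume a: "a \<in> Q"
      have im: "\<phi> (inv a) = inv (\<phi> a)"
      proof -
        have "\<phi> a \<otimes> \<phi> (inv a) = \<phi> (a \<otimes> inv a)"
          using a F_mult[OF \<phi>] subgroup.m_inv_closed[OF Q] by simp
        also have "\<dots> = \<phi> \<one>" using subgroup.mem_carrier[OF Q a] by simp
        also have "\<dots> = \<one>"
          using F_mult[OF \<phi>, of \<one> \<one>] subgroup.one_closed[OF Q] subgroup.mem_carrier[OF Q']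
            by (metis imageI l_cancel_one' one_closed r_one)
        finally show ?thesis
          using a subgroup.m_inv_closed[OF Q a] subgroup.mem_carrier[OF Q']
            by (metis imageI inv_equality inv_inv r_inv_ex m_closed inv_char)
      qed
      show "a \<in> ?E"
      proof (rule mem[of a "\<phi> a"])
        show "a \<in> setwise_normalizer Q" using subset_setwise_normalizer[OF Q] a by blast
        show "\<phi> a \<in> carrier S" using a subgroup.mem_carrier[OF Q'] by blast
        fix u assume u: "u \<in> Q"
        show "\<phi> (a \<otimes> u \<otimes> inv a) = \<phi> a \<otimes> \<phi> u \<otimes> inv (\<phi> a)"
          using a u F_mult[OF \<phi>] subgroup.m_inv_closed[OF Q a] subgroup.m_closed[OF Q a u] im by simp
      qed
    qed
    show "?E \<subseteq> setwise_normalizer Q" by (auto simp: extension_domain_def N)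
    show "\<psi> u = \<phi> u" if "u \<in> Q" for u using \<psi>(2) that by (metis restrict_apply')
  qed (rule mem)
qed

text \<open>Sylow's theorem in Aut(Q) makes the whole normalizer of P the extension domain of some
  isomorphism from P to Q.\<close>

lemma extend_normalizer:
  assumes PQ: "fconj P Q" and fn: "fully_normalized S F Q"
  obtains \<psi> where "\<psi> \<in> F (setwise_normalizer P) (carrier S)" "\<psi> ` P = Q"
proof -
  obtain \<phi> where \<phi>: "\<phi> \<in> F P (carrier S)" "\<phi> ` P = Q" using PQ by (auto simp: fconj_def)
  have \<phi>': "\<phi> \<in> F P Q" using F_iso(2)[OF \<phi>(1)] \<phi>(2) by simp
  have P: "subgroup P S" and Q: "subgroup Q S" using fconj_subgroup[OF PQ] by auto
  have sN: "subgroup (setwise_normalizer P) S" using subgroup_setwise_normalizer[OF subgroup.subset[OF P]] .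
  let ?A = "aut_group F Q" and ?N = "S\<lparr>carrier := setwise_normalizer P\<rparr>"
  interpret A: group ?A by (rule group_aut_group[OF Q])
  define \<iota> where "\<iota> y = inv_into P \<phi> y" for y
  have \<iota>1: "\<iota> (\<phi> u) = u" if "u \<in> P" for u using that F_inj[OF \<phi>(1)] by (simp add: \<iota>_def)
  have \<iota>2: "\<iota> y \<in> P" "\<phi> (\<iota> y) = y" if "y \<in> Q" for y
    using that \<phi>(2) by (auto simp: \<iota>_def inv_into_into f_inv_into_f)
  have \<iota>F: "(\<lambda>y\<in>Q. \<iota> y) \<in> F Q P"
    using F_iso(3)[OF \<phi>(1)] \<phi>(2) by (simp add: \<iota>_def)
  \<comment> \<open>\<open>k a\<close> is conjugation by \<open>a\<close> transported to
    \<open>Q\<close> along \<open>\<phi>\<close>; these maps form a p-subgroup of the automorphism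
    group of \<open>Q\<close>.\<close>
  define k where "k a = (\<lambda>y\<in>Q. \<phi> (a \<otimes> \<iota> y \<otimes> inv a))" for a
  have aP: "a \<otimes> u \<otimes> inv a \<in> P" if "a \<in> setwise_normalizer P" "u \<in> P" for a u
    using that by (auto simp: setwise_normalizer_def conjugate_def)
  have kF: "k a \<in> F Q Q" if a: "a \<in> setwise_normalizer P" for a
  proof -
    have "compose Q (compose P \<phi> (conj_map S a P)) (\<lambda>y\<in>Q. \<iota> y) \<in> F Q Q"
      using a P by (intro composition[OF \<iota>F composition[OF conj_in_F \<phi>']]) (auto simp: setwise_normalizer_def)
    moreover have "compose Q (compose P \<phi> (conj_map S a P)) (\<lambda>y\<in>Q. \<iota> y) = k a"
      using \<iota>2 by (auto simp: compose_def k_def conj_map_def intro!: restrict_ext)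
    ultimately show ?thesis by simp
  qed
  have "k \<in> hom ?N ?A"
  proof (rule homI)
    fix a b assume "a \<in> carrier ?N" "b \<in> carrier ?N"
    then have ab: "a \<in> setwise_normalizer P" "b \<in> setwise_normalizer P" by auto
    then have c: "a \<in> carrier S" "b \<in> carrier S" by (auto simp: setwise_normalizer_def)
    have "k (a \<otimes> b) = compose Q (k a) (k b)"
      unfolding k_def[of "a \<otimes> b"] compose_def
    proof (rule restrict_ext)
      fix y assume y: "y \<in> Q"
      have u: "b \<otimes> \<iota> y \<otimes> inv b \<in> P" using aP ab \<iota>2 y by blast
      have "\<phi> (b \<otimes> \<iota> y \<otimes> inv b) \<in> Q" using u \<phi>(2) by blast
      then show "\<phi> (a \<otimes> b \<otimes> \<iota> y \<otimes> inv (a \<otimes> b)) = k a (k b y)"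
        using y u c \<iota>1 subgroup.mem_carrier[OF P \<iota>2(1)[OF y]] by (simp add: k_def inv_mult_group m_assoc)
    qed
    then show "k (a \<otimes>\<^bsub>?N\<^esub> b) = k a \<otimes>\<^bsub>?A\<^esub> k b"
      using kF ab by (simp add: mult_aut_group)
  qed (use kF in auto)
  then have gh: "group_hom ?N ?A k"
    using subgroup.subgroup_is_group[OF sN is_group] A.is_group by (simp add: group_hom_def group_hom_axioms_def)
  let ?K = "k ` setwise_normalizer P"
  have K: "subgroup ?K ?A" using group_hom.img_is_subgroup[OF gh] by simp
  obtain n where "card (setwise_normalizer P) = p ^ n" using p_subgroup[OF sN] by blast
  then obtain j where j: "card ?K = p ^ j"
    using hom_image_p_group[OF gh _ prime, of n] finite_sub[OF sN] by (auto simp: order_def)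
  let ?T = "carrier (aut_group (trivial_fusion S) Q)"
  have syl: "sylow_subgroup p ?A ?T" by (rule fully_normalized_sylow[OF fn])
  then have T: "subgroup ?T ?A" by (simp add: sylow_subgroup_def)
  have finA: "finite (carrier ?A)" using finite_aut[OF Q] by simp
  obtain x where x: "x \<in> F Q Q" "A.conjugate x ?K \<subseteq> ?T"
    using A.p_subgroup_conjugate[OF finA prime T sylow_index[OF A.is_group finA prime syl] K j] by auto
  \<comment> \<open>Composing with \<open>x\<close> moves all transported conjugations into the
    automizer of \<open>Q\<close> in S, so that every \<open>a\<close> in the normalizer of
    \<open>P\<close> satisfies the criterion of \<open>extend\<close>.\<close>
  define \<chi> where "\<chi> = compose P x \<phi>"
  have \<chi>Q: "\<chi> \<in> F P Q" unfolding \<chi>_def by (rule composition[OF \<phi>' x(1)])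
  have \<chi>: "\<chi> \<in> F P (carrier S)" 
    by (rule F_corestrict[OF \<chi>Q subgroup_self]) (use F_into[OF \<chi>Q] subgroup.subset[OF Q] in blast)
  have im: "\<chi> ` P = Q"
    using \<phi>(2) F_self_bij[OF x(1)] by (auto simp: \<chi>_def compose_def bij_betw_def image_image[symmetric])
  have b: "\<exists>b\<in>carrier S. \<forall>u\<in>P. \<chi> (a \<otimes> u \<otimes> inv a) = b \<otimes> \<chi> u \<otimes> inv b" if a: "a \<in> setwise_normalizer P" for a
  proof -
    have "x \<otimes>\<^bsub>?A\<^esub> k a \<otimes>\<^bsub>?A\<^esub> inv\<^bsub>?A\<^esub> x \<in> ?T"
      using x(2) a by (auto simp: A.conjugate_def)
    then obtain b where b: "b \<in> setwise_normalizer Q" "x \<otimes>\<^bsub>?A\<^esub> k a \<otimes>\<^bsub>?A\<^esub> inv\<^bsub>?A\<^esub> x = conj_map S b Q"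
      unfolding carrier_aut_trivial[OF Q] by blast
    have bF: "conj_map S b Q \<in> F Q Q" using b(1) Q by (intro conj_in_F) (auto simp: setwise_normalizer_def)
    have xc: "x \<in> carrier ?A" and kc: "k a \<in> carrier ?A" using x(1) kF[OF a] by simp_all
    have "conj_map S b Q \<otimes>\<^bsub>?A\<^esub> x = x \<otimes>\<^bsub>?A\<^esub> k a"
      unfolding b(2)[symmetric] using xc kc by (simp add: A.m_assoc del: carrier_aut_group)
    then have c: "compose Q (conj_map S b Q) x = compose Q x (k a)"
      using x(1) kF[OF a] bF by (simp add: mult_aut_group)
    have "\<chi> (a \<otimes> u \<otimes> inv a) = b \<otimes> \<chi> u \<otimes> inv b" if u: "u \<in> P" for u
    proof -
      have yQ: "\<phi> u \<in> Q" using u \<phi>(2) by blast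
      have "x (\<phi> u) \<in> Q" using F_into[OF x(1)] yQ by blast
      then have "conj_map S b Q (x (\<phi> u)) = b \<otimes> x (\<phi> u) \<otimes> inv b" by (simp add: conj_map_def)
      moreover have "conj_map S b Q (x (\<phi> u)) = x (k a (\<phi> u))" using c yQ by (metis compose_eq)
      ultimately show ?thesis using u aP[OF a u] yQ \<iota>1[OF u] by (simp add: \<chi>_def compose_def k_def)
    qed
    then show ?thesis using b(1) by (auto simp: setwise_normalizer_def)
  qed
  obtain E \<psi> where E: "\<psi> \<in> F E (carrier S)" "P \<subseteq> E" "E \<subseteq> setwise_normalizer P"
    "\<And>u. u \<in> P \<Longrightarrow> \<psi> u = \<chi> u"
    "\<And>a b. \<lbrakk>a \<in> setwise_normalizer P; b \<in> carrier S;
       \<And>u. u \<in> P \<Longrightarrow> \<chi> (a \<otimes> u \<otimes> inv a) = b \<otimes> \<chi> u \<otimes> inv b\<rbrakk> \<Longrightarrow> a \<in> E"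
    using extend[OF \<chi>] fully_normalized_centralized[OF fn] im by metis
  have "setwise_normalizer P \<subseteq> E" using b E(5) by blast
  then have "E = setwise_normalizer P" using E(3) by (rule equalityI[rotated])
  then have "\<psi> \<in> F (setwise_normalizer P) (carrier S)" using E(1) by simp
  moreover have "\<psi> ` P = Q" using im E(4) by auto
  ultimately show thesis by (rule that)
qed

end

section \<open>Calculus of labels\<close>

context fusion_system
begin

text \<open>The label of a linked morphism is an element of S that the morphism would have to induce, were
  p'-automorphisms to act like the identity.\<close>

inductive linked :: "'a set \<Rightarrow> ('a \<Rightarrow> 'a) \<Rightarrow> 'a \<Rightarrow> bool" where
  linked_p': "\<lbrakk>\<alpha> \<in> F P P; 0 < k; coprime k p; \<forall>x\<in>P. (\<alpha> ^^ k) x = x; subgroup Q S; Q \<subseteq> P;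
    \<forall>x\<in>Q. f x = \<alpha> x\<rbrakk> \<Longrightarrow> linked Q f \<one>"
| linked_conj: "\<lbrakk>subgroup Q S; s \<in> carrier S; \<forall>x\<in>Q. f x = s \<otimes> x \<otimes> inv s\<rbrakk> \<Longrightarrow> linked Q f s"
| linked_comp: "\<lbrakk>linked Q f s; linked (f ` Q) g t; \<forall>x\<in>Q. h x = g (f x)\<rbrakk> \<Longrightarrow> linked Q h (t \<otimes> s)"

lemma linked_in_F:
  "linked Q f s \<Longrightarrow> subgroup Q S \<and> s \<in> carrier S \<and> restrict f Q \<in> F Q (carrier S)"
proof (induction rule: linked.induct)
  case (linked_p' \<alpha> P k Q f)
  have "\<alpha> \<in> F P (carrier S)"
    using F_corestrict[OF linked_p'(1) subgroup_self] F_into[OF linked_p'(1)]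
      subgroup.subset[OF F_dom[OF linked_p'(1)]] by blast
  then have "restrict \<alpha> Q \<in> F Q (carrier S)" using F_restrict linked_p' by blast
  moreover have "restrict \<alpha> Q = restrict f Q" using linked_p'(7) by (auto intro!: restrict_ext)
  ultimately have "restrict f Q \<in> F Q (carrier S)" by (simp only:)
  then show ?case using linked_p'(5) by (intro conjI one_closed)
next
  case (linked_conj Q s f)
  have "restrict f Q = conj_map S s Q"
    using linked_conj(3) by (auto simp: conj_map_def intro!: restrict_ext)
  then show ?case
    using conj_in_F[OF linked_conj(1) subgroup_self linked_conj(2)] linked_conj
      conjugate_subset[OF linked_conj(2) subgroup.subset[OF linked_conj(1)]] by simp
next
  case (linked_comp Q f s g t h)
  have f: "restrict f Q \<in> F Q (carrier S)" using linked_comp by blast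
  have im: "restrict f Q ` Q = f ` Q" by auto
  have "compose Q (restrict g (f ` Q)) (restrict f Q) \<in> F Q (carrier S)"
    using composition[OF F_iso(2)[OF f, unfolded im]] linked_comp by blast
  moreover have "compose Q (restrict g (f ` Q)) (restrict f Q) = restrict h Q"
    using linked_comp by (auto simp: compose_def intro!: restrict_ext)
  ultimately have "restrict h Q \<in> F Q (carrier S)" by (simp only:)
  then show ?case using linked_comp by blast
qed

lemma linked_subgroup: "linked Q f s \<Longrightarrow> subgroup Q S"
  and linked_label: "linked Q f s \<Longrightarrow> s \<in> carrier S"
  and linked_F: "linked Q f s \<Longrightarrow> restrict f Q \<in> F Q (carrier S)"
  using linked_in_F by auto

lemma linked_inj: "linked Q f s \<Longrightarrow> inj_on f Q"
  using F_inj[OF linked_F] by (simp add: inj_on_def)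

lemma linked_mult: "linked Q f s \<Longrightarrow> x \<in> Q \<Longrightarrow> y \<in> Q \<Longrightarrow> f (x \<otimes> y) = f x \<otimes> f y"
  using F_mult[OF linked_F, of Q f s x y] subgroup.m_closed[OF linked_subgroup, of Q f s x y] by simp

lemma linked_image: assumes "linked Q f s" shows "subgroup (f ` Q) S"
proof -
  have "restrict f Q ` Q = f ` Q" by auto
  then show ?thesis using F_iso(1)[OF linked_F[OF assms]] by simp
qed

lemma linked_closed: "linked Q f s \<Longrightarrow> x \<in> Q \<Longrightarrow> f x \<in> carrier S"
  using subgroup.mem_carrier[OF linked_image] by blast

lemma linked_one: assumes "linked Q f s" shows "f \<one> = \<one>"
proof -
  have 1: "\<one> \<in> Q" using subgroup.one_closed[OF linked_subgroup[OF assms]] .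
  have "f \<one> \<otimes> f \<one> = f \<one>" using linked_mult[OF assms 1 1] by simp
  then show ?thesis using linked_closed[OF assms 1] by simp
qed

lemma linked_inv_elem: assumes "linked Q f s" "x \<in> Q" shows "f (inv x) = inv (f x)"
proof -
  have ix: "inv x \<in> Q" using subgroup.m_inv_closed[OF linked_subgroup[OF assms(1)] assms(2)] .
  have xc: "x \<in> carrier S" using subgroup.mem_carrier[OF linked_subgroup[OF assms(1)] assms(2)] .
  have "f (inv x) \<otimes> f x = \<one>" using linked_mult[OF assms(1) ix assms(2)] xc linked_one[OF assms(1)] by simp
  then show ?thesis using linked_closed[OF assms(1)] ix assms(2) by (metis inv_equality)
qed

lemma linked_fconj: assumes "linked Q f s" shows "fconj Q (f ` Q)"
proof -
  have "restrict f Q ` Q = f ` Q" by auto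
  then show ?thesis unfolding fconj_def using linked_F[OF assms] by blast
qed

lemma linked_id: "subgroup Q S \<Longrightarrow> \<forall>x\<in>Q. f x = x \<Longrightarrow> linked Q f \<one>"
  by (rule linked_conj) (auto dest: subgroup.mem_carrier)

lemma linked_cong:
  assumes "linked Q f s" "\<And>x. x \<in> Q \<Longrightarrow> g x = f x" shows "linked Q g s"
proof -
  have "linked (f ` Q) (\<lambda>x. x) \<one>" using linked_image[OF assms(1)] by (intro linked_id) auto
  then have "linked Q g (\<one> \<otimes> s)" using assms by (intro linked_comp[OF assms(1)]) auto
  then show ?thesis using linked_label[OF assms(1)] by simp
qed

lemma linked_restrict: "linked Q f s \<Longrightarrow> subgroup R S \<Longrightarrow> R \<subseteq> Q \<Longrightarrow> linked R f s"
proof (induction arbitrary: R rule: linked.induct)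
  case (linked_p' \<alpha> P k Q f)
  have "\<forall>x\<in>R. f x = \<alpha> x" "R \<subseteq> P" using linked_p' by auto
  then show ?case using linked.linked_p'[OF linked_p'(1-4) linked_p'(8)] by blast
next
  case (linked_conj Q s f)
  then show ?case by (intro linked.linked_conj) auto
next
  case (linked_comp Q f s g t h)
  have f: "linked R f s" using linked_comp by blast
  have "linked (f ` R) g t" using linked_comp linked_image[OF f] by blast
  then show ?case using linked_comp by (intro linked.linked_comp[OF f]) auto
qed

text \<open>Inversion respects each clause: an inverse automorphism has the same exponent
  \<open>k\<close>, conjugation inverts to conjugation by the inverse, and composites reverse their
  order together with their labels.\<close>

lemma linked_inv: "linked Q f s \<Longrightarrow> linked (f ` Q) (inv_into Q f) (inv s)"
proof (induction rule: linked.induct)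
  case (linked_p' \<alpha> P k Q f)
  have b: "bij_betw \<alpha> P P" by (rule F_self_bij[OF linked_p'(1)])
  define \<beta> where "\<beta> = (\<lambda>y\<in>P. inv_into P \<alpha> y)"
  have im: "\<alpha> ` P = P" using b by (simp add: bij_betw_def)
  have \<beta>: "\<beta> \<in> F P P" using F_iso(3)[OF linked_p'(1)] im by (simp add: \<beta>_def)
  have inv1: "\<beta> (\<alpha> x) = x" if "x \<in> P" for x using b that im by (auto simp: bij_betw_def \<beta>_def)
  have "(\<alpha> ^^ n) x \<in> P \<and> (\<beta> ^^ n) ((\<alpha> ^^ n) x) = x" if x: "x \<in> P" for n x
  proof (induction n)
    case (Suc n)
    then have "(\<alpha> ^^ Suc n) x \<in> P" using im by auto
    moreover have "(\<beta> ^^ Suc n) ((\<alpha> ^^ Suc n) x) = (\<beta> ^^ n) (\<beta> (\<alpha> ((\<alpha> ^^ n) x)))"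
      by (simp add: funpow_swap1)
    ultimately show ?case using Suc inv1 by simp
  qed (use x in simp)
  then have pow: "\<forall>x\<in>P. (\<beta> ^^ k) x = x" using linked_p'(4) by metis
  have fQ: "f ` Q = \<alpha> ` Q" using linked_p'(7) by auto
  have sub: "f ` Q \<subseteq> P" unfolding fQ using linked_p'(6) im by blast
  have lf: "linked Q f \<one>" using linked.linked_p'[OF linked_p'] .
  have "inv_into Q f y = \<beta> y" if yf: "y \<in> f ` Q" for y
  proof -
    obtain x where x: "x \<in> Q" "y = f x" using yf by blast
    then have "inv_into Q f y = x" using linked_inj[OF lf] by simp
    then show ?thesis using x inv1[of x] linked_p'(6,7) by auto
  qed
  then have "linked (f ` Q) (inv_into Q f) \<one>"
    using linked.linked_p'[OF \<beta> linked_p'(2,3) pow linked_image[OF lf] sub] by blast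
  then show ?case by simp
next
  case (linked_conj Q s f)
  have lf: "linked Q f s" using linked.linked_conj[OF linked_conj] .
  have "inv_into Q f y = inv s \<otimes> y \<otimes> inv (inv s)" if yf: "y \<in> f ` Q" for y
  proof -
    obtain x where x: "x \<in> Q" "y = f x" using yf by blast
    have xc: "x \<in> carrier S" using linked_conj(1) x(1) by (rule subgroup.mem_carrier)
    have "inv s \<otimes> (s \<otimes> x \<otimes> inv s) \<otimes> s = x"
      using linked_conj(2) xc by (simp add: m_assoc) (simp flip: m_assoc)
    moreover have "f x = s \<otimes> x \<otimes> inv s" using linked_conj(3) x(1) by blast
    moreover have "inv_into Q f (f x) = x" using linked_inj[OF lf] x(1) by (rule inv_into_f_f)
    ultimately show ?thesis using x(2) linked_conj(2) by simp
  qed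
  then show ?case using linked_conj(2) linked_image[OF lf] by (intro linked.linked_conj) auto
next
  case (linked_comp Q f s g t h)
  have h: "linked Q h (t \<otimes> s)" using linked.linked_comp[OF linked_comp(1-3)] .
  have im: "h ` Q = g ` f ` Q" using linked_comp(3) by auto
  have gi: "inv_into (f ` Q) g ` (g ` f ` Q) = f ` Q"
    using linked_inj[OF linked_comp(2)] by (auto simp: image_iff)
  have "linked (g ` f ` Q) (inv_into Q h) (inv s \<otimes> inv t)"
  proof (rule linked.linked_comp[OF linked_comp(5)])
    show "linked (inv_into (f ` Q) g ` (g ` f ` Q)) (inv_into Q f) (inv s)" using linked_comp(4) gi by simp
    show "\<forall>y\<in>g ` f ` Q. inv_into Q h y = inv_into Q f (inv_into (f ` Q) g y)"
    proof
      fix y assume "y \<in> g ` f ` Q"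
      then obtain x where x: "x \<in> Q" "y = g (f x)" by blast
      have "inv_into Q h y = x" using x linked_comp(3) linked_inj[OF h] by (metis inv_into_f_f)
      moreover have "inv_into Q f (inv_into (f ` Q) g y) = x"
        using x linked_inj[OF linked_comp(1)] linked_inj[OF linked_comp(2)] by simp
      ultimately show "inv_into Q h y = inv_into Q f (inv_into (f ` Q) g y)" by simp
    qed
  qed
  then show ?case
    using im linked_label[OF linked_comp(1)] linked_label[OF linked_comp(2)] by (simp add: inv_mult_group)
qed

text \<open>Labels are not unique. Composing \<open>f\<close> with its own inverse turns the
  difference of two labels into a label of an identity map, so only labels of identities have to be
  bounded.\<close>

lemma linked_labels:
  assumes "linked Q f s" "linked Q f t" shows "linked (f ` Q) (\<lambda>x. x) (s \<otimes> inv t)"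
proof -
  have i: "linked (f ` Q) (inv_into Q f) (inv t)" by (rule linked_inv[OF assms(2)])
  have "inv_into Q f ` f ` Q = Q" using linked_inj[OF assms(1)] by (auto simp: image_iff)
  then have "linked (f ` Q) (\<lambda>y. f (inv_into Q f y)) (s \<otimes> inv t)"
    using assms(1) by (intro linked_comp[OF i]) auto
  then show ?thesis by (rule linked_cong) (simp add: f_inv_into_f)
qed

end

section \<open>Alperin's fusion theorem\<close>

context saturated_fusion_system
begin

text \<open>The automorphisms that possess some label are closed under composition. They contain the
  automizer of \<open>Q\<close> in S, which is a Sylow subgroup because \<open>Q\<close> is fully
  normalized, and every element of order prime to p, with label one. By
  \<open>generated_by_sylow_and_p'\<close> these are all automorphisms.\<close>

lemma automorphism_linked:
  assumes fn: "fully_normalized S F Q" and \<phi>: "\<phi> \<in> F Q Q"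
  shows "\<exists>s. linked Q \<phi> s"
proof -
  have Q: "subgroup Q S" using F_dom[OF \<phi>] .
  let ?A = "aut_group F Q"
  interpret A: group ?A by (rule group_aut_group[OF Q])
  let ?T = "carrier (aut_group (trivial_fusion S) Q)"
  let ?J = "{\<phi> \<in> F Q Q. \<exists>s. linked Q \<phi> s}"
  have syl: "sylow_subgroup p ?A ?T" by (rule fully_normalized_sylow[OF fn])
  then have T: "subgroup ?T ?A" by (simp add: sylow_subgroup_def)
  have finA: "finite (carrier ?A)" using finite_aut[OF Q] by simp
  have im: "\<psi> ` Q = Q" if "\<psi> \<in> F Q Q" for \<psi> using F_self_bij[OF that] by (simp add: bij_betw_def)
  have J: "subgroup ?J ?A"
  proof (rule A.finite_mult_closed_subgroup[OF finA])
    show "?J \<subseteq> carrier ?A" by auto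
    show "?J \<noteq> {}" using incl_in_F[OF Q Q] linked_id[OF Q, of "\<lambda>x\<in>Q. x"] by auto
    fix \<psi> \<chi> assume "\<psi> \<in> ?J" "\<chi> \<in> ?J"
    then obtain s t where \<psi>F: "\<psi> \<in> F Q Q" and s: "linked Q \<psi> s" and \<chi>F: "\<chi> \<in> F Q Q"
      and t: "linked Q \<chi> t"
      by blast
    have "linked Q (compose Q \<psi> \<chi>) (s \<otimes> t)"
      using s im[OF \<chi>F] by (intro linked_comp[OF t]) (auto simp: compose_def)
    then show "\<psi> \<otimes>\<^bsub>?A\<^esub> \<chi> \<in> ?J"
      using \<psi>F \<chi>F composition[OF \<chi>F \<psi>F] by (auto simp: mult_aut_group)
  qed
  have TJ: "?T \<subseteq> ?J"
  proof
    fix \<psi> assume \<psi>T: "\<psi> \<in> ?T"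
    then obtain g where g: "g \<in> setwise_normalizer Q" "\<psi> = conj_map S g Q"
      unfolding carrier_aut_trivial[OF Q] by blast
    have "linked Q \<psi> g" using g Q by (intro linked_conj) (auto simp: setwise_normalizer_def conj_map_def)
    moreover have "\<psi> \<in> F Q Q" using g Q by (auto intro!: conj_in_F simp: setwise_normalizer_def)
    ultimately show "\<psi> \<in> ?J" by blast
  qed
  have "?J = carrier ?A"
  proof (rule A.generated_by_sylow_and_p'[OF finA prime T sylow_index[OF A.is_group finA prime syl] J TJ])
    fix \<psi> k assume \<psi>: "\<psi> \<in> carrier ?A"
      and k: "0 < k" "coprime k p" "\<psi> [^]\<^bsub>?A\<^esub> k = \<one>\<^bsub>?A\<^esub>"
    have \<psi>F: "\<psi> \<in> F Q Q" using \<psi> by simp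
    have pow: "(\<psi> [^]\<^bsub>?A\<^esub> (n::nat)) x = (\<psi> ^^ n) x" if "x \<in> Q" for n x
      using that
    proof (induction n arbitrary: x)
      case 0 then show ?case by (simp add: one_aut_group)
    next
      case (Suc n)
      have "\<psi> [^]\<^bsub>?A\<^esub> n \<in> F Q Q" using A.nat_pow_closed[OF \<psi>] by simp
      then have "(\<psi> [^]\<^bsub>?A\<^esub> Suc n) x = (\<psi> [^]\<^bsub>?A\<^esub> n) (\<psi> x)"
        using \<psi>F Suc.prems by (simp add: mult_aut_group compose_eq)
      moreover have "\<psi> x \<in> Q" using im[OF \<psi>F] Suc.prems by blast
      ultimately show ?case using Suc.IH by (simp add: funpow_swap1)
    qed
    have "\<forall>x\<in>Q. (\<psi> ^^ k) x = x" using pow k(3) by (simp add: one_aut_group flip: pow)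
    then have "linked Q \<psi> \<one>" using linked_p'[OF \<psi>F k(1,2) _ Q] by blast
    then show "\<psi> \<in> ?J" using \<psi>F by blast
  qed
  then show ?thesis using \<phi> by auto
qed

text \<open>Alperin's theorem by induction from large to small subgroups. \<open>Q\<close> and its
  image are both carried to a fully normalized \<open>R\<close> by morphisms that extend to
  normalizers. These are strictly larger for a proper subgroup and so are covered by induction; what
  remains is an automorphism of \<open>R\<close>.\<close>

theorem every_morphism_linked: "\<phi> \<in> F Q (carrier S) \<Longrightarrow> \<exists>s. linked Q \<phi> s"
proof (induction "card (carrier S) - card Q" arbitrary: Q \<phi> rule: less_induct)
  case (less Q \<phi>)
  have Q: "subgroup Q S" and \<phi>Q: "subgroup (\<phi> ` Q) S" using F_dom F_iso(1) less.prems by auto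
  have conj: "fconj Q (\<phi> ` Q)" using less.prems by (auto simp: fconj_def)
  obtain R where R: "fconj Q R" "fully_normalized S F R" using exists_fully_normalized[OF Q] .
  have R': "fconj (\<phi> ` Q) R" using fconj_trans[OF fconj_sym[OF conj] R(1)] .
  have sR: "subgroup R S" using fconj_subgroup R by blast
  have cS: "P = carrier S" if "subgroup P S" "card P = card (carrier S)" for P
    using card_subset_eq[OF finite_S subgroup.subset[OF that(1)] that(2)] .
  show ?case
  proof (cases "Q = carrier S")
    case True
    then have "R = Q" "\<phi> ` Q = Q" using cS sR \<phi>Q fconj_card[OF R(1)] fconj_card[OF conj] by metis+
    then show ?thesis using automorphism_linked R(2) less.prems True by simp
  next
    case False
    have step: "\<exists>\<psi> s. linked P \<psi> s \<and> \<psi> ` P = R"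
      if PR: "fconj P R" and PQ: "card P = card Q" for P
    proof -
      have P: "subgroup P S" using fconj_subgroup PR by blast
      have ne: "P \<noteq> carrier S" using False PQ cS[OF Q] by auto
      obtain \<psi> where \<psi>: "\<psi> \<in> F (setwise_normalizer P) (carrier S)" "\<psi> ` P = R"
        using extend_normalizer[OF PR R(2)] .
      obtain n where n: "order S = p ^ n" using p_group by blast
      obtain x where x: "x \<in> carrier S" "x \<notin> P" "conjugate x P = P"
        using normalizer_grows[OF finite_S prime n P ne] .
      have sub: "P \<subseteq> setwise_normalizer P" by (rule subset_setwise_normalizer[OF P])
      have N: "subgroup (setwise_normalizer P) S" using F_dom[OF \<psi>(1)] .
      have "x \<in> setwise_normalizer P" using x by (simp add: setwise_normalizer_def)
      then have "card P < card (setwise_normalizer P)"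
        using x(2) sub finite_sub[OF N] by (intro psubset_card_mono) auto
      moreover have "card (setwise_normalizer P) \<le> card (carrier S)"
        using subgroup.subset[OF N] finite_S by (intro card_mono)
      ultimately obtain s where "linked (setwise_normalizer P) \<psi> s"
        using less.hyps[OF _ \<psi>(1)] PQ by (metis diff_less_mono2 le_less_trans less_le_trans)
      then show ?thesis using linked_restrict P sub \<psi>(2) by blast
    qed
    obtain \<psi> s where \<psi>: "linked Q \<psi> s" "\<psi> ` Q = R" using step[OF R(1)] by blast
    obtain \<psi>' s' where \<psi>': "linked (\<phi> ` Q) \<psi>' s'" "\<psi>' ` (\<phi> ` Q) = R"
      using step[OF R'] fconj_card[OF conj] by auto
    have i: "linked R (inv_into Q \<psi>) (inv s)" using linked_inv[OF \<psi>(1)] \<psi>(2) by simp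
    have i': "linked R (inv_into (\<phi> ` Q) \<psi>') (inv s')" using linked_inv[OF \<psi>'(1)] \<psi>'(2) by simp
    have iim: "inv_into Q \<psi> ` R = Q" using \<psi>(2) linked_inj[OF \<psi>(1)] by (auto simp: image_iff)
    \<comment> \<open>The automorphism of \<open>R\<close> that closes the square formed by
      \<open>\<phi>\<close>, \<open>\<psi>\<close> and \<open>\<psi>'\<close>.\<close>
    let ?h = "compose R (compose Q (restrict \<psi>' (\<phi> ` Q)) \<phi>) (restrict (inv_into Q \<psi>) R)"
    have "restrict (inv_into Q \<psi>) R \<in> F R Q"
      using F_corestrict[OF linked_F[OF i] Q] iim by auto
    moreover have "compose Q (restrict \<psi>' (\<phi> ` Q)) \<phi> \<in> F Q R"
      using composition[OF F_iso(2)[OF less.prems] F_corestrict[OF linked_F[OF \<psi>'(1)] sR]] \<psi>'(2) by auto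
    ultimately have h: "?h \<in> F R R" by (rule composition)
    then obtain t where t: "linked R ?h t" using automorphism_linked[OF R(2)] by blast
    have him: "?h ` R = R" using F_self_bij[OF h] by (simp add: bij_betw_def)
    have "linked R (\<lambda>y. inv_into (\<phi> ` Q) \<psi>' (?h y)) (inv s' \<otimes> t)"
      using i' him by (intro linked_comp[OF t]) auto
    then have l: "linked Q (\<lambda>x. inv_into (\<phi> ` Q) \<psi>' (?h (\<psi> x))) (inv s' \<otimes> t \<otimes> s)"
      using \<psi>(2) by (intro linked_comp[OF \<psi>(1)]) auto
    have e: "inv_into (\<phi> ` Q) \<psi>' (?h (\<psi> x)) = \<phi> x" if x: "x \<in> Q" for x
    proof -
      have "\<psi> x \<in> R" using \<psi>(2) x by blast
      moreover have "inv_into Q \<psi> (\<psi> x) = x" using linked_inj[OF \<psi>(1)] x by simp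
      ultimately have "?h (\<psi> x) = \<psi>' (\<phi> x)" using x by (simp add: compose_def)
      then show ?thesis using linked_inj[OF \<psi>'(1)] x by simp
    qed
    have "linked Q \<phi> (inv s' \<otimes> t \<otimes> s)" by (rule linked_cong[OF l e[symmetric]])
    then show ?thesis by (rule exI)
  qed
qed

end

section \<open>Sets with invariant marks\<close>

context normal
begin

definition cg :: "'a \<Rightarrow> 'a \<Rightarrow> bool" where "cg x y \<longleftrightarrow> x \<otimes> inv y \<in> H"

lemma cg_refl [simp]: "x \<in> carrier G \<Longrightarrow> cg x x" by (simp add: cg_def)

lemma cg_sym: assumes "cg x y" "x \<in> carrier G" "y \<in> carrier G" shows "cg y x"
proof -
  have "inv (x \<otimes> inv y) \<in> H" using assms(1) by (simp add: cg_def)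
  then show ?thesis using assms by (simp add: cg_def inv_mult_group)
qed

lemma cg_trans:
  assumes "cg x y" "cg y z" "x \<in> carrier G" "y \<in> carrier G" "z \<in> carrier G" shows "cg x z"
proof -
  have "(x \<otimes> inv y) \<otimes> (y \<otimes> inv z) \<in> H" using assms by (simp add: cg_def)
  moreover have "(x \<otimes> inv y) \<otimes> (y \<otimes> inv z) = x \<otimes> inv z"
    using assms by (simp add: m_assoc) (simp flip: m_assoc)
  ultimately show ?thesis by (simp add: cg_def)
qed

lemma cg_mult:
  assumes "cg x x'" "cg y y'" and c: "x \<in> carrier G" "x' \<in> carrier G" "y \<in> carrier G" "y' \<in> carrier G"
  shows "cg (x \<otimes> y) (x' \<otimes> y')"
proof -
  have "(x \<otimes> (y \<otimes> inv y') \<otimes> inv x) \<otimes> (x \<otimes> inv x') \<in> H"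
    using assms inv_op_closed2[of x "y \<otimes> inv y'"] by (simp add: cg_def)
  moreover have "(x \<otimes> (y \<otimes> inv y') \<otimes> inv x) \<otimes> (x \<otimes> inv x') = (x \<otimes> y) \<otimes> inv (x' \<otimes> y')"
  proof -
    have "inv x \<otimes> (x \<otimes> inv x') = inv x'" using c by (simp flip: m_assoc)
    then show ?thesis using c by (simp add: m_assoc inv_mult_group)
  qed
  ultimately show ?thesis by (simp add: cg_def)
qed

lemma cg_inv:
  assumes "cg x y" and c: "x \<in> carrier G" "y \<in> carrier G" shows "cg (inv x) (inv y)"
proof -
  have "inv x \<otimes> (y \<otimes> inv x) \<otimes> x \<in> H"
    using cg_sym[OF assms] c inv_op_closed1 by (simp add: cg_def)
  moreover have "inv x \<otimes> (y \<otimes> inv x) \<otimes> x = inv x \<otimes> y" using c by (simp add: m_assoc)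
  ultimately show ?thesis using c by (simp add: cg_def)
qed

lemma cg_one: "h \<in> H \<Longrightarrow> cg h \<one>" by (simp add: cg_def)

lemma cg_one_iff: "x \<in> carrier G \<Longrightarrow> cg x \<one> \<longleftrightarrow> x \<in> H"
  by (simp add: cg_def)

lemma cg_conj:
  "cg s t \<Longrightarrow> cg x y \<Longrightarrow> s \<in> carrier G \<Longrightarrow> t \<in> carrier G \<Longrightarrow> x \<in> carrier G \<Longrightarrow> y \<in> carrier G \<Longrightarrow>
   cg (s \<otimes> x \<otimes> inv s) (t \<otimes> y \<otimes> inv t)"
  by (intro cg_mult cg_inv) auto

lemma cg_conj_mem: "s \<in> H \<Longrightarrow> x \<in> carrier G \<Longrightarrow> cg (s \<otimes> x \<otimes> inv s) x"
  using cg_conj[OF cg_one cg_refl, of s x] by simp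

end

lemma pullback_action:
  assumes gh: "group_hom G' G \<psi>" and A: "finite_action G Y act" and fin: "finite (carrier G')"
  shows "finite_action G' Y (\<lambda>g. act (\<psi> g))"
proof -
  interpret group_hom G' G \<psi> by fact
  interpret finite_action G Y act by fact
  show ?thesis by unfold_locales (use fin finite_points in \<open>auto simp: act_mult\<close>)
qed

context fusion_system
begin

text \<open>The second clause bounds the ambiguity of labels. It is called upon when saturation
  extends a map: the extension comes with an unrelated label, and in
  \<open>extend_to_diagonal\<close> the discrepancy is absorbed by an element of \<open>N\<close>
  and a centralizing one. It is stated for fully normalized subgroups because those are the targets
  there, and because \<open>centralizing_lam\<close> can extend maps into them when the clause is
  passed on to a smaller subgroup.\<close>

definition controls :: "'a set \<Rightarrow> bool" where
  "controls N \<longleftrightarrow> N \<lhd> S \<and>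
     (\<forall>Q f s. linked Q f s \<longrightarrow> (\<forall>u\<in>Q. f u \<otimes> inv (s \<otimes> u \<otimes> inv s) \<in> N)) \<and>
     (\<forall>Q s. fully_normalized S F Q \<longrightarrow> linked Q (\<lambda>x. x) s \<longrightarrow> (\<exists>n\<in>N. \<exists>z\<in>centralizer S Q. s = n \<otimes> z))"

end

section \<open>Pairs congruent modulo N and graphs of morphisms among them\<close>

locale controlled = saturated_fusion_system + 
  fixes N assumes controls: "controls N"
begin

sublocale N: normal N S using controls by (simp add: controls_def)

lemma N_carrier: "x \<in> N \<Longrightarrow> x \<in> carrier S" by (rule N.mem_carrier)

lemma finite_N: "finite N" by (rule finite_sub[OF N.subgroup_axioms])

lemma linked_cg: "linked Q f s \<Longrightarrow> u \<in> Q \<Longrightarrow> N.cg (f u) (s \<otimes> u \<otimes> inv s)"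
  using controls by (simp add: controls_def N.cg_def)

lemma label_identity:
  "fully_normalized S F Q \<Longrightarrow> linked Q (\<lambda>x. x) s \<Longrightarrow> \<exists>n\<in>N. \<exists>z\<in>centralizer S Q. s = n \<otimes> z"
  using controls unfolding controls_def by blast

definition D :: "('a \<times> 'a) set" where
  "D = {(u, v). u \<in> carrier S \<and> v \<in> carrier S \<and> N.cg u v}"

definition DG :: "('a \<times> 'a) monoid" where
  "DG = (S \<times>\<times> S)\<lparr>carrier := D\<rparr>"

lemma D_subgroup: "subgroup D (S \<times>\<times> S)"
proof (rule group.subgroupI[OF DirProd_group[OF is_group is_group]])
  show "D \<subseteq> carrier (S \<times>\<times> S)" by (auto simp: D_def)
  show "D \<noteq> {}" by (auto simp: D_def intro!: exI[of _ \<one>])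
  fix a assume "a \<in> D"
  then obtain u v where a: "a = (u, v)" "u \<in> carrier S" "v \<in> carrier S" "N.cg u v" by (auto simp: D_def)
  then show "inv\<^bsub>S \<times>\<times> S\<^esub> a \<in> D"
    using N.cg_inv by (simp add: D_def inv_DirProd[OF is_group is_group])
  fix b assume "b \<in> D"
  then show "a \<otimes>\<^bsub>S \<times>\<times> S\<^esub> b \<in> D" using a N.cg_mult by (auto simp: D_def)
qed

sublocale DG: group DG
  unfolding DG_def by (rule subgroup.subgroup_is_group[OF D_subgroup DirProd_group[OF is_group is_group]])

lemma carrier_DG [simp]: "carrier DG = D" by (simp add: DG_def)

lemma mult_DG [simp]: "(a, b) \<otimes>\<^bsub>DG\<^esub> (c, d) = (a \<otimes> c, b \<otimes> d)" by (simp add: DG_def)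

lemma one_DG [simp]: "\<one>\<^bsub>DG\<^esub> = (\<one>, \<one>)" by (simp add: DG_def DirProd_def)

lemma D_iff [simp]: "(u, v) \<in> D \<longleftrightarrow> u \<in> carrier S \<and> v \<in> carrier S \<and> N.cg u v" by (simp add: D_def)

lemma inv_DG [simp]: "(a, b) \<in> D \<Longrightarrow> inv\<^bsub>DG\<^esub> (a, b) = (inv a, inv b)"
  using N.cg_inv by (intro DG.inv_equality) auto

lemma finite_D: "finite (carrier DG)"
  by (rule finite_subset[of _ "carrier S \<times> carrier S"]) (auto simp: finite_S)

lemma D_diag: "u \<in> carrier S \<Longrightarrow> (u, u) \<in> D" by simp

lemma D_N: "z \<in> N \<Longrightarrow> (\<one>, z) \<in> D"
  using N.cg_sym[OF N.cg_one] N_carrier by simp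

lemma card_D: "order DG = card (carrier S) * card N"
proof -
  have "bij_betw (\<lambda>(u, z). (u, u \<otimes> z)) (carrier S \<times> N) D"
  proof (rule bij_betwI[where g = "\<lambda>(u, v). (u, inv u \<otimes> v)"])
    show "(\<lambda>(u, z). (u, u \<otimes> z)) \<in> carrier S \<times> N \<rightarrow> D"
    proof clarify
      fix u z assume u: "u \<in> carrier S" and z: "z \<in> N"
      have "N.cg (u \<otimes> \<one>) (u \<otimes> z)"
        using u z N_carrier N.cg_sym[OF N.cg_one[OF z]] by (intro N.cg_mult N.cg_refl) auto
      then show "(u, u \<otimes> z) \<in> D" using u z N_carrier by simp
    qed
    show "(\<lambda>(u, v). (u, inv u \<otimes> v)) \<in> D \<rightarrow> carrier S \<times> N"
    proof clarify
      fix u v assume "(u, v) \<in> D"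
      then have uv: "u \<in> carrier S" "v \<in> carrier S" "N.cg v u" using N.cg_sym by auto
      have "N.cg (inv u \<otimes> v) (inv u \<otimes> u)" using uv by (intro N.cg_mult N.cg_refl) auto
      then show "u \<in> carrier S \<and> inv u \<otimes> v \<in> N"
        using uv N.cg_one_iff[of "inv u \<otimes> v"] by simp
    qed
  qed (auto simp: N_carrier simp flip: m_assoc)
  then show ?thesis by (simp add: order_def card_cartesian_product flip: bij_betw_same_card)
qed

definition graph :: "'a set \<Rightarrow> ('a \<Rightarrow> 'a) \<Rightarrow> ('a \<times> 'a) set" where
  "graph Q f = (\<lambda>u. (u, f u)) ` Q"

text \<open>With a label in \<open>N\<close>, \<open>f\<close> is congruent to the identity modulo
  \<open>N\<close> by \<open>linked_cg\<close>, which is what puts its graph inside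
  \<open>D\<close>. The family is closed under subgroups and under conjugation in \<open>D\<close>,
  as befits the possible stabilizers of a D-set and their subgroups.\<close>

definition diagonals :: "('a \<times> 'a) set set" where
  "diagonals = {graph Q f | Q f s. linked Q f s \<and> s \<in> N}"

lemma fst_graph [simp]: "fst ` graph Q f = Q" by (force simp: graph_def)

lemma card_graph [simp]: "card (graph Q f) = card Q"
  unfolding graph_def by (rule card_image) (auto simp: inj_on_def)

lemma diagonalI: "linked Q f s \<Longrightarrow> s \<in> N \<Longrightarrow> graph Q f \<in> diagonals"
  by (auto simp: diagonals_def)

lemma graph_cong: "(\<And>u. u \<in> Q \<Longrightarrow> f u = g u) \<Longrightarrow> graph Q f = graph Q g"
  by (auto simp: graph_def)

lemma linked_cg_self: assumes "linked Q f s" "s \<in> N" "u \<in> Q" shows "N.cg u (f u)"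
proof -
  have c: "u \<in> carrier S" "f u \<in> carrier S" "s \<in> carrier S"
    using assms linked_closed linked_label subgroup.mem_carrier[OF linked_subgroup] by blast+
  have "N.cg (f u) u" 
    using N.cg_trans[OF linked_cg[OF assms(1,3)] N.cg_conj_mem[OF assms(2)]] c by simp
  then show ?thesis using N.cg_sym c by blast
qed

lemma diagonals_subgroup: assumes "L \<in> diagonals" shows "subgroup L DG"
proof -
  obtain Q f s where L: "linked Q f s" "s \<in> N" "L = graph Q f" using assms by (auto simp: diagonals_def)
  have Q: "subgroup Q S" using linked_subgroup[OF L(1)] .
  show ?thesis
  proof (rule DG.subgroupI)
    show sub: "L \<subseteq> carrier DG"
      using linked_cg_self[OF L(1,2)] linked_closed[OF L(1)] subgroup.mem_carrier[OF Q] by (auto simp: L(3) graph_def)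
    show "L \<noteq> {}" using subgroup.one_closed[OF Q] by (auto simp: L(3) graph_def)
    fix a assume "a \<in> L"
    then obtain u where u: "u \<in> Q" "a = (u, f u)" by (auto simp: L(3) graph_def)
    have "(u, f u) \<in> D" using sub u L(3) by (auto simp: graph_def)
    then have "inv\<^bsub>DG\<^esub> a = (inv u, f (inv u))" using u inv_DG linked_inv_elem[OF L(1)] by simp
    then show "inv\<^bsub>DG\<^esub> a \<in> L" using subgroup.m_inv_closed[OF Q u(1)] by (auto simp: L(3) graph_def)
    fix b assume "b \<in> L"
    then obtain v where v: "v \<in> Q" "b = (v, f v)" by (auto simp: L(3) graph_def)
    have "a \<otimes>\<^bsub>DG\<^esub> b = (u \<otimes> v, f (u \<otimes> v))" using u v linked_mult[OF L(1)] by simp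
    then show "a \<otimes>\<^bsub>DG\<^esub> b \<in> L"
      using subgroup.m_closed[OF Q u(1) v(1)] by (auto simp: L(3) graph_def)
  qed
qed

lemma diagonals_sub: assumes L: "L \<in> diagonals" and K: "subgroup K DG" "K \<subseteq> L" shows "K \<in> diagonals"
proof -
  obtain Q f s where Lf: "linked Q f s" "s \<in> N" "L = graph Q f" using L by (auto simp: diagonals_def)
  let ?R = "fst ` K"
  have RQ: "?R \<subseteq> Q" using K(2) by (auto simp: Lf(3) graph_def)
  have KR: "K = graph ?R f"
  proof
    show "K \<subseteq> graph ?R f"
    proof
      fix x assume x: "x \<in> K"
      then obtain u where "u \<in> Q" "x = (u, f u)" using K(2) by (auto simp: Lf(3) graph_def)
      then show "x \<in> graph ?R f" using x by (force simp: graph_def)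
    qed
    show "graph ?R f \<subseteq> K" using K(2) by (auto simp: Lf(3) graph_def)
  qed
  have "subgroup ?R S"
  proof (rule subgroupI)
    show "?R \<subseteq> carrier S" using RQ subgroup.subset[OF linked_subgroup[OF Lf(1)]] by blast
    show "?R \<noteq> {}" using subgroup.one_closed[OF K(1)] by auto
    fix a assume "a \<in> ?R"
    then obtain b where ab: "(a, b) \<in> K" by auto
    then have "(a, b) \<in> D" using subgroup.mem_carrier[OF K(1)] by auto
    then have "(inv a, inv b) \<in> K" using subgroup.m_inv_closed[OF K(1) ab] inv_DG by simp
    then show "inv a \<in> ?R" by force
    fix c assume "c \<in> ?R"
    then obtain d where cd: "(c, d) \<in> K" by auto
    have "(a \<otimes> c, b \<otimes> d) \<in> K" using subgroup.m_closed[OF K(1) ab cd] by simp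
    then show "a \<otimes> c \<in> ?R" by force
  qed
  then have "linked ?R f s" using linked_restrict[OF Lf(1) _ RQ] by blast
  then show ?thesis using diagonalI Lf(2) KR by metis
qed

text \<open>Congruent labels make the product of \<open>f1\<close> and \<open>f2\<close> send
  congruent pairs to congruent pairs. Conjugation by an element of \<open>D\<close> and a morphism
  paired with conjugation by its label are both of this kind.\<close>

definition compatible :: "'a set \<Rightarrow> ('a \<Rightarrow> 'a) \<Rightarrow> 'a \<Rightarrow> 'a set \<Rightarrow> ('a \<Rightarrow> 'a) \<Rightarrow> 'a \<Rightarrow> bool" where
  "compatible P1 f1 s1 P2 f2 s2 \<longleftrightarrow> linked P1 f1 s1 \<and> linked P2 f2 s2 \<and> N.cg s1 s2"

lemma compatible_D:
  assumes c: "compatible P1 f1 s1 P2 f2 s2" and uv: "(u, v) \<in> D" "u \<in> P1" "v \<in> P2"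
  shows "(f1 u, f2 v) \<in> D"
proof -
  have l: "linked P1 f1 s1" "linked P2 f2 s2" "N.cg s1 s2" using c by (auto simp: compatible_def)
  have cs: "s1 \<in> carrier S" "s2 \<in> carrier S" "f1 u \<in> carrier S" "f2 v \<in> carrier S" "u \<in> carrier S" "v \<in> carrier S"
    using l uv linked_label linked_closed by auto
  have 1: "N.cg (f1 u) (s1 \<otimes> u \<otimes> inv s1)" using linked_cg[OF l(1) uv(2)] .
  have 2: "N.cg (s1 \<otimes> u \<otimes> inv s1) (s2 \<otimes> v \<otimes> inv s2)"
    using N.cg_conj[OF l(3)] uv(1) cs by simp
  have 3: "N.cg (s2 \<otimes> v \<otimes> inv s2) (f2 v)" using N.cg_sym[OF linked_cg[OF l(2) uv(3)]] cs by simp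
  have "N.cg (f1 u) (f2 v)" using N.cg_trans[OF N.cg_trans[OF 1 2] 3] cs by simp
  then show ?thesis using cs by simp
qed

text \<open>The graph of \<open>f\<close> goes to the graph of the composite of the inverse of
  \<open>f1\<close>, then \<open>f\<close>, then \<open>f2\<close>. Its label
  \<open>s2 \<otimes> (s \<otimes> inv s1)\<close> is congruent to one, because \<open>s\<close>
  lies in \<open>N\<close> and \<open>s1\<close>, \<open>s2\<close> are congruent. On first
  projections the map is \<open>f1\<close>.\<close>

lemma compatible_diagonals:
  assumes c: "compatible P1 f1 s1 P2 f2 s2" and L: "L \<in> diagonals" "L \<subseteq> P1 \<times> P2"
  shows "map_prod f1 f2 ` L \<in> diagonals \<and> fconj (fst ` L) (fst ` map_prod f1 f2 ` L)"
proof -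
  have l: "linked P1 f1 s1" "linked P2 f2 s2" "N.cg s1 s2" using c by (auto simp: compatible_def)
  obtain Q f s where Lf: "linked Q f s" "s \<in> N" "L = graph Q f" using L by (auto simp: diagonals_def)
  have Q: "subgroup Q S" using linked_subgroup[OF Lf(1)] .
  have sub: "Q \<subseteq> P1" "f ` Q \<subseteq> P2" using L(2) by (auto simp: Lf(3) graph_def)
  have l1: "linked Q f1 s1" using linked_restrict[OF l(1) Q sub(1)] .
  have l2: "linked (f ` Q) f2 s2" using linked_restrict[OF l(2) linked_image[OF Lf(1)] sub(2)] .
  have i: "linked (f1 ` Q) (inv_into Q f1) (inv s1)" using linked_inv[OF l1] .
  have im: "inv_into Q f1 ` f1 ` Q = Q" using linked_inj[OF l1] by (auto simp: image_iff)
  have li: "linked (f1 ` Q) (\<lambda>y. f (inv_into Q f1 y)) (s \<otimes> inv s1)"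
    using Lf(1) im by (intro linked_comp[OF i]) auto
  have "(\<lambda>y. f (inv_into Q f1 y)) ` f1 ` Q = f ` Q" using im by (metis image_image)
  then have "linked ((\<lambda>y. f (inv_into Q f1 y)) ` f1 ` Q) f2 s2" using l2 by simp
  then have "linked (f1 ` Q) (\<lambda>y. f2 (f (inv_into Q f1 y))) (s2 \<otimes> (s \<otimes> inv s1))"
    by (rule linked_comp[OF li]) simp
  moreover have "s2 \<otimes> (s \<otimes> inv s1) \<in> N"
  proof -
    have cs: "s1 \<in> carrier S" "s2 \<in> carrier S" "s \<in> carrier S" using l Lf linked_label by auto
    have "N.cg (s2 \<otimes> (s \<otimes> inv s1)) (s1 \<otimes> (\<one> \<otimes> inv s1))"
      using cs N.cg_sym[OF l(3)] N.cg_one[OF Lf(2)] by (intro N.cg_mult N.cg_refl) auto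
    then show ?thesis using cs N.cg_one_iff by simp
  qed
  ultimately have "graph (f1 ` Q) (\<lambda>y. f2 (f (inv_into Q f1 y))) \<in> diagonals" by (rule diagonalI)
  moreover have "map_prod f1 f2 ` L = graph (f1 ` Q) (\<lambda>y. f2 (f (inv_into Q f1 y)))"
    using linked_inj[OF l1] by (auto simp: Lf(3) graph_def image_image)
  ultimately show ?thesis using linked_fconj[OF l1] by (simp add: Lf(3))
qed

lemma compatible_inv:
  assumes c: "compatible P1 f1 s1 P2 f2 s2"
  shows "compatible (f1 ` P1) (inv_into P1 f1) (inv s1) (f2 ` P2) (inv_into P2 f2) (inv s2)"
  using assms linked_inv N.cg_inv linked_label by (auto simp: compatible_def)

lemma compatible_diagonals_iff:
  assumes c: "compatible P1 f1 s1 P2 f2 s2" and L: "L \<subseteq> P1 \<times> P2"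
  shows "map_prod f1 f2 ` L \<in> diagonals \<longleftrightarrow> L \<in> diagonals"
proof
  assume a: "map_prod f1 f2 ` L \<in> diagonals"
  have inj: "inj_on f1 P1" "inj_on f2 P2" using c linked_inj by (auto simp: compatible_def)
  have "map_prod (inv_into P1 f1) (inv_into P2 f2) ` (map_prod f1 f2 ` L) = L"
  proof -
    have "map_prod (inv_into P1 f1) (inv_into P2 f2) (map_prod f1 f2 x) = x" if "x \<in> L" for x
      using that L inj by (cases x) auto
    then show ?thesis by (force simp: image_image)
  qed
  then show "L \<in> diagonals" using compatible_diagonals[OF compatible_inv[OF c] a] L by fastforce
qed (use compatible_diagonals[OF c] L in blast)

lemma conjugate_D_eq:
  assumes "(a, b) \<in> D" "L \<subseteq> D"
  shows "DG.conjugate (a, b) L = map_prod (\<lambda>x. a \<otimes> x \<otimes> inv a) (\<lambda>x. b \<otimes> x \<otimes> inv b) ` L"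
  unfolding DG.conjugate_def using assms by (intro image_cong) (auto simp: inv_DG[OF assms(1)] simp del: D_iff)

lemma compatible_conj:
  assumes "(a, b) \<in> D"
  shows "compatible (carrier S) (\<lambda>x. a \<otimes> x \<otimes> inv a) a (carrier S) (\<lambda>x. b \<otimes> x \<otimes> inv b) b"
  using assms by (auto simp: compatible_def intro!: linked_conj subgroup_self)

lemma diagonals_conjugate:
  assumes "x \<in> D" "L \<subseteq> D" shows "DG.conjugate x L \<in> diagonals \<longleftrightarrow> L \<in> diagonals"
proof -
  obtain a b where x: "x = (a, b)" by (cases x)
  have "L \<subseteq> carrier S \<times> carrier S" using assms(2) by (auto simp: D_def)
  then show ?thesis
    using compatible_diagonals_iff[OF compatible_conj] assms conjugate_D_eq[of a b L] by (simp add: x del: D_iff)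
qed

lemma diagonals_conjugate_fst:
  assumes "x \<in> D" "L \<in> diagonals" shows "fconj (fst ` L) (fst ` DG.conjugate x L)"
proof -
  obtain a b where x: "x = (a, b)" by (cases x)
  have LD: "L \<subseteq> D" using subgroup.subset[OF diagonals_subgroup[OF assms(2)]] by simp
  then have "L \<subseteq> carrier S \<times> carrier S" by (auto simp: D_def)
  then show ?thesis
    using compatible_diagonals[OF compatible_conj] assms LD conjugate_D_eq[of a b L] by (simp add: x del: D_iff)
qed

lemma compatible_hom:
  assumes c: "compatible P1 f1 s1 P2 f2 s2" and B: "subgroup B DG" "B \<subseteq> P1 \<times> P2"
  shows "group_hom (DG\<lparr>carrier := B\<rparr>) DG (map_prod f1 f2)"
proof -
  have l: "linked P1 f1 s1" "linked P2 f2 s2" using c by (auto simp: compatible_def)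
  have BD: "B \<subseteq> D" using subgroup.subset[OF B(1)] by simp
  have "map_prod f1 f2 \<in> hom (DG\<lparr>carrier := B\<rparr>) DG"
  proof (rule homI)
    fix x assume "x \<in> carrier (DG\<lparr>carrier := B\<rparr>)"
    then show "map_prod f1 f2 x \<in> carrier DG"
      using compatible_D[OF c] BD B(2) by (cases x) (auto simp del: D_iff)
  next
    fix x y assume "x \<in> carrier (DG\<lparr>carrier := B\<rparr>)" "y \<in> carrier (DG\<lparr>carrier := B\<rparr>)"
    then have "x \<in> P1 \<times> P2" "y \<in> P1 \<times> P2" using B(2) by auto
    then show "map_prod f1 f2 (x \<otimes>\<^bsub>DG\<lparr>carrier := B\<rparr>\<^esub> y) = map_prod f1 f2 x \<otimes>\<^bsub>DG\<^esub> map_prod f1 f2 y"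
      using linked_mult[OF l(1)] linked_mult[OF l(2)] by (cases x; cases y) auto
  qed
  then show ?thesis
    using subgroup.subgroup_is_group[OF B(1) DG.is_group] DG.is_group by (simp add: group_hom_def group_hom_axioms_def)
qed

text \<open>Conjugating a point \<open>(u, f u)\<close> by \<open>(a, b)\<close> gives a point of
  the same graph, and reading off both coordinates shows that \<open>f\<close> carries conjugation
  by \<open>a\<close> to conjugation by \<open>b\<close>.\<close>

lemma normalizer_graph:
  assumes l: "linked Q f s" "s \<in> N" and ab: "(a, b) \<in> DG.setwise_normalizer (graph Q f)"
  shows "a \<in> setwise_normalizer Q" "b \<in> setwise_normalizer (f ` Q)"
    "\<And>u. u \<in> Q \<Longrightarrow> f (a \<otimes> u \<otimes> inv a) = b \<otimes> f u \<otimes> inv b"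
proof -
  have Q: "subgroup Q S" and fQ: "subgroup (f ` Q) S" using linked_subgroup linked_image l by auto
  have D: "(a, b) \<in> D" using ab by (simp add: DG.setwise_normalizer_def)
  have c: "a \<in> carrier S" "b \<in> carrier S" using D by auto
  have gD: "graph Q f \<subseteq> D" using subgroup.subset[OF diagonals_subgroup[OF diagonalI[OF l]]] by simp
  have eq: "map_prod (\<lambda>x. a \<otimes> x \<otimes> inv a) (\<lambda>x. b \<otimes> x \<otimes> inv b) ` graph Q f = graph Q f"
    using ab conjugate_D_eq[OF D gD] by (simp add: DG.setwise_normalizer_def)
  have key: "a \<otimes> u \<otimes> inv a \<in> Q \<and> f (a \<otimes> u \<otimes> inv a) = b \<otimes> f u \<otimes> inv b" if u: "u \<in> Q" for u
  proof -
    have "(u, f u) \<in> graph Q f" using u by (simp add: graph_def)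
    then have "map_prod (\<lambda>x. a \<otimes> x \<otimes> inv a) (\<lambda>x. b \<otimes> x \<otimes> inv b) (u, f u)
      \<in> map_prod (\<lambda>x. a \<otimes> x \<otimes> inv a) (\<lambda>x. b \<otimes> x \<otimes> inv b) ` graph Q f" by (rule imageI)
    then have "map_prod (\<lambda>x. a \<otimes> x \<otimes> inv a) (\<lambda>x. b \<otimes> x \<otimes> inv b) (u, f u) \<in> graph Q f"
      unfolding eq .
    then show ?thesis by (auto simp: graph_def)
  qed
  show "f (a \<otimes> u \<otimes> inv a) = b \<otimes> f u \<otimes> inv b" if "u \<in> Q" for u
    using key that by blast
  have "b \<otimes> f u \<otimes> inv b \<in> f ` Q" if "u \<in> Q" for u
    using key[OF that] imageI[of "a \<otimes> u \<otimes> inv a" Q f] by simp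
  then have "conjugate b (f ` Q) \<subseteq> f ` Q" unfolding conjugate_def by blast
  moreover have "conjugate a Q \<subseteq> Q" using key unfolding conjugate_def by blast
  ultimately show "a \<in> setwise_normalizer Q" "b \<in> setwise_normalizer (f ` Q)"
    using c conjugate_eqI[OF finite_sub[OF Q] subgroup.subset[OF Q]] conjugate_eqI[OF finite_sub[OF fQ] subgroup.subset[OF fQ]]
    by (auto simp: setwise_normalizer_def)
qed

text \<open>A graph is straightened to a diagonal by a map on its whole normalizer.
  \<open>f2\<close> is defined on the normalizer of the image of \<open>f\<close>, and
  \<open>f1\<close> comes from extending the composite of \<open>f\<close> and \<open>f2\<close>.
  The extension reaches every first coordinate \<open>a\<close> of a normalizing pair
  \<open>(a, b)\<close>, the witness being \<open>f2 b\<close>.\<close>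

lemma extend_to_diagonal:
  assumes l: "linked Q f s" "s \<in> N" and R: "fconj Q R" "fully_normalized S F R"
  obtains P1 f1 s1 P2 f2 s2 where "compatible P1 f1 s1 P2 f2 s2"
    "DG.setwise_normalizer (graph Q f) \<subseteq> P1 \<times> P2" "map_prod f1 f2 ` graph Q f = graph R (\<lambda>x. x)"
proof -
  have Q: "subgroup Q S" using linked_subgroup l by auto
  have fQR: "fconj (f ` Q) R" using fconj_trans[OF fconj_sym[OF linked_fconj[OF l(1)]] R(1)] .
  let ?P2 = "setwise_normalizer (f ` Q)"
  obtain f2 where f2: "f2 \<in> F ?P2 (carrier S)" "f2 ` f ` Q = R" using extend_normalizer[OF fQR R(2)] .
  obtain s2 where s2: "linked ?P2 f2 s2" using every_morphism_linked[OF f2(1)] by blast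
  have l2: "linked (f ` Q) f2 s2"
    using linked_restrict[OF s2 linked_image[OF l(1)] subset_setwise_normalizer[OF linked_image[OF l(1)]]] .
  define \<phi> where "\<phi> = (\<lambda>u\<in>Q. f2 (f u))"
  have l\<phi>: "linked Q \<phi> (s2 \<otimes> s)" by (rule linked_comp[OF l(1) l2]) (simp add: \<phi>_def)
  have \<phi>: "\<phi> \<in> F Q (carrier S)" using linked_F[OF l\<phi>] by (simp add: \<phi>_def)
  have im: "\<phi> ` Q = R" using f2(2) by (auto simp: \<phi>_def image_image)
  have "fully_centralized S F (\<phi> ` Q)" using fully_normalized_centralized[OF R(2)] im by simp
  from extend[OF \<phi> this] obtain P1 \<psi> where
    \<psi>: "\<psi> \<in> F P1 (carrier S)" "Q \<subseteq> P1" "\<And>u. u \<in> Q \<Longrightarrow> \<psi> u = \<phi> u"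
    "\<And>a b. \<lbrakk>a \<in> setwise_normalizer Q; b \<in> carrier S;
       \<And>u. u \<in> Q \<Longrightarrow> \<phi> (a \<otimes> u \<otimes> inv a) = b \<otimes> \<phi> u \<otimes> inv b\<rbrakk> \<Longrightarrow> a \<in> P1"
    by metis
  obtain t where t: "linked P1 \<psi> t" using every_morphism_linked[OF \<psi>(1)] by blast
  have t': "linked Q \<phi> t" using linked_cong[OF linked_restrict[OF t Q \<psi>(2)]] \<psi>(3) by simp
  have "linked R (\<lambda>y. y) (s2 \<otimes> s \<otimes> inv t)" using linked_labels[OF l\<phi> t'] im by simp
  then obtain n z where nz: "n \<in> N" "z \<in> centralizer S R" "s2 \<otimes> s \<otimes> inv t = n \<otimes> z"
    using label_identity[OF R(2)] by blast
  have c: "s \<in> carrier S" "s2 \<in> carrier S" "t \<in> carrier S" "z \<in> carrier S" "n \<in> carrier S"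
    using linked_label l s2 t nz N_carrier by (auto simp: centralizer_def)
  \<comment> \<open>\<open>t\<close> and \<open>s2 \<otimes> s\<close> are labels of the same map on
    \<open>Q\<close>, with quotient \<open>n \<otimes> z\<close>. Conjugating by \<open>z\<close>
    makes the label of the extension congruent to \<open>s2\<close> and changes nothing on
    \<open>Q\<close>, since \<open>z\<close> centralizes \<open>R\<close>.\<close>
  define f1 where "f1 x = z \<otimes> \<psi> x \<otimes> inv z" for x
  have "linked (\<psi> ` P1) (\<lambda>x. z \<otimes> x \<otimes> inv z) z"
    using linked_image[OF t] c by (intro linked_conj) auto
  then have l1: "linked P1 f1 (z \<otimes> t)" using linked_comp[OF t] f1_def by blast
  have cg: "N.cg (z \<otimes> t) s2"
  proof -
    have "s2 \<otimes> s = n \<otimes> (z \<otimes> t)"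
    proof -
      have "s2 \<otimes> s = (s2 \<otimes> s \<otimes> inv t) \<otimes> t" using c by (simp add: m_assoc)
      then show ?thesis using nz(3) c by (simp add: m_assoc)
    qed
    moreover have "N.cg (\<one> \<otimes> (z \<otimes> t)) (n \<otimes> (z \<otimes> t))"
      using c N.cg_sym[OF N.cg_one[OF nz(1)]] by (intro N.cg_mult N.cg_refl) auto
    moreover have "N.cg (s2 \<otimes> s) (s2 \<otimes> \<one>)"
      using c N.cg_one[OF l(2)] by (intro N.cg_mult N.cg_refl) auto
    ultimately show ?thesis using c N.cg_trans[of "z \<otimes> t" "s2 \<otimes> s" s2] by simp
  qed
  show thesis
  proof (rule that)
    show "compatible P1 f1 (z \<otimes> t) ?P2 f2 s2" using l1 s2 cg by (simp add: compatible_def)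
    show "DG.setwise_normalizer (graph Q f) \<subseteq> P1 \<times> ?P2"
    proof clarify
      fix a b assume ab: "(a, b) \<in> DG.setwise_normalizer (graph Q f)"
      note ng = normalizer_graph[OF l ab]
      have b: "b \<in> carrier S" using ng(2) by (simp add: setwise_normalizer_def)
      have f2b: "f2 b \<in> carrier S" using linked_closed[OF s2 ng(2)] .
      have "a \<in> P1"
      proof (rule \<psi>(4)[OF ng(1) f2b])
        fix u assume u: "u \<in> Q"
        have aQ: "a \<otimes> u \<otimes> inv a \<in> Q"
          using ng(1) u by (auto simp: setwise_normalizer_def conjugate_def)
        have P2: "subgroup ?P2 S" using linked_subgroup[OF s2] .
        have fu: "f u \<in> ?P2" using subset_setwise_normalizer[OF linked_image[OF l(1)]] u by blast
        have "\<phi> (a \<otimes> u \<otimes> inv a) = f2 (b \<otimes> f u \<otimes> inv b)"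
          using aQ ng(3)[OF u] by (simp add: \<phi>_def)
        also have "\<dots> = f2 b \<otimes> f2 (f u) \<otimes> inv (f2 b)"
          using linked_mult[OF s2] linked_inv_elem[OF s2] ng(2) fu subgroup.m_closed[OF P2] subgroup.m_inv_closed[OF P2] by simp
        finally show "\<phi> (a \<otimes> u \<otimes> inv a) = f2 b \<otimes> \<phi> u \<otimes> inv (f2 b)"
          using u by (simp add: \<phi>_def)
      qed
      then show "a \<in> P1 \<and> b \<in> ?P2" using ng(2) by blast
    qed
    have "f1 u = f2 (f u)" if u: "u \<in> Q" for u
    proof -
      have e: "\<psi> u = f2 (f u)" using \<psi>(3) u by (simp add: \<phi>_def)
      have "f2 (f u) \<in> R" using f2(2) u by blast
      then have "z \<otimes> \<psi> u = \<psi> u \<otimes> z" "\<psi> u \<in> carrier S"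
        using nz(2) e subgroup.mem_carrier[OF fconj_subgroup(2)[OF R(1)]] by (auto simp: centralizer_def)
      then show ?thesis using c e by (simp add: f1_def m_assoc)
    qed
    then show "map_prod f1 f2 ` graph Q f = graph R (\<lambda>x. x)"
      using f2(2) by (force simp: graph_def image_image)
  qed
qed

definition supported :: "(('a \<times> 'a) set \<Rightarrow> nat) \<Rightarrow> bool" where
  "supported b \<longleftrightarrow> (\<forall>L. b L \<noteq> 0 \<longrightarrow> L \<in> diagonals)"

text \<open>The bound \<open>k\<close> lets invariance of marks be established order by order, from
  the order of S down to one.\<close>

definition stable :: "nat \<Rightarrow> (('a \<times> 'a) set \<Rightarrow> nat) \<Rightarrow> bool" where
  "stable k b \<longleftrightarrow> (\<forall>L\<in>diagonals. \<forall>L'\<in>diagonals. k \<le> card L \<longrightarrow> fconj (fst ` L) (fst ` L') \<longrightarrow>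
     DG.total_mark b L = DG.total_mark b L')"

text \<open>A fixed point would conjugate \<open>K\<close> into a member of
  \<open>diagonals\<close>, and that family is closed under subgroups and conjugation.\<close>

lemma supported_mark_zero:
  assumes b: "supported b" and K: "subgroup K DG" "K \<notin> diagonals" shows "DG.total_mark b K = 0"
  unfolding DG.total_mark_def
proof (rule sum.neutral, rule ballI, rule ccontr)
  fix L assume L: "L \<in> {L. subgroup L DG}" and ne: "b L * DG.mark L K \<noteq> 0"
  have KD: "K \<subseteq> D" using subgroup.subset[OF K(1)] by simp
  have diagonals: "L \<in> diagonals" using b ne by (auto simp: supported_def)
  obtain x where x: "x \<in> D" "DG.conjugate x K \<subseteq> L"
    using DG.mark_pos_conjugate[of L K] L KD ne by auto
  have "subgroup (DG.conjugate x K) DG" using DG.subgroup_conjugate[of x K] x(1) K(1) by simp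
  then have "DG.conjugate x K \<in> diagonals" using diagonals_sub[OF diagonals _ x(2)] by blast
  then show False using diagonals_conjugate[OF x(1) KD] K(2) by simp
qed

text \<open>A diagonal keeps the class of its first projection and hence its mark, by stability; for
  every other subgroup both marks are zero.\<close>

lemma compatible_marks:
  assumes b: "supported b" "stable k b" and c: "compatible P1 f1 s1 P2 f2 s2"
    and K: "subgroup K DG" "K \<subseteq> P1 \<times> P2" "k \<le> card K"
  shows "DG.total_mark b (map_prod f1 f2 ` K) = DG.total_mark b K"
proof (cases "K \<in> diagonals")
  case True
  then have "DG.total_mark b K = DG.total_mark b (map_prod f1 f2 ` K)"
    using compatible_diagonals[OF c True K(2)] b(2) K(3) unfolding stable_def by blast
  then show ?thesis by simp
next
  case False
  have "subgroup (map_prod f1 f2 ` K) DG"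
    using group_hom.img_is_subgroup[OF compatible_hom[OF c K(1,2)]] by simp
  then show ?thesis
    using supported_mark_zero[OF b(1)] K(1) False compatible_diagonals_iff[OF c K(2)] by metis
qed

text \<open>The normalizer of L acts on the given set in two ways, directly and through its map to D. By
  stability, the two actions have the same marks at the subgroups that properly contain L.\<close>

lemma mark_congruence:
  assumes b: "supported b" "stable (Suc k) b" and L: "L \<in> diagonals" "card L = k"
    and R: "fconj (fst ` L) R" "fully_normalized S F R"
  shows "[DG.total_mark b L = DG.total_mark b (graph R (\<lambda>x. x))] (mod (card (DG.setwise_normalizer L) div k))"
proof -
  obtain Q f s where l: "linked Q f s" "s \<in> N" and Lf: "L = graph Q f" using L by (auto simp: diagonals_def)
  have QR: "fconj Q R" using R(1) by (simp add: Lf)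
  obtain P1 f1 s1 P2 f2 s2 where c: "compatible P1 f1 s1 P2 f2 s2"
    and NL: "DG.setwise_normalizer L \<subseteq> P1 \<times> P2" and im: "map_prod f1 f2 ` L = graph R (\<lambda>x. x)"
    using extend_to_diagonal[OF l QR R(2)] unfolding Lf by metis
  let ?NL = "DG.setwise_normalizer L" and ?f = "map_prod f1 f2"
  have sL: "subgroup L DG" by (rule diagonals_subgroup[OF L(1)])
  have sN: "subgroup ?NL DG" by (rule DG.subgroup_setwise_normalizer[OF subgroup.subset[OF sL]])
  let ?G = "DG\<lparr>carrier := ?NL\<rparr>"
  let ?Y = "DG.weighted_cosets b"
  have A: "finite_action DG ?Y DG.coset_act" by (rule DG.weighted_action[OF finite_D])
  interpret A: finite_action DG ?Y DG.coset_act by (rule A)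
  interpret A1: finite_action ?G ?Y DG.coset_act by (rule A.restrict_action[OF sN])
  have gh: "group_hom ?G DG ?f" by (rule compatible_hom[OF c sN NL])
  interpret A2: finite_action ?G ?Y "\<lambda>g. DG.coset_act (?f g)"
    by (rule pullback_action[OF gh A]) (rule A1.finite_carrier)
  have LN: "L \<subseteq> ?NL" by (rule DG.subset_setwise_normalizer[OF sL])
  have fx1: "card (A1.fixed K) = DG.total_mark b K" for K
    using DG.card_weighted_fixed[OF finite_D, of b K] by (simp add: A1.fixed_def A.fixed_def)
  have fx2: "card (A2.fixed K) = DG.total_mark b (?f ` K)" for K
    using DG.card_weighted_fixed[OF finite_D, of b "?f ` K"] by (simp add: A2.fixed_def A.fixed_def)
  have "L \<lhd> ?G"
  proof -
    have sub: "subgroup L ?G" using DG.subgroup_incl[OF sL sN LN] .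
    have "x \<otimes>\<^bsub>?G\<^esub> h \<otimes>\<^bsub>?G\<^esub> inv\<^bsub>?G\<^esub> x \<in> L"
      if x: "x \<in> ?NL" and h: "h \<in> L" for x h
    proof -
      have "inv\<^bsub>?G\<^esub> x = inv\<^bsub>DG\<^esub> x" using DG.m_inv_consistent[OF sN x] by simp
      moreover have "x \<otimes>\<^bsub>DG\<^esub> h \<otimes>\<^bsub>DG\<^esub> inv\<^bsub>DG\<^esub> x \<in> L"
        using x h by (auto simp: DG.setwise_normalizer_def DG.conjugate_def)
      ultimately show ?thesis by simp
    qed
    then show ?thesis using A1.normal_inv_iff sub by simp
  qed
  moreover have "card (A1.fixed K) = card (A2.fixed K)" if K: "subgroup K ?G" "L \<subset> K" for K
  proof -
    have KN: "K \<subseteq> ?NL" using subgroup.subset[OF K(1)] by simp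
    have sK: "subgroup K DG" using DG.incl_subgroup[OF sN K(1)] .
    have "finite K" using finite_subset[OF subgroup.subset[OF sK] finite_D] .
    then have "Suc k \<le> card K" using psubset_card_mono[OF _ K(2)] L(2) by simp
    then show ?thesis using compatible_marks[OF b c sK] KN NL fx1 fx2 by simp
  qed
  ultimately have "[card (A1.fixed L) = card (A2.fixed L)] (mod (order ?G div card L))"
    by (intro marks_cong[OF A1.finite_action_axioms A2.finite_action_axioms])
  then show ?thesis using fx1 fx2 im L(2) by (simp add: order_def)
qed

text \<open>For an automorphism \<open>f\<close> of S, a pair with first coordinate \<open>a\<close>
  normalizes the graph when its second coordinate acts like \<open>f a\<close>, that is when it is
  \<open>f a\<close> times a central element; membership in \<open>D\<close> puts this element into
  \<open>N\<close>.\<close>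

lemma card_top_normalizer:
  assumes l: "linked (carrier S) f s" "s \<in> N"
  shows "card (DG.setwise_normalizer (graph (carrier S) f)) = card (carrier S) * card (N \<inter> centralizer S (carrier S))"
proof -
  let ?g = "graph (carrier S) f" and ?Z = "N \<inter> centralizer S (carrier S)"
  have fim: "f ` carrier S = carrier S"
    using endo_inj_surj[OF finite_S _ linked_inj[OF l(1)]] linked_closed[OF l(1)] by blast
  have gLL: "?g \<in> diagonals" by (rule diagonalI[OF l])
  have gD: "?g \<subseteq> D" using subgroup.subset[OF diagonals_subgroup[OF gLL]] by simp
  have fc: "f a \<in> carrier S" if "a \<in> carrier S" for a using linked_closed[OF l(1) that] .
  have "bij_betw (\<lambda>(a, z). (a, f a \<otimes> z)) (carrier S \<times> ?Z) (DG.setwise_normalizer ?g)"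
  proof (rule bij_betwI[where g = "\<lambda>(a, b). (a, inv (f a) \<otimes> b)"])
    show "(\<lambda>(a, z). (a, f a \<otimes> z)) \<in> carrier S \<times> ?Z \<rightarrow> DG.setwise_normalizer ?g"
    proof clarify
      fix a z assume a: "a \<in> carrier S" and z: "z \<in> N" "z \<in> centralizer S (carrier S)"
      have zc: "z \<in> carrier S" using z by (simp add: N_carrier)
      have "N.cg (a \<otimes> \<one>) (f a \<otimes> z)"
        using linked_cg_self[OF l a] N.cg_sym[OF N.cg_one[OF z(1)]] a zc fc by (intro N.cg_mult) auto
      then have D: "(a, f a \<otimes> z) \<in> D" using a zc fc by simp
      have "DG.conjugate (a, f a \<otimes> z) ?g \<subseteq> ?g"
      proof -
        have "(a \<otimes> u \<otimes> inv a, f a \<otimes> z \<otimes> f u \<otimes> inv (f a \<otimes> z)) \<in> ?g" if u: "u \<in> carrier S" for u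
        proof -
          have "z \<otimes> f u = f u \<otimes> z" using z(2) fc[OF u] by (simp add: centralizer_def)
          then have "f a \<otimes> z \<otimes> f u \<otimes> inv (f a \<otimes> z) = f a \<otimes> f u \<otimes> (z \<otimes> inv (f a \<otimes> z))"
            using fc a u zc by (simp add: m_assoc)
          also have "z \<otimes> inv (f a \<otimes> z) = inv (f a)"
            using fc[OF a] zc by (simp add: inv_mult_group) (simp flip: m_assoc)
          also have "f a \<otimes> f u \<otimes> inv (f a) = f (a \<otimes> u \<otimes> inv a)"
            using linked_mult[OF l(1)] linked_inv_elem[OF l(1)] a u by simp
          finally show ?thesis using a u by (simp add: graph_def)
        qed
        then show ?thesis unfolding conjugate_D_eq[OF D gD] by (auto simp: graph_def)
      qed
      then have "DG.conjugate (a, f a \<otimes> z) ?g = ?g"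
        using DG.conjugate_eqI[OF finite_subset[OF gD finite_D[unfolded carrier_DG]]] gD D by simp
      then show "(a, f a \<otimes> z) \<in> DG.setwise_normalizer ?g" using D by (simp add: DG.setwise_normalizer_def)
    qed
    show "(\<lambda>(a, b). (a, inv (f a) \<otimes> b)) \<in> DG.setwise_normalizer ?g \<rightarrow> carrier S \<times> ?Z"
    proof clarify
      fix a b assume ab: "(a, b) \<in> DG.setwise_normalizer ?g"
      then have "(a, b) \<in> D" by (simp add: DG.setwise_normalizer_def)
      then have c: "a \<in> carrier S" "b \<in> carrier S" "N.cg a b" by auto
      note ng = normalizer_graph(3)[OF l ab]
      let ?z = "inv (f a) \<otimes> b"
      have fa: "f a \<in> carrier S" using fc c by simp
      have "N.cg b (f a)"
        using N.cg_trans[OF N.cg_sym[OF c(3)] linked_cg_self[OF l c(1)]] c fa by simp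
      then have "N.cg ?z (inv (f a) \<otimes> f a)" using c fa by (intro N.cg_mult N.cg_refl) auto
      then have zN: "?z \<in> N" using c fa N.cg_one_iff[of ?z] by simp
      have "?z \<otimes> y = y \<otimes> ?z" if y: "y \<in> carrier S" for y
      proof -
        obtain u where u: "u \<in> carrier S" "y = f u" using y fim by blast
        have "f a \<otimes> y \<otimes> inv (f a) = b \<otimes> y \<otimes> inv b"
          using ng[OF u(1)] u c linked_mult[OF l(1)] linked_inv_elem[OF l(1)] by simp
        then have "inv (f a) \<otimes> (f a \<otimes> y \<otimes> inv (f a)) \<otimes> b = inv (f a) \<otimes> (b \<otimes> y \<otimes> inv b) \<otimes> b" by simp
        moreover have "inv (f a) \<otimes> (f a \<otimes> y \<otimes> inv (f a)) \<otimes> b = y \<otimes> ?z"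
          using fa y c by (simp add: m_assoc) (simp flip: m_assoc)
        moreover have "inv (f a) \<otimes> (b \<otimes> y \<otimes> inv b) \<otimes> b = ?z \<otimes> y"
          using fa y c by (simp add: m_assoc)
        ultimately show ?thesis by simp
      qed
      then show "a \<in> carrier S \<and> ?z \<in> N \<inter> centralizer S (carrier S)"
        using c zN fa by (simp add: centralizer_def)
    qed
  qed (use fc N_carrier in \<open>auto simp: DG.setwise_normalizer_def simp flip: m_assoc\<close>)
  then show ?thesis by (simp add: card_cartesian_product flip: bij_betw_same_card)
qed

section \<open>Automorphisms of S and the start of the construction\<close>

definition top_aut :: "('a \<Rightarrow> 'a) set" where
  "top_aut = {\<phi> \<in> F (carrier S) (carrier S). \<exists>s\<in>N. linked (carrier S) \<phi> s}"

definition inner_N :: "('a \<Rightarrow> 'a) set" where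
  "inner_N = (\<lambda>n. conj_map S n (carrier S)) ` N"

lemma conj_map_top: "g \<in> carrier S \<Longrightarrow> conj_map S g (carrier S) \<in> F (carrier S) (carrier S)"
  using conj_in_F[OF subgroup_self subgroup_self] conjugate_subset by blast

lemma compose_conj_map_top:
  "g \<in> carrier S \<Longrightarrow> h \<in> carrier S \<Longrightarrow>
    compose (carrier S) (conj_map S g (carrier S)) (conj_map S h (carrier S)) = conj_map S (g \<otimes> h) (carrier S)"
  by (auto simp: compose_def conj_map_def inv_mult_group m_assoc intro!: restrict_ext)

text \<open>\<open>N\<close> acts transitively on its own conjugations of S by left multiplication,
  and the stabilizer of the identity is the part of \<open>N\<close> that is central in S.\<close>

lemma card_inner_N: "card inner_N * card (N \<inter> centralizer S (carrier S)) = card N"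
proof -
  let ?G = "S\<lparr>carrier := N\<rparr>"
  interpret G: group ?G by (rule subgroup.subgroup_is_group[OF N.subgroup_axioms is_group])
  interpret A: finite_action ?G inner_N "\<lambda>n \<phi>. compose (carrier S) (conj_map S n (carrier S)) \<phi>"
  proof unfold_locales
    show "finite (carrier ?G)" using finite_N by simp
    show "finite inner_N" using finite_N by (simp add: inner_N_def)
    show "compose (carrier S) (conj_map S g (carrier S)) y \<in> inner_N"
      if "g \<in> carrier ?G" "y \<in> inner_N" for g y
      using that N_carrier by (auto simp: inner_N_def compose_conj_map_top)
    show "compose (carrier S) (conj_map S \<one>\<^bsub>?G\<^esub> (carrier S)) y = y" if "y \<in> inner_N" for y
      using that N_carrier by (auto simp: inner_N_def compose_conj_map_top)
    show "compose (carrier S) (conj_map S (g \<otimes>\<^bsub>?G\<^esub> h) (carrier S)) y =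
      compose (carrier S) (conj_map S g (carrier S)) (compose (carrier S) (conj_map S h (carrier S)) y)"
      if "g \<in> carrier ?G" "h \<in> carrier ?G" "y \<in> inner_N" for g h y
      using that N_carrier by (auto simp: inner_N_def compose_conj_map_top m_assoc)
  qed
  let ?e = "conj_map S \<one> (carrier S)"
  have e: "?e \<in> inner_N" by (simp add: inner_N_def)
  have "A.orb ?e = inner_N"
    unfolding A.orb_def inner_N_def using N_carrier by (intro image_cong) (auto simp: compose_conj_map_top)
  moreover have "A.stab ?e = N \<inter> centralizer S (carrier S)"
  proof -
    have "conj_map S n (carrier S) = ?e \<longleftrightarrow> n \<in> centralizer S (carrier S)"
      if n: "n \<in> carrier S" for n
    proof -
      have "conj_map S n (carrier S) = ?e \<longleftrightarrow> (\<forall>x\<in>carrier S. n \<otimes> x \<otimes> inv n = x)"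
      proof
        assume eq: "conj_map S n (carrier S) = ?e"
        show "\<forall>x\<in>carrier S. n \<otimes> x \<otimes> inv n = x"
        proof
          fix x assume "x \<in> carrier S"
          then show "n \<otimes> x \<otimes> inv n = x" using fun_cong[OF eq, of x] by (simp add: conj_map_def)
        qed
      qed (auto simp: conj_map_def intro!: restrict_ext)
      also have "\<dots> \<longleftrightarrow> n \<in> centralizer S (carrier S)"
        using n by (simp add: centralizer_def inv_solve_right')
      finally show ?thesis .
    qed
    then show ?thesis using N_carrier by (auto simp: A.stab_def compose_conj_map_top)
  qed
  ultimately show ?thesis using A.card_orb[OF e] by (simp add: order_def)
qed

lemma top_fully_normalized: "fully_normalized S F (carrier S)"
proof -
  obtain Q where Q: "fconj (carrier S) Q" "fully_normalized S F Q" using exists_fully_normalized[OF subgroup_self] .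
  have "Q = carrier S"
    using card_subset_eq[OF finite_S subgroup.subset[OF fconj_subgroup(2)[OF Q(1)]]] fconj_card[OF Q(1)] by simp
  then show ?thesis using Q by simp
qed

text \<open>The conjugations by \<open>N\<close> form a Sylow p-subgroup of \<open>top_aut\<close>.
  Indeed, a Sylow subgroup of \<open>top_aut\<close> is conjugate into the conjugations by S, so its
  elements are themselves conjugations by elements \<open>g\<close> of S, and comparing
  \<open>g\<close> with a label in \<open>N\<close> through \<open>label_identity\<close> replaces
  \<open>g\<close> by an element of \<open>N\<close>. This is the origin of the factor prime to p in
  the number of points.\<close>

lemma card_top_aut: "\<exists>l. card top_aut = l * card inner_N \<and> \<not> p dvd l"
proof -
  let ?C = "carrier S"
  let ?A = "aut_group F ?C"
  interpret A: group ?A by (rule group_aut_group[OF subgroup_self])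
  have finA: "finite (carrier ?A)" using finite_aut[OF subgroup_self] by simp
  have im: "\<psi> ` ?C = ?C" if "\<psi> \<in> F ?C ?C" for \<psi> using F_self_bij[OF that] by (simp add: bij_betw_def)
  have J: "subgroup top_aut ?A"
  proof (rule A.finite_mult_closed_subgroup[OF finA])
    show "top_aut \<subseteq> carrier ?A" by (auto simp: top_aut_def)
    show "top_aut \<noteq> {}"
      using incl_in_F[OF subgroup_self subgroup_self] linked_id[OF subgroup_self, of "\<lambda>x\<in>?C. x"] N.one_closed
      unfolding top_aut_def by fastforce
    fix \<psi> \<chi> assume "\<psi> \<in> top_aut" "\<chi> \<in> top_aut"
    then obtain s t where \<psi>F: "\<psi> \<in> F ?C ?C" and s: "linked ?C \<psi> s" "s \<in> N"
      and \<chi>F: "\<chi> \<in> F ?C ?C" and t: "linked ?C \<chi> t" "t \<in> N" by (auto simp: top_aut_def)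
    have "linked ?C (compose ?C \<psi> \<chi>) (s \<otimes> t)"
      using s im[OF \<chi>F] by (intro linked_comp[OF t(1)]) (auto simp: compose_def)
    then show "\<psi> \<otimes>\<^bsub>?A\<^esub> \<chi> \<in> top_aut"
      using \<psi>F \<chi>F composition[OF \<chi>F \<psi>F] s(2) t(2) by (auto simp: mult_aut_group top_aut_def)
  qed
  let ?B = "?A\<lparr>carrier := top_aut\<rparr>"
  interpret B: group ?B by (rule subgroup.subgroup_is_group[OF J A.is_group])
  have finB: "finite (carrier ?B)" using finite_subset[OF subgroup.subset[OF J] finA] by simp
  have inn_sub: "inner_N \<subseteq> top_aut"
  proof
    fix \<phi> assume "\<phi> \<in> inner_N"
    then obtain n where n: "n \<in> N" "\<phi> = conj_map S n ?C" by (auto simp: inner_N_def)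
    then have "linked ?C \<phi> n" using N_carrier by (intro linked_conj subgroup_self) (auto simp: conj_map_def)
    then show "\<phi> \<in> top_aut" using n conj_map_top N_carrier by (auto simp: top_aut_def)
  qed
  have inn: "subgroup inner_N ?B"
  proof (rule B.finite_mult_closed_subgroup[OF finB])
    show "inner_N \<noteq> {}" unfolding inner_N_def using N.one_closed by blast
    fix \<phi> \<psi> assume "\<phi> \<in> inner_N" "\<psi> \<in> inner_N"
    then show "\<phi> \<otimes>\<^bsub>?B\<^esub> \<psi> \<in> inner_N"
      using N_carrier by (auto simp: inner_N_def mult_aut_group conj_map_top compose_conj_map_top)
  qed (use inn_sub in simp)
  let ?l = "card (rcosets\<^bsub>?B\<^esub> inner_N)"
  have lag: "?l * card inner_N = card top_aut" using B.lagrange[OF inn] by (simp add: order_def)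
  have "\<not> p dvd ?l"
  proof
    assume pl: "p dvd ?l"
    let ?a = "multiplicity p (order ?B)"
    have "p ^ ?a dvd order ?B" by (rule multiplicity_dvd)
    then obtain m where "order ?B = p ^ ?a * m" by blast
    then obtain P where P: "subgroup P ?B" "card P = p ^ ?a"
      using sylow_thm[OF prime B.is_group _ finB] by blast
    have PA: "subgroup P ?A" using A.incl_subgroup[OF J P(1)] .
    let ?T = "carrier (aut_group (trivial_fusion S) ?C)"
    have syl: "sylow_subgroup p ?A ?T" by (rule fully_normalized_sylow[OF top_fully_normalized])
    then have T: "subgroup ?T ?A" by (simp add: sylow_subgroup_def)
    obtain x where x: "x \<in> F ?C ?C" "A.conjugate x P \<subseteq> ?T"
      using A.p_subgroup_conjugate[OF finA prime T sylow_index[OF A.is_group finA prime syl] PA P(2)] by auto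
    have "P \<subseteq> inner_N"
    proof
      fix k assume k: "k \<in> P"
      then have "k \<in> top_aut" using subgroup.subset[OF P(1)] by auto
      then obtain s where kF: "k \<in> F ?C ?C" and s: "linked ?C k s" "s \<in> N" by (auto simp: top_aut_def)
      have "x \<otimes>\<^bsub>?A\<^esub> k \<otimes>\<^bsub>?A\<^esub> inv\<^bsub>?A\<^esub> x \<in> ?T"
        using x(2) k by (auto simp: A.conjugate_def)
      then obtain b where b: "b \<in> ?C" "x \<otimes>\<^bsub>?A\<^esub> k \<otimes>\<^bsub>?A\<^esub> inv\<^bsub>?A\<^esub> x = conj_map S b ?C"
        unfolding carrier_aut_trivial[OF subgroup_self] by (auto simp: setwise_normalizer_def)
      have xc: "x \<in> carrier ?A" and kc: "k \<in> carrier ?A" using x(1) kF by simp_all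
      have "conj_map S b ?C \<otimes>\<^bsub>?A\<^esub> x = x \<otimes>\<^bsub>?A\<^esub> k"
        unfolding b(2)[symmetric] using xc kc by (simp add: A.m_assoc del: carrier_aut_group)
      then have c: "compose ?C (conj_map S b ?C) x = compose ?C x k"
        using x(1) kF conj_map_top[OF b(1)] by (simp add: mult_aut_group)
      \<comment> \<open>Since \<open>x\<close> is an automorphism of S, conjugation by
        \<open>b\<close> pulled back along \<open>x\<close> is conjugation by the preimage of
        \<open>b\<close>.\<close>
      obtain g where g: "g \<in> ?C" "b = x g" using im[OF x(1)] b(1) by blast
      obtain t where t: "linked ?C x t" using automorphism_linked[OF top_fully_normalized x(1)] by blast
      have kg: "k u = g \<otimes> u \<otimes> inv g" if u: "u \<in> ?C" for u
      proof -
        have ku: "k u \<in> ?C" using F_into[OF kF] u by blast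
        have "x (k u) = conj_map S b ?C (x u)" using c u by (metis compose_eq)
        also have "\<dots> = x g \<otimes> x u \<otimes> inv (x g)"
          using g linked_closed[OF t u] by (simp add: conj_map_def)
        also have "\<dots> = x (g \<otimes> u \<otimes> inv g)"
          using linked_mult[OF t] linked_inv_elem[OF t] g u by simp
        finally show ?thesis using F_inj[OF x(1)] ku g u by (simp add: inj_on_def)
      qed
      have "linked ?C k g" using g kg by (intro linked_conj subgroup_self) auto
      from linked_labels[OF s(1) this] im[OF kF] have "linked ?C (\<lambda>x. x) (s \<otimes> inv g)" by simp
      then obtain n z where nz: "n \<in> N" "z \<in> centralizer S ?C" "s \<otimes> inv g = n \<otimes> z"
        using label_identity[OF top_fully_normalized] by blast
      have cs: "s \<in> ?C" "n \<in> ?C" "z \<in> ?C" using s nz N_carrier by (auto simp: centralizer_def)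
      \<comment> \<open>\<open>inv n \<otimes> s\<close> lies in \<open>N\<close>, and it equals
        \<open>z \<otimes> g\<close> with \<open>z\<close> central, so it conjugates like
        \<open>g\<close>.\<close>
      have "k = conj_map S (inv n \<otimes> s) ?C"
      proof (rule extensionalityI[OF F_ext[OF kF]])
        show "conj_map S (inv n \<otimes> s) ?C \<in> extensional ?C" by (simp add: conj_map_def)
        fix u assume u: "u \<in> ?C"
        have "inv n \<otimes> s = z \<otimes> g"
        proof -
          have "inv n \<otimes> ((s \<otimes> inv g) \<otimes> g) = inv n \<otimes> (n \<otimes> z \<otimes> g)"
            using nz(3) by simp
          then show ?thesis using cs g by (simp add: m_assoc) (simp flip: m_assoc)
        qed
        moreover have "(z \<otimes> g) \<otimes> u \<otimes> inv (z \<otimes> g) = g \<otimes> u \<otimes> inv g"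
        proof -
          have w: "g \<otimes> u \<otimes> inv g \<in> ?C" using g u by simp
          have "(z \<otimes> g) \<otimes> u \<otimes> inv (z \<otimes> g) = z \<otimes> (g \<otimes> u \<otimes> inv g) \<otimes> inv z"
            using cs g u by (simp add: m_assoc inv_mult_group)
          also have "z \<otimes> (g \<otimes> u \<otimes> inv g) = (g \<otimes> u \<otimes> inv g) \<otimes> z"
            using nz(2) w unfolding centralizer_def by blast
          also have "\<dots> \<otimes> inv z = g \<otimes> u \<otimes> inv g" using cs g u by (simp add: m_assoc)
          finally show ?thesis .
        qed
        ultimately show "k u = conj_map S (inv n \<otimes> s) ?C u" using kg u by (simp add: conj_map_def)
      qed
      then show "k \<in> inner_N" using nz(1) s(2) by (auto simp: inner_N_def)
    qed
    moreover have "finite inner_N" using finite_N by (simp add: inner_N_def)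
    ultimately have le: "p ^ ?a \<le> card inner_N" using P(2) card_mono by metis
    obtain j where "card N = p ^ j" using p_subgroup[OF N.subgroup_axioms] by blast
    then have "card inner_N dvd p ^ j" using card_inner_N by (metis dvd_triv_left)
    then obtain e where e: "card inner_N = p ^ e" using divides_primepow_nat prime by blast
    have "?a \<le> e" using le e prime_gt_1_nat[OF prime] by simp
    moreover have "p ^ Suc e dvd order ?B" using pl lag e by (simp add: order_def flip: lag)
    moreover have "order ?B > 0" using B.order_gt_0_iff_finite finB by blast
    moreover have "\<not> is_unit p" using prime not_prime_unit by blast
    ultimately have "Suc e \<le> ?a" by (intro multiplicity_geI) auto
    then show False using \<open>?a \<le> e\<close> by simp
  qed
  then show ?thesis using lag by (intro exI[of _ ?l]) simp
qed

lemma top_graphs: "bij_betw (graph (carrier S)) top_aut {L \<in> diagonals. card L = card (carrier S)}"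
  unfolding bij_betw_def
proof
  show "inj_on (graph (carrier S)) top_aut"
  proof (rule inj_onI)
    fix \<phi> \<psi> assume a: "\<phi> \<in> top_aut" "\<psi> \<in> top_aut" "graph (carrier S) \<phi> = graph (carrier S) \<psi>"
    have "\<phi> x = \<psi> x" if "x \<in> carrier S" for x using a(3) that by (auto simp: graph_def)
    then show "\<phi> = \<psi>" using a F_ext extensionalityI[of \<phi> "carrier S" \<psi>] by (auto simp: top_aut_def)
  qed
  show "graph (carrier S) ` top_aut = {L \<in> diagonals. card L = card (carrier S)}"
  proof (intro equalityI subsetI)
    fix L assume "L \<in> graph (carrier S) ` top_aut"
    then show "L \<in> {L \<in> diagonals. card L = card (carrier S)}" using diagonalI by (auto simp: top_aut_def)
  next
    fix L assume L: "L \<in> {L \<in> diagonals. card L = card (carrier S)}"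
    then obtain Q f s where l: "linked Q f s" "s \<in> N" "L = graph Q f" by (auto simp: diagonals_def)
    have Q: "Q = carrier S"
      using card_subset_eq[OF finite_S subgroup.subset[OF linked_subgroup[OF l(1)]]] L l(3) by simp
    have "L = graph (carrier S) (restrict f (carrier S))" unfolding l(3) Q by (rule graph_cong) simp
    moreover have "linked (carrier S) (restrict f (carrier S)) s"
      by (rule linked_cong) (use l(1) Q in auto)
    moreover have "restrict f (carrier S) \<in> F (carrier S) (carrier S)" using linked_F[OF l(1)] Q by blast
    ultimately show "L \<in> graph (carrier S) ` top_aut" using l(2) unfolding top_aut_def by blast
  qed
qed

lemma total_mark_zero [simp]: "DG.total_mark (\<lambda>_. 0) K = 0"
  by (simp add: DG.total_mark_def)

lemma card_fst_diagonals: "L \<in> diagonals \<Longrightarrow> card (fst ` L) = card L"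
  by (auto simp: diagonals_def)

lemma diagonals_props: assumes "L \<in> diagonals" shows "L \<subseteq> D" "finite L" "0 < card L" "card L dvd order DG"
proof -
  have s: "subgroup L DG" by (rule diagonals_subgroup[OF assms])
  show LD: "L \<subseteq> D" using subgroup.subset[OF s] by simp
  then show f: "finite L" using finite_subset finite_D by simp
  then show "0 < card L" using subgroup.one_closed[OF s] by (auto simp: card_gt_0_iff)
  show "card L dvd order DG" using DG.lagrange[OF s] by (metis dvd_triv_right)
qed

lemma diagonals_same_order_conj:
  "L \<in> diagonals \<Longrightarrow> x \<in> D \<Longrightarrow> DG.conjugate x L \<in> diagonals \<and> card (DG.conjugate x L) = card L"
  using diagonals_conjugate[of x L] diagonals_props[of L] DG.card_conjugate[of x L] by simp

text \<open>The prescribed mark is the index of a graph in its normalizer, so each conjugacy class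
  of graphs over S contributes one transitive set. All stabilizers have the order of S, hence the
  number of points is the number of such graphs, which is that of \<open>top_aut\<close>, times this
  mark; \<open>card_top_aut\<close> and \<open>card_inner_N\<close> evaluate the product.\<close>

lemma top_level:
  "\<exists>b. supported b \<and> stable (card (carrier S)) b \<and> (\<exists>l. card (DG.weighted_cosets b) = l * card N \<and> \<not> p dvd l)"
proof -
  let ?k = "card (carrier S)" and ?z = "card (N \<inter> centralizer S (carrier S))"
  let ?S = "{L \<in> diagonals. card L = ?k}"
  have kpos: "?k > 0" using finite_S one_closed by (auto simp: card_gt_0_iff)
  have nrm: "card (DG.setwise_normalizer L) div ?k = ?z" if L: "L \<in> ?S" for L
  proof -
    obtain \<phi> where "\<phi> \<in> top_aut" "L = graph (carrier S) \<phi>" using top_graphs L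
      unfolding bij_betw_def by blast
    then show ?thesis using card_top_normalizer kpos by (auto simp: top_aut_def)
  qed
  have finD: "finite (carrier DG)" by (rule finite_D)
  have h1: "subgroup K DG \<and> card K = ?k" if "K \<in> ?S" for K using that diagonals_subgroup by simp
  have h2: "DG.conjugate x K \<in> ?S" if "K \<in> ?S" "x \<in> carrier DG" for K x
    using that diagonals_same_order_conj by simp
  have h3: "card (DG.setwise_normalizer K) div ?k dvd ?z - DG.total_mark (\<lambda>_. 0) K" if "K \<in> ?S" for K
    using nrm[OF that] by simp
  have h4: "DG.total_mark (\<lambda>_. 0) K \<le> ?z" for K by simp
  have "\<exists>b. (\<forall>K\<in>?S. DG.total_mark b K = ?z) \<and> (\<forall>L. 0 \<le> b L) \<and> (\<forall>L. L \<notin> ?S \<longrightarrow> b L = 0) \<and>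
    (\<forall>K. subgroup K DG \<longrightarrow> ?k \<le> card K \<longrightarrow> K \<notin> ?S \<longrightarrow> DG.total_mark b K = DG.total_mark (\<lambda>_. 0) K)"
    by (rule DG.prescribe_marks[OF finD h1 h2 refl h4 h3])
  then obtain b where b: "\<And>K. K \<in> ?S \<Longrightarrow> DG.total_mark b K = ?z" "\<And>L. L \<notin> ?S \<Longrightarrow> b L = 0"
    by blast
  have sup: "supported b" using b(2) unfolding supported_def by fastforce
  have "DG.total_mark b L = ?z" if "L \<in> diagonals" "?k \<le> card L" for L
  proof -
    obtain Q f s where l: "linked Q f s" "L = graph Q f"
      using \<open>L \<in> diagonals\<close> by (auto simp: diagonals_def)
    have "card Q \<le> ?k" using subgroup.subset[OF linked_subgroup[OF l(1)]] finite_S card_mono by blast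
    then show ?thesis using b(1) that l(2) by simp
  qed
  then have st: "stable ?k b"
    unfolding stable_def using fconj_card card_fst_diagonals by (intro ballI impI) metis
  interpret A: finite_action DG "DG.weighted_cosets b" DG.coset_act by (rule DG.weighted_action[OF finD])
  have "card (DG.weighted_cosets b) = (\<Sum>L\<in>?S. card (A.fixed L))"
  proof (rule A.card_eq_sum_fixed)
    fix y assume "y \<in> DG.weighted_cosets b"
    then obtain L x where "b L \<noteq> 0" "x \<in> carrier DG" "A.stab y = DG.conjugate x L"
      using DG.weighted_stab[OF finD] by blast
    moreover have "L \<in> ?S" using calculation(1) b(2) by fastforce
    ultimately show "A.stab y \<in> ?S" using diagonals_same_order_conj by simp
  next
    show "finite ?S" by (rule finite_subset[of _ "Pow D"]) (use diagonals_props finite_D in auto)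
    show "L \<subseteq> carrier DG \<and> card L = ?k" if "L \<in> ?S" for L using that diagonals_props by simp
  qed
  also have "\<dots> = card ?S * ?z" using b(1) DG.card_weighted_fixed[OF finD] by simp
  also have "card ?S = card top_aut" using top_graphs by (simp add: bij_betw_same_card)
  finally have "card (DG.weighted_cosets b) = card top_aut * ?z" .
  moreover obtain l where "card top_aut = l * card inner_N" "\<not> p dvd l" using card_top_aut by blast
  ultimately have "card (DG.weighted_cosets b) = l * card N \<and> \<not> p dvd l"
    using card_inner_N by (simp add: mult.assoc)
  then show ?thesis using sup st by blast
qed

text \<open>At order \<open>k\<close> the mark of a graph is raised to a constant plus the mark of
  the diagonal of a fully normalized conjugate of its domain, which depends on the class of the
  domain only. Divisibility of the deficit is \<open>mark_congruence\<close>. Since \<open>k\<close>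
  is smaller than the order of S, every added orbit has length divisible by
  \<open>p * card N\<close>, so the number of N-orbits does not change modulo p.\<close>

lemma level_step:
  assumes k: "0 < k" "k < card (carrier S)" and b0: "supported b0" "stable (Suc k) b0"
    and l0: "card (DG.weighted_cosets b0) = l0 * card N" "\<not> p dvd l0"
  shows "\<exists>b. supported b \<and> stable k b \<and> (\<exists>l. card (DG.weighted_cosets b) = l * card N \<and> \<not> p dvd l)"
proof -
  let ?S = "{L \<in> diagonals. card L = k}"
  have finD: "finite (carrier DG)" by (rule finite_D)
  \<comment> \<open>The choice depends only on the set of candidates, which is the same for
    conjugate subgroups; hence \<open>rep_eq\<close>.\<close>
  define rep where "rep Q = (SOME R. fconj Q R \<and> fully_normalized S F R)" for Q
  have rep: "fconj Q (rep Q) \<and> fully_normalized S F (rep Q)" if sQ: "subgroup Q S" for Q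
  proof -
    obtain R where "fconj Q R" "fully_normalized S F R" using exists_fully_normalized[OF sQ] .
    then have "fconj Q R \<and> fully_normalized S F R" by simp
    then show ?thesis unfolding rep_def by (rule someI)
  qed
  have rep_eq: "rep Q = rep Q'" if "fconj Q Q'" for Q Q'
  proof -
    have "fconj Q R \<longleftrightarrow> fconj Q' R" for R using that fconj_trans fconj_sym by blast
    then show ?thesis by (simp add: rep_def)
  qed
  have fstL: "subgroup (fst ` L) S" if "L \<in> diagonals" for L
    using that linked_subgroup by (auto simp: diagonals_def)
  \<comment> \<open>At least as large as every mark, so that all deficits are nonnegative, and a
    multiple of the order of \<open>DG\<close>, so that it disappears in all congruences.\<close>
  let ?t = "card (DG.weighted_cosets b0) * order DG"
  define V :: "('a \<times> 'a) set \<Rightarrow> nat"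
    where "V L = DG.total_mark b0 (graph (rep (fst ` L)) (\<lambda>x. x)) + ?t" for L
  have bound: "DG.total_mark b0 L \<le> card (DG.weighted_cosets b0)" for L
  proof -
    interpret A: finite_action DG "DG.weighted_cosets b0" DG.coset_act by (rule DG.weighted_action[OF finD])
    show ?thesis unfolding DG.card_weighted_fixed[OF finD, symmetric]
      by (rule card_mono[OF A.finite_points]) (auto simp: A.fixed_def)
  qed
  have opos: "order DG > 0" using DG.order_gt_0_iff_finite finD by blast
  have le: "DG.total_mark b0 L \<le> V L" for L
  proof -
    have "card (DG.weighted_cosets b0) * 1 \<le> ?t" using opos by (intro mult_le_mono2) simp
    then show ?thesis using bound[of L] unfolding V_def by linarith
  qed
  have dvd: "card (DG.setwise_normalizer L) div k dvd V L - DG.total_mark b0 L" if L: "L \<in> ?S" for L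
  proof -
    let ?n = "card (DG.setwise_normalizer L) div k"
    have diagonals: "L \<in> diagonals" "card L = k" using L by auto
    have sL: "subgroup L DG" by (rule diagonals_subgroup[OF diagonals(1)])
    have sN: "subgroup (DG.setwise_normalizer L) DG" by (rule DG.subgroup_setwise_normalizer[OF subgroup.subset[OF sL]])
    have "subgroup L (DG\<lparr>carrier := DG.setwise_normalizer L\<rparr>)"
      using DG.subgroup_incl[OF sL sN DG.subset_setwise_normalizer[OF sL]] .
    then have "k dvd card (DG.setwise_normalizer L)"
      using group.lagrange[OF subgroup.subgroup_is_group[OF sN DG.is_group]] diagonals(2)
        by (metis dvd_triv_right order_def partial_object.select_convs(1) partial_object.surjective partial_object.update_convs(1))
    then have "?n dvd card (DG.setwise_normalizer L)" by (metis dvd_div_mult_self dvd_triv_left)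
    also have "card (DG.setwise_normalizer L) dvd order DG" using DG.lagrange[OF sN] by (metis dvd_triv_right)
    finally have "?n dvd ?t" by simp
    moreover have "[DG.total_mark b0 L = DG.total_mark b0 (graph (rep (fst ` L)) (\<lambda>x. x))] (mod ?n)"
      using rep[OF fstL[OF diagonals(1)]] by (intro mark_congruence[OF b0 diagonals]) auto
    ultimately have "[V L = DG.total_mark b0 L] (mod ?n)"
      unfolding V_def by (metis add.right_neutral cong_0_iff cong_add cong_sym)
    then show ?thesis using le[of L] by (simp add: cong_altdef_nat)
  qed
  have h1: "subgroup K DG \<and> card K = k" if "K \<in> ?S" for K using that diagonals_subgroup by simp
  have h2: "DG.conjugate x K \<in> ?S" if "K \<in> ?S" "x \<in> carrier DG" for K x
    using that diagonals_same_order_conj by simp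
  have h3: "V (DG.conjugate x K) = V K" if "K \<in> ?S" "x \<in> carrier DG" for K x
    using rep_eq[OF diagonals_conjugate_fst[of x K]] that by (simp add: V_def)
  have "\<exists>b. (\<forall>K\<in>?S. DG.total_mark b K = V K) \<and> (\<forall>L. b0 L \<le> b L) \<and> (\<forall>L. L \<notin> ?S \<longrightarrow> b L = b0 L) \<and>
    (\<forall>K. subgroup K DG \<longrightarrow> k \<le> card K \<longrightarrow> K \<notin> ?S \<longrightarrow> DG.total_mark b K = DG.total_mark b0 K)"
    by (rule DG.prescribe_marks[OF finD h1 h2 h3 le dvd])
  then obtain b where b: "\<And>K. K \<in> ?S \<Longrightarrow> DG.total_mark b K = V K" "\<And>L. b0 L \<le> b L" "\<And>L. L \<notin> ?S \<Longrightarrow> b L = b0 L"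
    "\<And>K. \<lbrakk>subgroup K DG; k \<le> card K; K \<notin> ?S\<rbrakk> \<Longrightarrow> DG.total_mark b K = DG.total_mark b0 K"
    by blast
  have sup: "supported b" using b(3) b0(1) unfolding supported_def by (metis (mono_tags, lifting) mem_Collect_eq)
  have st: "stable k b"
    unfolding stable_def
  proof (intro ballI impI)
    fix L L' assume L: "L \<in> diagonals" "L' \<in> diagonals" "k \<le> card L" and c: "fconj (fst ` L) (fst ` L')"
    have cc: "card L = card L'" using fconj_card[OF c] card_fst_diagonals L by simp
    show "DG.total_mark b L = DG.total_mark b L'"
    proof (cases "card L = k")
      case True
      then show ?thesis using b(1) L cc rep_eq[OF c] by (simp add: V_def)
    next
      case False
      then have "DG.total_mark b0 L = DG.total_mark b0 L'" using b0(2) L c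
        unfolding stable_def by (metis Suc_leI le_neq_implies_less)
      then show ?thesis using b(4) L cc False diagonals_subgroup by simp
    qed
  qed
  have "\<exists>m. card (DG.weighted_cosets b) = card (DG.weighted_cosets b0) + p * m * card N"
  proof (cases "?S = {}")
    case True
    then have "b = b0" using b(3) by auto
    then show ?thesis by (intro exI[of _ 0]) simp
  next
    case False
    then obtain L where L: "L \<in> ?S" by blast
    have "k dvd card (carrier S)"
    proof -
      obtain Q f s where "linked Q f s" "L = graph Q f" using L by (auto simp: diagonals_def)
      then show ?thesis using lagrange[OF linked_subgroup] L
        by (metis (mono_tags, lifting) card_graph dvd_triv_right mem_Collect_eq order_def)
    qed
    then obtain c where c: "card (carrier S) = k * c" by blast
    obtain n where "card (carrier S) = p ^ n" using p_group by (auto simp: order_def)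
    then have "c dvd p ^ n" using c by (metis dvd_triv_right)
    then obtain j where j: "c = p ^ j" using divides_primepow_nat prime by blast
    have "j \<noteq> 0" using j c k by (intro notI) simp
    then obtain c' where c': "c = p * c'" using j by (cases j) auto
    have quot: "order DG div k = p * c' * card N" using card_D c c' k(1) by (simp add: mult.assoc)
    have "card (DG.weighted_cosets b) = (\<Sum>L | subgroup L DG. b0 L * (order DG div card L) + (b L - b0 L) * (order DG div card L))"
      unfolding DG.card_weighted[OF finD] using b(2) by (intro sum.cong) (auto simp flip: add_mult_distrib)
    also have "\<dots> = card (DG.weighted_cosets b0) + (\<Sum>L | subgroup L DG. (b L - b0 L) * (order DG div card L))"
      unfolding DG.card_weighted[OF finD] by (rule sum.distrib)
    also have "(\<Sum>L | subgroup L DG. (b L - b0 L) * (order DG div card L)) = (\<Sum>L | subgroup L DG. (b L - b0 L) * (p * c' * card N))"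
    proof (rule sum.cong[OF refl])
      fix L
      show "(b L - b0 L) * (order DG div card L) = (b L - b0 L) * (p * c' * card N)"
      proof (cases "L \<in> ?S")
        case True then show ?thesis using quot by simp
      next
        case False then show ?thesis using b(3) by simp
      qed
    qed
    also have "\<dots> = p * ((\<Sum>L | subgroup L DG. b L - b0 L) * c') * card N"
      by (simp add: sum_distrib_right sum_distrib_left algebra_simps)
    finally show ?thesis by blast
  qed
  then obtain m where "card (DG.weighted_cosets b) = (l0 + p * m) * card N" using l0(1) by (auto simp: algebra_simps)
  moreover have "\<not> p dvd l0 + p * m" using l0(2) by (simp add: dvd_add_left_iff)
  ultimately show ?thesis using sup st by blast
qed

theorem exists_stable_weights:
  obtains b l where "supported b" "card (DG.weighted_cosets b) = l * card N" "\<not> p dvd l"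
    "\<And>L L'. L \<in> diagonals \<Longrightarrow> L' \<in> diagonals \<Longrightarrow> fconj (fst ` L) (fst ` L') \<Longrightarrow> DG.total_mark b L = DG.total_mark b L'"
proof -
  have "1 \<le> card (carrier S)" using finite_S one_closed by (auto simp: card_gt_0_iff Suc_le_eq)
  then have "\<exists>b. supported b \<and> stable 1 b \<and> (\<exists>l. card (DG.weighted_cosets b) = l * card N \<and> \<not> p dvd l)"
  proof (induction rule: inc_induct)
    case base show ?case by (rule top_level)
  next
    case (step k) then show ?case using level_step[of k] by auto
  qed
  then obtain b l where b: "supported b" "stable 1 b" "card (DG.weighted_cosets b) = l * card N" "\<not> p dvd l"
    by blast
  show thesis
  proof (rule that[OF b(1,3,4)])
    fix L L' assume L: "L \<in> diagonals" "L' \<in> diagonals" "fconj (fst ` L) (fst ` L')"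
    have "1 \<le> card L" using diagonals_props(3)[OF L(1)] by simp
    then show "DG.total_mark b L = DG.total_mark b L'" using b(2) L unfolding stable_def by blast
  qed
qed

end

section \<open>Realization of morphisms and transfer\<close>

text \<open>\<open>lam\<close> represents an S-invariant homomorphism from \<open>N\<close> to Z/p
  with kernel \<open>M\<close>; its values are integers taken modulo p, so that the transfer can be
  an ordinary sum. \<open>stable_hom\<close> is the form in which the hypothesis on cohomology is
  carried along.\<close>

locale central_step = controlled +
  fixes M and lam :: "'a \<Rightarrow> int"
  assumes M_normal: "M \<lhd> S" and M_sub: "M \<subseteq> N"
    and lam_mult: "\<lbrakk>x \<in> N; y \<in> N\<rbrakk> \<Longrightarrow> [lam (x \<otimes> y) = lam x + lam y] (mod int p)"
    and lam_conj: "\<lbrakk>s \<in> carrier S; x \<in> N\<rbrakk> \<Longrightarrow> [lam (s \<otimes> x \<otimes> inv s) = lam x] (mod int p)"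
    and lam_ker: "x \<in> N \<Longrightarrow> [lam x = 0] (mod int p) \<longleftrightarrow> x \<in> M"
    and stable_hom: "\<lbrakk>\<And>x y. x \<in> carrier S \<Longrightarrow> y \<in> carrier S \<Longrightarrow> [\<mu> (x \<otimes> y) = \<mu> x + \<mu> y] (mod int p);
      \<phi> \<in> F P (carrier S); x \<in> P\<rbrakk> \<Longrightarrow> [\<mu> (\<phi> x) = \<mu> x] (mod int p)"

locale central_step_set = central_step +
  fixes Y :: "'y set" and act :: "'a \<times> 'a \<Rightarrow> 'y \<Rightarrow> 'y" and l :: nat
  assumes action: "finite_action DG Y act"
    and stab_diagonals: "y \<in> Y \<Longrightarrow> finite_action.stab DG act y \<in> diagonals"
    and fixed_eq: "\<lbrakk>L \<in> diagonals; L' \<in> diagonals; fconj (fst ` L) (fst ` L')\<rbrakk> \<Longrightarrow>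
      card (finite_action.fixed Y act L) = card (finite_action.fixed Y act L')"
    and card_Y: "card Y = l * card N" and l_dvd: "\<not> p dvd l"
begin

sublocale A: finite_action DG Y act by (rule action)
sublocale M: normal M S by (rule M_normal)

lemma act_D [simp]: "(u, v) \<in> D \<Longrightarrow> y \<in> Y \<Longrightarrow> act (u, v) y \<in> Y"
  by (rule A.act_closed) (simp_all del: D_iff)

lemma act_D_mult: "(u, v) \<in> D \<Longrightarrow> (u', v') \<in> D \<Longrightarrow> y \<in> Y \<Longrightarrow> act (u, v) (act (u', v') y) = act (u \<otimes> u', v \<otimes> v') y"
  using A.act_mult[of "(u, v)" "(u', v')" y] by (simp del: D_iff)

lemma act_one' [simp]: "y \<in> Y \<Longrightarrow> act (\<one>, \<one>) y = y"
  using A.act_one by simp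

lemma N_hom: "group_hom (S\<lparr>carrier := N\<rparr>) DG (\<lambda>z. (\<one>, z))"
proof -
  have "(\<lambda>z. (\<one>, z)) \<in> hom (S\<lparr>carrier := N\<rparr>) DG"
    using D_N by (intro homI) (auto simp del: D_iff)
  then show ?thesis
    using subgroup.subgroup_is_group[OF N.subgroup_axioms is_group] DG.is_group
    by (simp add: group_hom_def group_hom_axioms_def)
qed

sublocale NA: finite_action "S\<lparr>carrier := N\<rparr>" Y "\<lambda>z. act (\<one>, z)"
  by (rule pullback_action[OF N_hom action]) (simp add: finite_N)

text \<open>Stabilizers are graphs of maps that fix one, and such a graph contains
  \<open>(\<one>, z)\<close> only for \<open>z = \<one>\<close>.\<close>

lemma N_free: assumes "z \<in> N" "y \<in> Y" "act (\<one>, z) y = y" shows "z = \<one>"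
proof -
  have "(\<one>, z) \<in> A.stab y" using assms D_N by (simp add: A.stab_def del: D_iff)
  moreover obtain Q f s where "linked Q f s" "A.stab y = graph Q f"
    using stab_diagonals[OF assms(2)] by (auto simp: diagonals_def)
  ultimately show ?thesis using linked_one by (auto simp: graph_def)
qed

section \<open>Orbits of N and the transfer to N/M\<close>

definition rep :: "'y \<Rightarrow> 'y" where "rep y = (SOME t. t \<in> NA.orb y)"

definition T :: "'y set" where "T = rep ` Y"

lemma rep_orb: "y \<in> Y \<Longrightarrow> rep y \<in> NA.orb y"
  unfolding rep_def by (rule someI[of _ y]) (rule NA.orb_refl)

lemma rep_Y: "y \<in> Y \<Longrightarrow> rep y \<in> Y" using rep_orb NA.orb_subset by blast

lemma orb_rep: "y \<in> Y \<Longrightarrow> NA.orb (rep y) = NA.orb y" using NA.orb_eq rep_orb by blast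

lemma rep_eq: assumes "y \<in> Y" "y' \<in> Y" shows "rep y = rep y' \<longleftrightarrow> NA.orb y = NA.orb y'"
proof
  assume "rep y = rep y'" then show "NA.orb y = NA.orb y'" using orb_rep assms by metis
qed (simp add: rep_def)

lemma rep_T: "t \<in> T \<Longrightarrow> rep t = t"
  using rep_eq orb_rep rep_Y by (auto simp: T_def)

lemma T_Y: "t \<in> T \<Longrightarrow> t \<in> Y" using rep_Y by (auto simp: T_def)

lemma finite_T: "finite T" using A.finite_points by (simp add: T_def)

lemma rep_E: assumes "y \<in> Y" obtains z where "z \<in> N" "rep y = act (\<one>, z) y"
  using rep_orb[OF assms] by (auto simp: NA.orb_def)

lemma rep_act_N: assumes "z \<in> N" "y \<in> Y" shows "rep (act (\<one>, z) y) = rep y"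
proof -
  have "act (\<one>, z) y \<in> NA.orb y" using assms by (auto simp: NA.orb_def)
  then have "NA.orb (act (\<one>, z) y) = NA.orb y" using NA.orb_eq assms by blast
  then show ?thesis by (simp add: rep_def)
qed

lemma card_T: "card T = l"
proof -
  have "bij_betw (\<lambda>(t, z). act (\<one>, z) t) (T \<times> N) Y"
    unfolding bij_betw_def
  proof
    show "inj_on (\<lambda>(t, z). act (\<one>, z) t) (T \<times> N)"
    proof (rule inj_onI, clarify)
      fix t z t' z' assume t: "t \<in> T" "t' \<in> T" and z: "z \<in> N" "z' \<in> N"
        and e: "act (\<one>, z) t = act (\<one>, z') t'"
      have "rep t = rep t'" using rep_act_N[OF z(1)] rep_act_N[OF z(2)] e T_Y t by metis
      then have tt: "t = t'" using rep_T t by simp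
      have t': "t' \<in> Y" using T_Y t by blast
      have "act (\<one>, inv z' \<otimes> z) t' = act (\<one>, inv z') (act (\<one>, z) t')"
        using D_N z t' by (simp add: act_D_mult del: D_iff)
      also have "act (\<one>, z) t' = act (\<one>, z') t'" using e tt by simp
      also have "act (\<one>, inv z') (act (\<one>, z') t') = t'"
        using D_N z t' N_carrier by (simp add: act_D_mult del: D_iff)
      finally have "inv z' \<otimes> z = \<one>" using N_free[of "inv z' \<otimes> z"] z t' by simp
      then have "z = z'" using z N_carrier inv_solve_left'[of \<one> z' z] by simp
      with tt show "t = t' \<and> z = z'" by simp
    qed
    show "(\<lambda>(t, z). act (\<one>, z) t) ` (T \<times> N) = Y"
    proof (intro equalityI subsetI)
      fix y assume y: "y \<in> Y"
      have "y \<in> NA.orb (rep y)" using NA.orb_refl[OF y] orb_rep[OF y] by simp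
      then obtain z where "z \<in> N" "y = act (\<one>, z) (rep y)" by (auto simp: NA.orb_def)
      then show "y \<in> (\<lambda>(t, z). act (\<one>, z) t) ` (T \<times> N)" using y by (force simp: T_def)
    qed (use D_N T_Y in \<open>auto simp del: D_iff\<close>)
  qed
  then have "card T * card N = card Y" by (metis bij_betw_same_card card_cartesian_product)
  moreover have "N \<noteq> {}" using N.one_closed by blast
  then have "card N > 0" using finite_N by (simp add: card_gt_0_iff)
  ultimately show ?thesis using card_Y by simp
qed

text \<open>The sum \<open>tau\<close> is an additive form of the transfer to N/M. Modulo p it does not depend on the set
  \<open>T\<close> of representatives of the N-orbits.\<close>

definition potential :: "('y \<Rightarrow> int) \<Rightarrow> bool" where
  "potential \<omega> \<longleftrightarrow> (\<forall>z\<in>N. \<forall>y\<in>Y. [\<omega> (act (\<one>, z) y) = \<omega> y + lam z] (mod int p))"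

definition semilinear :: "'a \<Rightarrow> ('y \<Rightarrow> 'y) \<Rightarrow> bool" where
  "semilinear s g \<longleftrightarrow> s \<in> carrier S \<and> bij_betw g Y Y \<and>
     (\<forall>z\<in>N. \<forall>y\<in>Y. g (act (\<one>, z) y) = act (\<one>, s \<otimes> z \<otimes> inv s) (g y))"

definition tau :: "('y \<Rightarrow> int) \<Rightarrow> ('y \<Rightarrow> 'y) \<Rightarrow> int" where
  "tau \<omega> g = (\<Sum>t\<in>T. \<omega> (g t) - \<omega> t)"

lemma semilinear_Y: "semilinear s g \<Longrightarrow> y \<in> Y \<Longrightarrow> g y \<in> Y"
  by (auto simp: semilinear_def bij_betw_def)

lemma tau_cong: "(\<And>y. y \<in> Y \<Longrightarrow> g y = g' y) \<Longrightarrow> tau \<omega> g = tau \<omega> g'"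
  unfolding tau_def using T_Y by (intro sum.cong) auto

text \<open>Moving \<open>y\<close> by \<open>z\<close> changes both terms by \<open>lam z\<close>,
  the first one because \<open>lam\<close> is invariant under conjugation by \<open>s\<close>. The
  displacement of \<open>\<omega>\<close> under \<open>g\<close> is therefore a function on
  N-orbits, which is why representatives do not matter.\<close>

lemma shift_const:
  assumes g: "semilinear s g" and \<omega>: "potential \<omega>" and y: "y \<in> Y" and z: "z \<in> N"
  shows "[\<omega> (g (act (\<one>, z) y)) - \<omega> (act (\<one>, z) y) = \<omega> (g y) - \<omega> y] (mod int p)"
proof -
  have s: "s \<in> carrier S" and e: "g (act (\<one>, z) y) = act (\<one>, s \<otimes> z \<otimes> inv s) (g y)"
    using g y z by (auto simp: semilinear_def)
  have sz: "s \<otimes> z \<otimes> inv s \<in> N" using N.inv_op_closed2 s z by blast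
  have "[\<omega> (g (act (\<one>, z) y)) = \<omega> (g y) + lam z] (mod int p)"
    unfolding e using \<omega> sz semilinear_Y[OF g y] cong_trans[OF _ cong_add[OF cong_refl lam_conj[OF s z]]]
    unfolding potential_def by blast
  moreover have "[\<omega> (act (\<one>, z) y) = \<omega> y + lam z] (mod int p)"
    using \<omega> y z by (simp add: potential_def)
  ultimately have "[\<omega> (g (act (\<one>, z) y)) - \<omega> (act (\<one>, z) y) = (\<omega> (g y) + lam z) - (\<omega> y + lam z)] (mod int p)"
    by (rule cong_diff)
  then show ?thesis by simp
qed

lemma semilinear_orb:
  assumes g: "semilinear s g" and y: "y \<in> Y" "y' \<in> Y" and o: "NA.orb (g y) = NA.orb (g y')"
  shows "NA.orb y = NA.orb y'"
proof -
  have s: "s \<in> carrier S" using g by (simp add: semilinear_def)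
  have "g y' \<in> NA.orb (g y)" using NA.orb_refl[OF semilinear_Y[OF g y(2)]] o by simp
  then obtain z where z: "z \<in> N" "g y' = act (\<one>, z) (g y)" by (auto simp: NA.orb_def)
  let ?z = "inv s \<otimes> z \<otimes> s"
  have z': "?z \<in> N" using N.inv_op_closed1 s z(1) by blast
  have "s \<otimes> ?z \<otimes> inv s = z" using s N_carrier[OF z(1)] by (simp add: m_assoc) (simp flip: m_assoc)
  then have "g (act (\<one>, ?z) y) = g y'" using g z' y(1) z(2) by (simp add: semilinear_def)
  moreover have "act (\<one>, ?z) y \<in> Y" using D_N[OF z'] y(1) by (simp del: D_iff)
  ultimately have "act (\<one>, ?z) y = y'" using g y(2) by (auto simp: semilinear_def bij_betw_def inj_on_def)
  then have "y' \<in> NA.orb y" using z' by (auto simp: NA.orb_def)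
  then show ?thesis using NA.orb_eq[OF y(1)] by simp
qed

lemma rep_inj: assumes g: "semilinear s g" shows "inj_on (\<lambda>t. rep (g t)) T"
proof (rule inj_onI)
  fix t t' assume t: "t \<in> T" "t' \<in> T" and e: "rep (g t) = rep (g t')"
  have Y: "t \<in> Y" "t' \<in> Y" "g t \<in> Y" "g t' \<in> Y" using t T_Y semilinear_Y[OF g] by auto
  have "NA.orb (g t) = NA.orb (g t')" using e rep_eq Y by blast
  then have "rep t = rep t'" using semilinear_orb[OF g Y(1,2)] by (simp add: rep_def)
  then show "t = t'" using rep_T t by simp
qed

lemma sum_reindex_T:
  assumes g: "semilinear s g" and U: "U \<subseteq> T" "\<And>t. t \<in> U \<Longrightarrow> rep (g t) \<in> U"
    and h: "\<And>y z. \<lbrakk>y \<in> Y; z \<in> N; rep y \<in> U\<rbrakk> \<Longrightarrow> [h (act (\<one>, z) y) = h y] (mod int p)"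
  shows "[(\<Sum>t\<in>U. h (g t)) = (\<Sum>t\<in>U. h t)] (mod int p)"
proof -
  have fU: "finite U" using finite_subset[OF U(1) finite_T] .
  have inj: "inj_on (\<lambda>t. rep (g t)) U" using inj_on_subset[OF rep_inj[OF g] U(1)] .
  have "(\<lambda>t. rep (g t)) ` U \<subseteq> U" using U(2) by (rule image_subsetI)
  then have im: "(\<lambda>t. rep (g t)) ` U = U" using inj by (rule endo_inj_surj[OF fU])
  have "[(\<Sum>t\<in>U. h (g t)) = (\<Sum>t\<in>U. h (rep (g t)))] (mod int p)"
  proof (rule cong_sum)
    fix t assume t: "t \<in> U"
    have gY: "g t \<in> Y" using t U(1) T_Y semilinear_Y[OF g] by blast
    obtain z where z: "z \<in> N" "rep (g t) = act (\<one>, z) (g t)" using rep_E[OF gY] .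
    have "[h (act (\<one>, z) (g t)) = h (g t)] (mod int p)" by (rule h[OF gY z(1) U(2)[OF t]])
    then show "[h (g t) = h (rep (g t))] (mod int p)" unfolding z(2) by (rule cong_sym)
  qed
  also have "(\<Sum>t\<in>U. h (rep (g t))) = (\<Sum>t\<in>U. h t)"
    using sum.reindex[OF inj, of h] im by simp
  finally show ?thesis .
qed

text \<open>Insert the intermediate value \<open>\<omega> (g' t)\<close>. The outer difference is
  then summed over another system of orbit representatives, which gives the same result modulo
  p.\<close>

lemma tau_comp:
  assumes g: "semilinear s g" and g': "semilinear s' g'" and \<omega>: "potential \<omega>"
  shows "[tau \<omega> (\<lambda>y. g (g' y)) = tau \<omega> g + tau \<omega> g'] (mod int p)"
proof -
  have "tau \<omega> (\<lambda>y. g (g' y)) = (\<Sum>t\<in>T. \<omega> (g (g' t)) - \<omega> (g' t)) + tau \<omega> g'"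
    by (simp add: tau_def flip: sum.distrib)
  moreover have "[(\<Sum>t\<in>T. \<omega> (g (g' t)) - \<omega> (g' t)) = tau \<omega> g] (mod int p)"
    unfolding tau_def
  proof (rule sum_reindex_T[OF g' subset_refl, where h = "\<lambda>y. \<omega> (g y) - \<omega> y"])
    show "rep (g' t) \<in> T" if "t \<in> T" for t
      unfolding T_def using semilinear_Y[OF g' T_Y[OF that]] by (rule imageI)
  qed (rule shift_const[OF g \<omega>])
  ultimately show ?thesis by (simp add: cong_add)
qed

lemma semilinear_comp:
  assumes g: "semilinear s g" and g': "semilinear s' g'" shows "semilinear (s \<otimes> s') (\<lambda>y. g (g' y))"
  unfolding semilinear_def
proof (intro conjI ballI)
  have s: "s \<in> carrier S" "s' \<in> carrier S" using g g' by (auto simp: semilinear_def)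
  then show "s \<otimes> s' \<in> carrier S" by simp
  show "bij_betw (\<lambda>y. g (g' y)) Y Y"
    using bij_betw_trans[of g' Y Y g Y] g g' by (simp add: semilinear_def comp_def)
  fix z y assume z: "z \<in> N" and y: "y \<in> Y"
  have sz: "s' \<otimes> z \<otimes> inv s' \<in> N" using N.inv_op_closed2 s z by blast
  have "g (g' (act (\<one>, z) y)) = act (\<one>, s \<otimes> (s' \<otimes> z \<otimes> inv s') \<otimes> inv s) (g (g' y))"
    using g g' z y sz semilinear_Y[OF g' y] by (simp add: semilinear_def)
  also have "s \<otimes> (s' \<otimes> z \<otimes> inv s') \<otimes> inv s = s \<otimes> s' \<otimes> z \<otimes> inv (s \<otimes> s')"
    using s N_carrier[OF z] by (simp add: m_assoc inv_mult_group)
  finally show "g (g' (act (\<one>, z) y)) = act (\<one>, s \<otimes> s' \<otimes> z \<otimes> inv (s \<otimes> s')) (g (g' y))" .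
qed

lemma act_comm:
  assumes "(a, b) \<in> D" "(u, v) \<in> D" "y \<in> Y"
  shows "act (a, b) (act (u, v) y) = act (a \<otimes> u \<otimes> inv a, b \<otimes> v \<otimes> inv b) (act (a, b) y)"
proof -
  have c: "a \<in> carrier S" "b \<in> carrier S" "u \<in> carrier S" "v \<in> carrier S" using assms by auto
  have D: "(a \<otimes> u \<otimes> inv a, b \<otimes> v \<otimes> inv b) \<in> D" using assms c N.cg_conj by simp
  have "a \<otimes> u \<otimes> inv a \<otimes> a = a \<otimes> u" "b \<otimes> v \<otimes> inv b \<otimes> b = b \<otimes> v" using c by (simp_all add: m_assoc)
  then show ?thesis using assms D by (simp add: act_D_mult del: D_iff)
qed

lemma semilinear_act: assumes "(a, b) \<in> D" shows "semilinear b (act (a, b))"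
proof -
  have c: "a \<in> carrier S" "b \<in> carrier S" using assms by auto
  have "act (a, b) (act (\<one>, z) y) = act (\<one>, b \<otimes> z \<otimes> inv b) (act (a, b) y)"
    if "z \<in> N" "y \<in> Y" for z y
    using act_comm[OF assms D_N[OF that(1)] that(2)] c by simp
  then show ?thesis using c A.bij_betw_act[of "(a, b)"] assms by (simp add: semilinear_def del: D_iff)
qed

text \<open>Each of the \<open>l\<close> orbits contributes \<open>lam z\<close>. Since
  \<open>l\<close> is prime to p, the transfer detects \<open>lam\<close>.\<close>

lemma tau_act_N:
  assumes \<omega>: "potential \<omega>" and z: "z \<in> N"
    shows "[tau \<omega> (act (\<one>, z)) = int l * lam z] (mod int p)"
proof -
  have "[tau \<omega> (act (\<one>, z)) = (\<Sum>t\<in>T. lam z)] (mod int p)"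
    unfolding tau_def
  proof (rule cong_sum)
    fix t assume "t \<in> T"
    then have "[\<omega> (act (\<one>, z) t) = \<omega> t + lam z] (mod int p)"
      using \<omega> z T_Y by (simp add: potential_def)
    from cong_diff[OF this cong_refl[of "\<omega> t"]]
    show "[\<omega> (act (\<one>, z) t) - \<omega> t = lam z] (mod int p)" by simp
  qed
  then show ?thesis by (simp add: card_T)
qed

lemma tau_act_mult:
  assumes \<omega>: "potential \<omega>" and D: "(a, b) \<in> D" "(c, d) \<in> D"
  shows "[tau \<omega> (act (a \<otimes> c, b \<otimes> d)) = tau \<omega> (act (a, b)) + tau \<omega> (act (c, d))] (mod int p)"
proof -
  have "tau \<omega> (act (a \<otimes> c, b \<otimes> d)) = tau \<omega> (\<lambda>y. act (a, b) (act (c, d) y))"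
    using act_D_mult[OF D] by (intro tau_cong) simp
  then show ?thesis using tau_comp[OF semilinear_act[OF D(1)] semilinear_act[OF D(2)] \<omega>] by simp
qed

text \<open>Equivariance along \<open>f\<close> in the first coordinate and along conjugation by the
  label in the second. It is demanded for pairs over \<open>Q\<close>, where \<open>f\<close> is
  meaningful; these include all pairs \<open>(\<one>, z)\<close>, which yields
  semilinearity.\<close>

definition realizes :: "'a set \<Rightarrow> ('a \<Rightarrow> 'a) \<Rightarrow> 'a \<Rightarrow> ('y \<Rightarrow> 'y) \<Rightarrow> bool" where
  "realizes Q f s g \<longleftrightarrow> bij_betw g Y Y \<and>
    (\<forall>u v y. (u, v) \<in> D \<longrightarrow> u \<in> Q \<longrightarrow> y \<in> Y \<longrightarrow> g (act (u, v) y) = act (f u, s \<otimes> v \<otimes> inv s) (g y))"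

lemma fixed_empty: assumes "subgroup K DG" "K \<notin> diagonals" shows "A.fixed K = {}"
proof (rule ccontr)
  assume "A.fixed K \<noteq> {}"
  then obtain y where "y \<in> Y" "K \<subseteq> A.stab y" using A.fixed_iff[OF subgroup.subset[OF assms(1)]] by blast
  then show False using diagonals_sub[OF stab_diagonals _ ] assms by blast
qed

lemma linked_compatible: "linked Q f s \<Longrightarrow> compatible Q f s (carrier S) (\<lambda>v. s \<otimes> v \<otimes> inv s) s"
  using linked_label by (auto simp: compatible_def intro!: linked_conj subgroup_self)

text \<open>The pairs over \<open>Q\<close> act on \<open>Y\<close> directly and through the product
  of \<open>f\<close> and conjugation by \<open>s\<close>. A subgroup in \<open>diagonals\<close>
  and its image have conjugate first projections and so equal marks; any other subgroup and its
  image have no fixed points. Burnside's theorem supplies the bijection.\<close>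

lemma exists_realization: assumes l: "linked Q f s" obtains g where "realizes Q f s g"
proof -
  let ?P = "map_prod f (\<lambda>v. s \<otimes> v \<otimes> inv s)" and ?B = "{(u, v) \<in> D. u \<in> Q}"
  note c = linked_compatible[OF l]
  have Q: "subgroup Q S" by (rule linked_subgroup[OF l])
  have B: "subgroup ?B DG"
  proof (rule DG.subgroupI)
    show "?B \<noteq> {}" using subgroup.one_closed[OF Q] by (auto intro!: exI[of _ \<one>])
    fix a assume "a \<in> ?B"
    then obtain u v where a: "a = (u, v)" "(u, v) \<in> D" "u \<in> Q" by auto
    then show "inv\<^bsub>DG\<^esub> a \<in> ?B"
      using subgroup.m_inv_closed[OF Q] inv_DG[OF a(2)] DG.inv_closed[of a] by (simp del: D_iff)
    fix b assume "b \<in> ?B"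
    then obtain u' v' where b: "b = (u', v')" "(u', v') \<in> D" "u' \<in> Q" by auto
    then show "a \<otimes>\<^bsub>DG\<^esub> b \<in> ?B"
      using a subgroup.m_closed[OF Q] DG.m_closed[of a b] by (simp del: D_iff)
  qed auto
  have BP: "?B \<subseteq> Q \<times> carrier S" by auto
  let ?G = "DG\<lparr>carrier := ?B\<rparr>"
  interpret A1: finite_action ?G Y act by (rule A.restrict_action[OF B])
  interpret A2: finite_action ?G Y "\<lambda>g. act (?P g)"
    by (rule pullback_action[OF compatible_hom[OF c B BP] action]) (rule A1.finite_carrier)
  have "card (A1.fixed K) = card (A2.fixed K)" if K: "subgroup K ?G" for K
  proof -
    have sK: "subgroup K DG" using DG.incl_subgroup[OF B K] .
    have KB: "K \<subseteq> Q \<times> carrier S" using subgroup.subset[OF K] BP by auto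
    have f1: "A1.fixed K = A.fixed K" and f2: "A2.fixed K = A.fixed (?P ` K)"
      by (auto simp: A1.fixed_def A2.fixed_def A.fixed_def)
    have sP: "subgroup (?P ` K) DG"
      using group_hom.img_is_subgroup[OF compatible_hom[OF c sK KB]] by simp
    show ?thesis
    proof (cases "K \<in> diagonals")
      case True
      then show ?thesis using compatible_diagonals[OF c True KB] fixed_eq f1 f2 by simp
    next
      case False
      then have "?P ` K \<notin> diagonals" using compatible_diagonals_iff[OF c KB] by simp
      then show ?thesis using fixed_empty sK sP False f1 f2 by simp
    qed
  qed
  from isomorphic_of_marks[OF A1.finite_action_axioms A2.finite_action_axioms this]
  obtain g where "bij_betw g Y Y" "\<And>x y. x \<in> ?B \<Longrightarrow> y \<in> Y \<Longrightarrow> g (act x y) = act (?P x) (g y)" by auto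
  then have "realizes Q f s g" unfolding realizes_def by auto
  then show thesis by (rule that)
qed

lemma realizes_semilinear: assumes l: "linked Q f s" and g: "realizes Q f s g" shows "semilinear s g"
  using g linked_label[OF l] D_N linked_one[OF l] subgroup.one_closed[OF linked_subgroup[OF l]]
  unfolding semilinear_def realizes_def by auto

lemma exists_potential_on_Y: obtains \<omega> where "potential \<omega>"
proof -
  have "[lam z = 0] (mod int p)" if "y \<in> Y" "z \<in> NA.stab y" for y z
    using that N_free[of z y] lam_ker[of z] by (auto simp: NA.stab_def M.one_closed)
  then obtain \<omega> where "\<forall>z\<in>carrier (S\<lparr>carrier := N\<rparr>). \<forall>y\<in>Y. [\<omega> (act (\<one>, z) y) = \<omega> y + lam z] (mod int p)"
    using NA.exists_potential[of lam "int p"] lam_mult by auto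
  then show thesis using that by (simp add: potential_def)
qed

lemma l_cancel: assumes "[int l * a = 0] (mod int p)" shows "[a = 0] (mod int p)"
proof -
  have "int p dvd int l * a" using assms by (simp add: cong_0_iff)
  moreover have "Factorial_Ring.prime (int p)" using prime by simp
  ultimately have "int p dvd int l \<or> int p dvd a" using prime_dvd_mult_iff by blast
  then show ?thesis using l_dvd by (simp add: cong_0_iff)
qed

text \<open>Conjugating the action of (u, u) by a realization of f changes it by an element of N, whose
  image under lam is the difference of two values of a homomorphism from S to Z/p.\<close>

theorem linked_cg_M: assumes l: "linked Q f s" and u: "u \<in> Q" shows "M.cg (f u) (s \<otimes> u \<otimes> inv s)"
proof -
  obtain \<omega> where \<omega>: "potential \<omega>" by (rule exists_potential_on_Y)
  obtain g where g: "realizes Q f s g" by (rule exists_realization[OF l])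
  have sg: "semilinear s g" by (rule realizes_semilinear[OF l g])
  define \<mu> where "\<mu> a = tau \<omega> (act (a, a))" for a
  have hom: "[\<mu> (a \<otimes> b) = \<mu> a + \<mu> b] (mod int p)" if "a \<in> carrier S" "b \<in> carrier S" for a b
    unfolding \<mu>_def using tau_act_mult[OF \<omega> D_diag[OF that(1)] D_diag[OF that(2)]] .
  have Q: "subgroup Q S" by (rule linked_subgroup[OF l])
  have c: "u \<in> carrier S" "f u \<in> carrier S" "s \<in> carrier S"
    using subgroup.mem_carrier[OF Q u] linked_closed[OF l u] linked_label[OF l] by auto
  let ?w = "s \<otimes> u \<otimes> inv s"
  let ?n = "inv (f u) \<otimes> ?w"
  have wc: "?w \<in> carrier S" using c by simp
  have "N.cg ?n (inv (f u) \<otimes> f u)"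
    using N.cg_sym[OF linked_cg[OF l u]] c wc by (intro N.cg_mult N.cg_refl) auto
  then have nN: "?n \<in> N" using N.cg_one_iff[of ?n] c by simp
  have D: "(u, u) \<in> D" "(f u, f u) \<in> D" "(\<one>, ?n) \<in> D" "(f u, ?w) \<in> D"
    using c D_N[OF nN] linked_cg[OF l u] by auto
  \<comment> \<open>Splitting off a diagonal pair isolates the discrepancy \<open>?n\<close> between
    \<open>f u\<close> and conjugation by the label in a pair \<open>(\<one>, ?n)\<close>.\<close>
  have e: "(f u, ?w) = (f u \<otimes> \<one>, f u \<otimes> ?n)" using c by (simp flip: m_assoc)
  \<comment> \<open>The transfer of the realization itself is unknown, but it occurs in both
    composites and cancels.\<close>
  have "tau \<omega> (\<lambda>y. g (act (u, u) y)) = tau \<omega> (\<lambda>y. act (f u, ?w) (g y))"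
    using g u D(1) by (intro tau_cong) (simp add: realizes_def del: D_iff)
  then have "[tau \<omega> g + \<mu> u = tau \<omega> (act (f u, ?w)) + tau \<omega> g] (mod int p)"
    using cong_trans[OF cong_sym[OF tau_comp[OF sg semilinear_act[OF D(1)] \<omega>]]]
      tau_comp[OF semilinear_act[OF D(4)] sg \<omega>] unfolding \<mu>_def by simp
  then have "[\<mu> u + tau \<omega> g = tau \<omega> (act (f u, ?w)) + tau \<omega> g] (mod int p)"
    by (simp add: add.commute)
  then have "[\<mu> u = tau \<omega> (act (f u, ?w))] (mod int p)" by (simp only: cong_add_rcancel)
  also have "[tau \<omega> (act (f u, ?w)) = \<mu> (f u) + tau \<omega> (act (\<one>, ?n))] (mod int p)"
    unfolding e \<mu>_def by (rule tau_act_mult[OF \<omega> D(2,3)])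
  also have "[\<mu> (f u) + tau \<omega> (act (\<one>, ?n)) = \<mu> u + int l * lam ?n] (mod int p)"
  proof (rule cong_add[OF _ tau_act_N[OF \<omega> nN]])
    have "[\<mu> (restrict f Q u) = \<mu> u] (mod int p)" by (rule stable_hom[OF hom linked_F[OF l] u])
    then show "[\<mu> (f u) = \<mu> u] (mod int p)" using u by simp
  qed
  finally have "[\<mu> u + 0 = \<mu> u + int l * lam ?n] (mod int p)" by simp
  then have "[int l * lam ?n = 0] (mod int p)" using cong_add_lcancel cong_sym by blast
  then have "?n \<in> M" using l_cancel lam_ker[OF nN] by blast
  then have "M.cg (f u \<otimes> ?n) (f u \<otimes> \<one>)" using c wc M.cg_one by (intro M.cg_mult M.cg_refl) auto
  then have "M.cg ?w (f u)" using c by (simp flip: m_assoc)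
  then show ?thesis using M.cg_sym c wc by blast
qed

text \<open>By invariance of \<open>lam\<close>, a commutator of \<open>n\<close> with any element
  has \<open>lam\<close> zero and so lies in \<open>M\<close>: the quotient N/M is central in
  S/M.\<close>

lemma commutator_M: assumes "n \<in> N" "u \<in> carrier S"
  shows "M.cg (n \<otimes> u \<otimes> inv n) u" "M.cg (u \<otimes> n \<otimes> inv u) n"
proof -
  have nc: "n \<in> carrier S" using assms(1) by (rule N_carrier)
  have key: "a \<otimes> n \<otimes> inv a \<otimes> inv n \<in> M" if a: "a \<in> carrier S" for a
  proof -
    have N: "a \<otimes> n \<otimes> inv a \<in> N" "inv n \<in> N" using N.inv_op_closed2 a assms(1) by auto
    have "[lam (a \<otimes> n \<otimes> inv a \<otimes> inv n) = lam (a \<otimes> n \<otimes> inv a) + lam (inv n)] (mod int p)" using lam_mult N by blast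
    also have "[lam (a \<otimes> n \<otimes> inv a) + lam (inv n) = lam n + lam (inv n)] (mod int p)"
      using lam_conj[OF a assms(1)] by (intro cong_add) auto
    also have "[lam n + lam (inv n) = lam (n \<otimes> inv n)] (mod int p)"
      using lam_mult[OF assms(1) N(2)] by (rule cong_sym)
    also have "[lam (n \<otimes> inv n) = 0] (mod int p)" using lam_ker[of \<one>] nc N.one_closed M.one_closed by simp
    finally show ?thesis using lam_ker N by simp
  qed
  then show "M.cg (u \<otimes> n \<otimes> inv u) n" using assms(2) by (simp add: M.cg_def)
  have "inv (u \<otimes> n \<otimes> inv u \<otimes> inv n) \<in> M" using key[OF assms(2)] by blast
  then show "M.cg (n \<otimes> u \<otimes> inv n) u" using assms(2) nc by (simp add: M.cg_def inv_mult_group m_assoc)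
qed

text \<open>An automorphism of order k prime to p is its own c-th power, where c is 1 modulo k and 0 modulo p,
  and the c-th power of a realization has transfer 0.\<close>

lemma realization_tau:
  assumes \<omega>: "potential \<omega>"
  shows "linked Q f s \<Longrightarrow> \<exists>g. realizes Q f s g \<and> [tau \<omega> g = tau \<omega> (act (s, s))] (mod int p)"
proof (induction rule: linked.induct)
  case (linked_p' \<alpha> P k Q f)
  have P: "subgroup P S" by (rule F_dom[OF linked_p'(1)])
  have im: "\<alpha> ` P = P" using F_self_bij[OF linked_p'(1)] by (simp add: bij_betw_def)
  have la: "linked P \<alpha> \<one>" using linked.linked_p'[OF linked_p'(1-4) P] by blast
  obtain g where g: "realizes P \<alpha> \<one> g" by (rule exists_realization[OF la])
  have sg: "semilinear \<one> g" by (rule realizes_semilinear[OF la g])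
  \<comment> \<open>The label is one, so a realization leaves second coordinates alone and its
    powers realize the powers of \<open>\<alpha>\<close> with the same label.\<close>
  have iter: "realizes P (\<alpha> ^^ n) \<one> (g ^^ n) \<and> semilinear \<one> (g ^^ n) \<and>
    [tau \<omega> (g ^^ n) = int n * tau \<omega> g] (mod int p)" for n
  proof (induction n)
    case 0
    have "tau \<omega> id = 0" by (simp add: tau_def)
    moreover have "realizes P id \<one> id" using subgroup.mem_carrier[OF P] by (auto simp: realizes_def)
    moreover have "semilinear \<one> id" using N_carrier by (auto simp: semilinear_def)
    ultimately show ?case by (simp add: id_def)
  next
    case (Suc n)
    have r: "realizes P (\<alpha> ^^ n) \<one> (g ^^ n)" and sl: "semilinear \<one> (g ^^ n)"
      and t: "[tau \<omega> (g ^^ n) = int n * tau \<omega> g] (mod int p)"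
      using Suc by auto
    have an: "(\<alpha> ^^ n) u \<in> P" if "u \<in> P" for u using that im by (induction n) auto
    have "g ((g ^^ n) (act (u, v) y)) = act (\<alpha> ((\<alpha> ^^ n) u), v) (g ((g ^^ n) y))"
      if D: "(u, v) \<in> D" and u: "u \<in> P" and y: "y \<in> Y" for u v y
    proof -
      have vc: "v \<in> carrier S" using D by simp
      have e: "(g ^^ n) (act (u, v) y) = act ((\<alpha> ^^ n) u, v) ((g ^^ n) y)"
        using r D u y vc by (simp add: realizes_def del: D_iff)
      have "((\<alpha> ^^ n) u, v) \<in> D"
      proof -
        have "compatible P (\<alpha> ^^ n) \<one> (carrier S) (\<lambda>v. \<one> \<otimes> v \<otimes> inv \<one>) \<one>"
        proof -
          have "linked P (\<alpha> ^^ m) \<one>" for m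
          proof (induction m)
            case 0 show ?case using linked_id[OF P, of id] by (simp add: id_def)
          next
            case (Suc m)
            have "(\<alpha> ^^ m) ` P \<subseteq> P" using im by (induction m) auto
            then have "linked ((\<alpha> ^^ m) ` P) \<alpha> \<one>"
              using linked_restrict[OF la linked_image[OF Suc]] by blast
            then have "linked P (\<alpha> ^^ Suc m) (\<one> \<otimes> \<one>)" by (intro linked_comp[OF Suc]) auto
            then show ?case by (simp add: comp_def)
          qed
          then show ?thesis by (rule linked_compatible)
        qed
        from compatible_D[OF this D u] show ?thesis using vc by simp
      qed
      then have "g (act ((\<alpha> ^^ n) u, v) ((g ^^ n) y)) = act (\<alpha> ((\<alpha> ^^ n) u), \<one> \<otimes> v \<otimes> inv \<one>) (g ((g ^^ n) y))"
        using g an[OF u] semilinear_Y[OF sl y] unfolding realizes_def by blast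
      then show ?thesis using e vc by simp
    qed
    moreover have sl': "semilinear \<one> (g ^^ Suc n)" using semilinear_comp[OF sg sl] by (simp add: comp_def)
    ultimately have "realizes P (\<alpha> ^^ Suc n) \<one> (g ^^ Suc n)"
      unfolding realizes_def by (auto simp: semilinear_def)
    moreover have "[tau \<omega> (g ^^ Suc n) = tau \<omega> g + int n * tau \<omega> g] (mod int p)"
      using cong_trans[OF tau_comp[OF sg sl \<omega>] cong_add[OF cong_refl t]] by (simp add: comp_def)
    ultimately show ?case using sl' by (simp add: algebra_simps comp_def)
  qed
  obtain c where c: "[c = 1] (mod k)" "[c = 0] (mod p)"
    using binary_chinese_remainder_nat[OF linked_p'(3), of 1 0] by blast
  have ac: "(\<alpha> ^^ c) x = \<alpha> x" if x: "x \<in> P" for x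
  proof -
    have "(\<alpha> ^^ k) x = x" using linked_p'(4) x by blast
    then have "(\<alpha> ^^ c) x = (\<alpha> ^^ (c mod k)) x" "(\<alpha> ^^ 1) x = (\<alpha> ^^ (1 mod k)) x"
      by (metis funpow_mod_eq)+
    then show ?thesis using c(1) by (simp add: cong_def)
  qed
  have "realizes Q f \<one> (g ^^ c)"
    using iter[of c] ac linked_p'(6,7) unfolding realizes_def by (metis subsetD)
  moreover have "[tau \<omega> (g ^^ c) = tau \<omega> (act (\<one>, \<one>))] (mod int p)"
  proof -
    have "tau \<omega> (act (\<one>, \<one>)) = 0" using T_Y by (simp add: tau_def)
    moreover have "[int c * tau \<omega> g = 0] (mod int p)" using c(2) by (simp add: cong_0_iff)
    ultimately show ?thesis using iter[of c] cong_trans by metis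
  qed
  ultimately show ?case by blast
next
  case (linked_conj Q s f)
  have "realizes Q f s (act (s, s))"
    unfolding realizes_def
  proof (intro conjI allI impI)
    show "bij_betw (act (s, s)) Y Y" using semilinear_act[OF D_diag[OF linked_conj(2)]] by (simp add: semilinear_def)
    fix u v y assume "(u, v) \<in> D" "u \<in> Q" "y \<in> Y"
    then show "act (s, s) (act (u, v) y) = act (f u, s \<otimes> v \<otimes> inv s) (act (s, s) y)"
      using act_comm[OF D_diag[OF linked_conj(2)]] linked_conj(3) by simp
  qed
  then show ?case by (intro exI[of _ "act (s, s)"] conjI cong_refl)
next
  case (linked_comp Q f s f' t h)
  obtain g where g: "realizes Q f s g" "[tau \<omega> g = tau \<omega> (act (s, s))] (mod int p)"
    using linked_comp by blast
  obtain g' where g': "realizes (f ` Q) f' t g'" "[tau \<omega> g' = tau \<omega> (act (t, t))] (mod int p)"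
    using linked_comp by blast
  have sg: "semilinear s g" and sg': "semilinear t g'"
    using realizes_semilinear linked_comp(1,2) g(1) g'(1) by auto
  have c: "s \<in> carrier S" "t \<in> carrier S" using linked_label linked_comp(1,2) by auto
  have "realizes Q h (t \<otimes> s) (\<lambda>y. g' (g y))"
    unfolding realizes_def
  proof (intro conjI allI impI)
    show "bij_betw (\<lambda>y. g' (g y)) Y Y" using semilinear_comp[OF sg' sg] by (simp add: semilinear_def)
    fix u v y assume a: "(u, v) \<in> D" "u \<in> Q" "y \<in> Y"
    have vc: "v \<in> carrier S" using a by simp
    have D: "(f u, s \<otimes> v \<otimes> inv s) \<in> D"
      using compatible_D[OF linked_compatible[OF linked_comp(1)] a(1,2)] vc by blast
    have "g' (g (act (u, v) y)) = g' (act (f u, s \<otimes> v \<otimes> inv s) (g y))" using g(1) a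
      unfolding realizes_def by simp
    also have "\<dots> = act (f' (f u), t \<otimes> (s \<otimes> v \<otimes> inv s) \<otimes> inv t) (g' (g y))"
      using g'(1) D a(2) semilinear_Y[OF sg a(3)] unfolding realizes_def by blast
    also have "t \<otimes> (s \<otimes> v \<otimes> inv s) \<otimes> inv t = (t \<otimes> s) \<otimes> v \<otimes> inv (t \<otimes> s)"
      using c vc by (simp add: m_assoc inv_mult_group)
    finally show "g' (g (act (u, v) y)) = act (h u, t \<otimes> s \<otimes> v \<otimes> inv (t \<otimes> s)) (g' (g y))"
      using linked_comp(3) a(2) by simp
  qed
  moreover have "[tau \<omega> (\<lambda>y. g' (g y)) = tau \<omega> (act (t \<otimes> s, t \<otimes> s))] (mod int p)"
    using cong_trans[OF cong_trans[OF tau_comp[OF sg' sg \<omega>] cong_add[OF g'(2) g(2)]]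
        cong_sym[OF tau_act_mult[OF \<omega> D_diag[OF c(2)] D_diag[OF c(1)]]]] .
  ultimately show ?case by blast
qed

text \<open>The inverse of \<open>f\<close> extends from the image of \<open>R\<close> to a subgroup
  containing \<open>z\<close>, since \<open>z\<close> acts trivially on that image and
  \<open>R\<close> is fully centralized. The extension sends \<open>z\<close> to an element of
  \<open>N\<close> that centralizes \<open>R\<close>, hence into \<open>M\<close> by
  \<open>C\<close>, and by \<open>linked_cg_M\<close> and centrality of N/M this element is
  congruent to \<open>z\<close> modulo \<open>M\<close>.\<close>

lemma centralizing_lam:
  assumes l: "linked R f s" and fn: "fully_normalized S F R"
    and C: "\<And>c. c \<in> N \<Longrightarrow> c \<in> centralizer S R \<Longrightarrow> c \<in> M"
    and z: "z \<in> N" "\<And>u. u \<in> R \<Longrightarrow> z \<otimes> f u = f u \<otimes> z"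
  shows "z \<in> M"
proof -
  have R: "subgroup R S" and fR: "subgroup (f ` R) S" using linked_subgroup linked_image l by auto
  define \<phi> where "\<phi> = restrict (inv_into R f) (f ` R)"
  have \<phi>F: "\<phi> \<in> F (f ` R) (carrier S)" unfolding \<phi>_def by (rule linked_F[OF linked_inv[OF l]])
  have \<phi>f: "\<phi> (f u) = u" if "u \<in> R" for u using that linked_inj[OF l] by (simp add: \<phi>_def)
  have im: "\<phi> ` f ` R = R" using \<phi>f by (force simp: image_image)
  have fc: "fully_centralized S F (\<phi> ` f ` R)" unfolding im by (rule fully_normalized_centralized[OF fn])
  have zc: "z \<in> carrier S" using z(1) by (rule N_carrier)
  obtain E \<psi> where \<psi>: "\<psi> \<in> F E (carrier S)" "f ` R \<subseteq> E" "\<And>u. u \<in> f ` R \<Longrightarrow> \<psi> u = \<phi> u"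
    "\<And>a b. \<lbrakk>a \<in> setwise_normalizer (f ` R); b \<in> carrier S;
       \<And>u. u \<in> f ` R \<Longrightarrow> \<phi> (a \<otimes> u \<otimes> inv a) = b \<otimes> \<phi> u \<otimes> inv b\<rbrakk> \<Longrightarrow> a \<in> E"
    using extend[OF \<phi>F fc] by metis
  have zu: "z \<otimes> v \<otimes> inv z = v" if v: "v \<in> f ` R" for v
  proof -
    have "z \<otimes> v = v \<otimes> z" using v z(2) by blast
    then show ?thesis using zc subgroup.mem_carrier[OF fR v] by (simp add: m_assoc)
  qed
  have zE: "z \<in> E"
  proof (rule \<psi>(4)[OF _ one_closed])
    have "conjugate z (f ` R) = f ` R" using zu by (force simp: conjugate_def)
    then show "z \<in> setwise_normalizer (f ` R)" using zc by (simp add: setwise_normalizer_def)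
    fix v assume v: "v \<in> f ` R"
    then have "\<phi> v \<in> carrier S" using im subgroup.mem_carrier[OF R] by blast
    then show "\<phi> (z \<otimes> v \<otimes> inv z) = \<one> \<otimes> \<phi> v \<otimes> inv \<one>"
      using zu[OF v] by simp
  qed
  obtain t where t: "linked E \<psi> t" using every_morphism_linked[OF \<psi>(1)] by blast
  have c: "t \<in> carrier S" "\<psi> z \<in> carrier S" using linked_label[OF t] linked_closed[OF t zE] by auto
  have cg: "M.cg (\<psi> z) z"
    using M.cg_trans[OF linked_cg_M[OF t zE] commutator_M(2)[OF z(1) c(1)]] c zc by simp
  have "\<psi> z \<in> N"
  proof -
    have "\<psi> z \<otimes> inv z \<in> N" using cg M_sub by (auto simp: M.cg_def)
    then have "\<psi> z \<otimes> inv z \<otimes> z \<in> N" using z(1) by blast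
    then show ?thesis using c zc by (simp add: m_assoc)
  qed
  moreover have "\<psi> z \<in> centralizer S R"
  proof -
    have "\<psi> z \<otimes> q = q \<otimes> \<psi> z" if q: "q \<in> R" for q
    proof -
      have fq: "f q \<in> E" "\<psi> (f q) = q" using \<psi>(2,3) \<phi>f q by auto
      have "\<psi> (z \<otimes> f q) = \<psi> (f q \<otimes> z)" using z(2)[OF q] by simp
      then show ?thesis using linked_mult[OF t zE fq(1)] linked_mult[OF t fq(1) zE] fq(2) by simp
    qed
    then show ?thesis using c by (simp add: centralizer_def)
  qed
  ultimately have "\<psi> z \<in> M" by (rule C)
  then have "M.cg z \<one>" using M.cg_trans[OF M.cg_sym[OF cg] M.cg_one] c zc by simp
  then show ?thesis using M.cg_one_iff zc by blast
qed

text \<open>A potential \<open>\<pi>\<close> that is compatible with all of D is used, and \<open>g'\<close> is a realization of the identity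
  of R, with transfer -l lam n, that commutes with all pairs over R. By the congruence for the action of
  R, only the points with stabilizer projecting onto R matter. On these, the part \<open>Ls y\<close> of the
  stabilizer that lies over R carries a second potential \<open>\<xi>\<close>, because C_N(R) is contained in M.
  Since \<open>Ls (g' y) = Ls y\<close>, replacing \<open>\<pi>\<close>
    by the N-invariant function \<open>\<pi> - \<xi>\<close> does not change the sum,
  which then vanishes.\<close>

theorem label_in_M:
  assumes fn: "fully_normalized S F R" and l: "linked R (\<lambda>x. x) n" and n: "n \<in> N"
    and C: "\<And>c. c \<in> N \<Longrightarrow> c \<in> centralizer S R \<Longrightarrow> c \<in> M"
  shows "n \<in> M"
proof -
  have R: "subgroup R S" by (rule linked_subgroup[OF l])
  have nc: "n \<in> carrier S" using n by (rule N_carrier)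
  \<comment> \<open>The homomorphism from \<open>D\<close> to Z/p that is \<open>lam\<close> on
    pairs \<open>(\<one>, z)\<close> and zero on the diagonal. It is zero on stabilizers because, by
    \<open>linked_cg_M\<close> and centrality of N/M, a map with label in \<open>N\<close> is
    congruent to the identity modulo \<open>M\<close>.\<close>
  define \<kappa> where "\<kappa> x = lam (inv (fst x) \<otimes> snd x)" for x :: "'a \<times> 'a"
  have dN: "inv u \<otimes> v \<in> N" if "(u, v) \<in> D" for u v
  proof -
    have "N.cg (inv u \<otimes> v) (inv u \<otimes> u)" using that N.cg_sym by (intro N.cg_mult N.cg_refl) auto
    then show ?thesis using that N.cg_one_iff[of "inv u \<otimes> v"] by simp
  qed
  have \<kappa>_hom: "[\<kappa> (x \<otimes>\<^bsub>DG\<^esub> y) = \<kappa> x + \<kappa> y] (mod int p)"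
    if "x \<in> carrier DG" "y \<in> carrier DG" for x y
  proof -
    obtain a b c d where xy: "x = (a, b)" "y = (c, d)" by (cases x; cases y)
    have D: "(a, b) \<in> D" "(c, d) \<in> D" using that xy by (simp_all del: D_iff)
    have cs: "a \<in> carrier S" "b \<in> carrier S" "c \<in> carrier S" "d \<in> carrier S" using D by auto
    have i: "inv c \<otimes> (inv a \<otimes> b) \<otimes> inv (inv c) \<in> N"
      using N.inv_op_closed2 dN[OF D(1)] cs by blast
    have "inv (a \<otimes> c) \<otimes> (b \<otimes> d) = (inv c \<otimes> (inv a \<otimes> b) \<otimes> inv (inv c)) \<otimes> (inv c \<otimes> d)"
    proof -
      have "c \<otimes> (inv c \<otimes> d) = d" using cs by (simp flip: m_assoc)
      then show ?thesis using cs by (simp add: m_assoc inv_mult_group)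
    qed
    then have "\<kappa> (x \<otimes>\<^bsub>DG\<^esub> y) = lam ((inv c \<otimes> (inv a \<otimes> b) \<otimes> inv (inv c)) \<otimes> (inv c \<otimes> d))"
      by (simp add: \<kappa>_def xy)
    also have "[\<dots> = lam (inv c \<otimes> (inv a \<otimes> b) \<otimes> inv (inv c)) + lam (inv c \<otimes> d)] (mod int p)"
      by (rule lam_mult[OF i dN[OF D(2)]])
    also have "[lam (inv c \<otimes> (inv a \<otimes> b) \<otimes> inv (inv c)) + lam (inv c \<otimes> d) = \<kappa> x + \<kappa> y] (mod int p)"
      using lam_conj[OF _ dN[OF D(1)], of "inv c"] cs by (intro cong_add) (auto simp: \<kappa>_def xy)
    finally show ?thesis .
  qed
  have "[\<kappa> x = 0] (mod int p)" if y: "y \<in> Y" and x: "x \<in> A.stab y" for y x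
  proof -
    obtain Q f s where L: "linked Q f s" "s \<in> N" "A.stab y = graph Q f"
      using stab_diagonals[OF y] by (auto simp: diagonals_def)
    obtain u where u: "u \<in> Q" "x = (u, f u)" using x L(3) by (auto simp: graph_def)
    have cs: "u \<in> carrier S" "f u \<in> carrier S" "s \<in> carrier S"
      using subgroup.mem_carrier[OF linked_subgroup[OF L(1)] u(1)] linked_closed[OF L(1) u(1)] linked_label[OF L(1)]
        by auto
    have "M.cg (f u) u" using M.cg_trans[OF linked_cg_M[OF L(1) u(1)] commutator_M(1)[OF L(2) cs(1)]] cs by simp
    then have "M.cg (inv u \<otimes> f u) (inv u \<otimes> u)" using cs by (intro M.cg_mult M.cg_refl) auto
    then have m: "inv u \<otimes> f u \<in> M" using cs M.cg_one_iff[of "inv u \<otimes> f u"] by simp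
    then have "[lam (inv u \<otimes> f u) = 0] (mod int p)" using lam_ker[of "inv u \<otimes> f u"] M_sub by blast
    then show ?thesis by (simp add: \<kappa>_def u(2))
  qed
  then obtain \<pi> where \<pi>0: "\<forall>x\<in>carrier DG. \<forall>y\<in>Y. [\<pi> (act x y) = \<pi> y + \<kappa> x] (mod int p)"
    using A.exists_potential[of \<kappa> "int p"] \<kappa>_hom by blast
  have \<pi>: "[\<pi> (act (u, v) y) = \<pi> y + lam (inv u \<otimes> v)] (mod int p)"
    if "(u, v) \<in> D" "y \<in> Y" for u v y
    using \<pi>0 that by (force simp: \<kappa>_def simp del: D_iff)
  have pot: "potential \<pi>"
    unfolding potential_def using \<pi> D_N N_carrier by (fastforce simp del: D_iff)
  obtain g where g: "realizes R (\<lambda>x. x) n g" "[tau \<pi> g = tau \<pi> (act (n, n))] (mod int p)"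
    using realization_tau[OF pot l] by blast
  \<comment> \<open>On a diagonal pair \<open>\<kappa>\<close> is zero, so \<open>\<pi>\<close> is
    invariant under its action.\<close>
  have "[tau \<pi> (act (n, n)) = (\<Sum>t\<in>T. 0)] (mod int p)"
    unfolding tau_def
  proof (rule cong_sum)
    fix t assume "t \<in> T"
    then have "[\<pi> (act (n, n) t) = \<pi> t + lam \<one>] (mod int p)" using \<pi>[OF D_diag[OF nc] T_Y] nc by simp
    moreover have "[lam \<one> = 0] (mod int p)" using lam_ker N.one_closed M.one_closed by blast
    ultimately have "[\<pi> (act (n, n) t) - \<pi> t = \<pi> t + 0 - \<pi> t] (mod int p)"
      using cong_trans cong_add[OF cong_refl] cong_diff[OF _ cong_refl] by blast
    then show "[\<pi> (act (n, n) t) - \<pi> t = 0] (mod int p)" by simp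
  qed
  then have tg: "[tau \<pi> g = 0] (mod int p)" using cong_trans[OF g(2)] by simp
  have sg: "semilinear n g" by (rule realizes_semilinear[OF l g(1)])
  \<comment> \<open>The realization \<open>g\<close> conjugates second coordinates by
    \<open>n\<close>; composing with \<open>(\<one>, inv n)\<close> undoes this.\<close>
  define g' where "g' y = act (\<one>, inv n) (g y)" for y
  have Dn: "(\<one>, inv n) \<in> D" using D_N n by blast
  have sg': "semilinear (inv n \<otimes> n) g'"
    unfolding g'_def by (rule semilinear_comp[OF semilinear_act[OF Dn] sg])
  then have sg1: "semilinear \<one> g'" using nc by simp
  have g'Y: "g' y \<in> Y" if "y \<in> Y" for y using semilinear_Y[OF sg1 that] .
  have comm: "g' (act (u, v) y) = act (u, v) (g' y)"
    if D: "(u, v) \<in> D" and u: "u \<in> R" and y: "y \<in> Y" for u v y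
  proof -
    have cs: "u \<in> carrier S" "v \<in> carrier S" using D by auto
    have gy: "g y \<in> Y" using semilinear_Y[OF sg y] .
    have D': "(u, n \<otimes> v \<otimes> inv n) \<in> D"
      using compatible_D[OF linked_compatible[OF l] D u cs(2)] .
    have "g' (act (u, v) y) = act (\<one>, inv n) (act (u, n \<otimes> v \<otimes> inv n) (g y))"
      using g(1) D u y by (simp add: g'_def realizes_def del: D_iff)
    also have "\<dots> = act (\<one> \<otimes> u, inv n \<otimes> (n \<otimes> v \<otimes> inv n)) (g y)"
      by (rule act_D_mult[OF Dn D' gy])
    also have "\<one> \<otimes> u = u \<otimes> \<one>" using cs by simp
    also have "inv n \<otimes> (n \<otimes> v \<otimes> inv n) = v \<otimes> inv n" using cs nc by (simp flip: m_assoc)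
    also have "act (u \<otimes> \<one>, v \<otimes> inv n) (g y) = act (u, v) (g' y)"
      unfolding g'_def by (rule act_D_mult[OF D Dn gy, symmetric])
    finally show ?thesis .
  qed
  have tg': "[tau \<pi> g' = int l * lam (inv n)] (mod int p)"
  proof -
    have "[tau \<pi> g' = tau \<pi> (act (\<one>, inv n)) + tau \<pi> g] (mod int p)"
      unfolding g'_def by (rule tau_comp[OF semilinear_act[OF Dn] sg pot])
    also have "[tau \<pi> (act (\<one>, inv n)) + tau \<pi> g = int l * lam (inv n) + 0] (mod int p)"
      using n by (intro cong_add tg tau_act_N[OF pot]) blast
    finally show ?thesis by simp
  qed
  define h where "h y = \<pi> (g' y) - \<pi> y" for y
  have h_inv: "[h (act (u, v) y) = h y] (mod int p)" if D: "(u, v) \<in> D" "u \<in> R" "y \<in> Y" for u v y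
  proof -
    have "[h (act (u, v) y) = (\<pi> (g' y) + lam (inv u \<otimes> v)) - (\<pi> y + lam (inv u \<otimes> v))] (mod int p)"
      unfolding h_def comm[OF D] by (intro cong_diff \<pi> D g'Y)
    then show ?thesis by (simp add: h_def)
  qed
  have oneR: "\<one> \<in> R" using subgroup.one_closed[OF R] .
  have Rc: "u \<in> carrier S" if "u \<in> R" for u using subgroup.mem_carrier[OF R that] .
  have h_rep: "[h (rep y) = h y] (mod int p)" if y: "y \<in> Y" for y
  proof -
    obtain z where z: "z \<in> N" "rep y = act (\<one>, z) y" using rep_E[OF y] .
    show ?thesis unfolding z(2) by (rule h_inv[OF D_N[OF z(1)] oneR y])
  qed
  have rep_act: "rep (act (u, v) (rep y)) = rep (act (u, v) y)" if D: "(u, v) \<in> D" and y: "y \<in> Y" for u v y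
  proof -
    obtain z where z: "z \<in> N" "rep y = act (\<one>, z) y" using rep_E[OF y] .
    have vc: "v \<in> carrier S" "u \<in> carrier S" using D by auto
    have "act (u, v) (rep y) = act (\<one>, v \<otimes> z \<otimes> inv v) (act (u, v) y)"
      using act_comm[OF D D_N[OF z(1)] y] vc by (simp add: z(2))
    moreover have "v \<otimes> z \<otimes> inv v \<in> N" using N.inv_op_closed2 vc z(1) by blast
    ultimately show ?thesis using rep_act_N act_D[OF D y] by simp
  qed
  \<comment> \<open>The diagonal of \<open>R\<close> permutes the N-orbits, because elements of
    \<open>D\<close> normalize the pairs \<open>(\<one>, z)\<close> with \<open>z\<close> in
    \<open>N\<close>; passing to representatives turns this into an action on
    \<open>T\<close>.\<close>
  interpret RT: finite_action "S\<lparr>carrier := R\<rparr>" T "\<lambda>u t. rep (act (u, u) t)"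
  proof -
    interpret RG: group "S\<lparr>carrier := R\<rparr>" by (rule subgroup.subgroup_is_group[OF R is_group])
    show "finite_action (S\<lparr>carrier := R\<rparr>) T (\<lambda>u t. rep (act (u, u) t))"
    proof unfold_locales
      show "finite (carrier (S\<lparr>carrier := R\<rparr>))" using finite_sub[OF R] by simp
      show "finite T" by (rule finite_T)
      show "rep (act (g, g) y) \<in> T" if "g \<in> carrier (S\<lparr>carrier := R\<rparr>)" "y \<in> T" for g y
        using that act_D[OF D_diag[OF Rc] T_Y] by (simp add: T_def)
      show "rep (act (\<one>\<^bsub>S\<lparr>carrier := R\<rparr>\<^esub>, \<one>\<^bsub>S\<lparr>carrier := R\<rparr>\<^esub>) y) = y" if "y \<in> T" for y
        using that T_Y rep_T by simp
      show "rep (act (g \<otimes>\<^bsub>S\<lparr>carrier := R\<rparr>\<^esub> h, g \<otimes>\<^bsub>S\<lparr>carrier := R\<rparr>\<^esub> h) y) = rep (act (g, g) (rep (act (h, h) y)))"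
        if "g \<in> carrier (S\<lparr>carrier := R\<rparr>)" "h \<in> carrier (S\<lparr>carrier := R\<rparr>)" "y \<in> T" for g h y
        using that rep_act[OF D_diag[OF Rc] act_D[OF D_diag[OF Rc] T_Y]] act_D_mult[OF D_diag[OF Rc] D_diag[OF Rc] T_Y] by simp
    qed
  qed
  define Yf where "Yf = {y \<in> Y. \<forall>u\<in>R. \<exists>v. (u, v) \<in> A.stab y}"
  have Yf_N: "act (\<one>, z) y \<in> Yf" if z: "z \<in> N" and y: "y \<in> Yf" for z y
  proof -
    have yY: "y \<in> Y" using y by (simp add: Yf_def)
    have "\<exists>v. (u, v) \<in> A.stab (act (\<one>, z) y)" if u: "u \<in> R" for u
    proof -
      obtain v where v: "(u, v) \<in> A.stab y" using y u by (auto simp: Yf_def)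
      then have D: "(u, v) \<in> D" "act (u, v) y = y" by (auto simp: A.stab_def simp del: D_iff)
      have "act (\<one> \<otimes> u \<otimes> inv \<one>, z \<otimes> v \<otimes> inv z) (act (\<one>, z) y) = act (\<one>, z) y"
        using act_comm[OF D_N[OF z] D(1) yY] D(2) by simp
      moreover have "(u, z \<otimes> v \<otimes> inv z) \<in> D"
        using D(1) N.cg_trans[OF _ N.cg_sym[OF N.cg_conj_mem[OF z]], of u v] N_carrier[OF z] by simp
      ultimately have "(u, z \<otimes> v \<otimes> inv z) \<in> A.stab (act (\<one>, z) y)"
        using Rc[OF u] by (simp add: A.stab_def del: D_iff)
      then show ?thesis by blast
    qed
    then show ?thesis using D_N[OF z] yY by (simp add: Yf_def del: D_iff)
  qed
  \<comment> \<open>\<open>R\<close> fixes the orbit of \<open>t\<close> when each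
    \<open>(u, u)\<close> moves \<open>t\<close> by an element of \<open>N\<close>, and correcting
    by that element gives a pair \<open>(u, v)\<close> that fixes \<open>t\<close> itself.\<close>
  have fixed_eq': "RT.fixed R = T \<inter> Yf"
  proof (intro equalityI subsetI)
    fix t assume t: "t \<in> RT.fixed R"
    then have tT: "t \<in> T" and tY: "t \<in> Y" using T_Y by (auto simp: RT.fixed_def)
    have "\<exists>v. (u, v) \<in> A.stab t" if u: "u \<in> R" for u
    proof -
      have D: "(u, u) \<in> D" using D_diag Rc u by blast
      obtain z where z: "z \<in> N" "rep (act (u, u) t) = act (\<one>, z) (act (u, u) t)"
        using rep_E[OF act_D[OF D tY]] .
      have "act (\<one>, z) (act (u, u) t) = t" using t u z(2) by (simp add: RT.fixed_def)
      then have "act (\<one> \<otimes> u, z \<otimes> u) t = t" using act_D_mult[OF D_N[OF z(1)] D tY] by simp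
      moreover have "(\<one> \<otimes> u, z \<otimes> u) \<in> D"
        using DG.m_closed[of "(\<one>, z)" "(u, u)"] D D_N[OF z(1)] by (simp del: D_iff)
      ultimately have "(u, z \<otimes> u) \<in> A.stab t" using Rc[OF u] by (simp add: A.stab_def del: D_iff)
      then show ?thesis by blast
    qed
    then show "t \<in> T \<inter> Yf" using tT tY by (simp add: Yf_def)
  next
    fix t assume t: "t \<in> T \<inter> Yf"
    then have tT: "t \<in> T" and tY: "t \<in> Y" using T_Y by auto
    have "rep (act (u, u) t) = t" if u: "u \<in> R" for u
    proof -
      obtain v where v: "(u, v) \<in> A.stab t" using t u by (auto simp: Yf_def)
      then have D: "(u, v) \<in> D" "act (u, v) t = t" by (auto simp: A.stab_def simp del: D_iff)
      have c: "u \<in> carrier S" "v \<in> carrier S" using D by auto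
      have zN: "u \<otimes> inv v \<in> N" using D(1) by (simp add: N.cg_def)
      have "act (\<one>, u \<otimes> inv v) (act (u, v) t) = act (\<one> \<otimes> u, u \<otimes> inv v \<otimes> v) t"
        by (rule act_D_mult[OF D_N[OF zN] D(1) tY])
      then have "act (u, u) t = act (\<one>, u \<otimes> inv v) t" using D(2) c by (simp add: m_assoc)
      then show ?thesis using rep_act_N[OF zN tY] rep_T[OF tT] by simp
    qed
    then show "t \<in> RT.fixed R" using tT by (simp add: RT.fixed_def)
  qed
  obtain j where j: "card R = p ^ j" using p_subgroup[OF R] by blast
  have "[(\<Sum>t\<in>T. h t) = (\<Sum>t\<in>RT.fixed R. h t)] (mod int p)"
  proof -
    have "[(\<Sum>t\<in>T. h t) = (\<Sum>t\<in>RT.fixed (carrier (S\<lparr>carrier := R\<rparr>)). h t)] (mod int p)"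
    proof (rule RT.sum_cong_fixed[OF prime])
      show "order (S\<lparr>carrier := R\<rparr>) = p ^ j" using j by (simp add: order_def)
      fix u t assume "u \<in> carrier (S\<lparr>carrier := R\<rparr>)" and t: "t \<in> T"
      then have u: "u \<in> R" by simp
      show "[h (rep (act (u, u) t)) = h t] (mod int p)"
        using cong_trans[OF h_rep[OF act_D[OF D_diag[OF Rc[OF u]] T_Y[OF t]]] h_inv[OF D_diag[OF Rc[OF u]] u T_Y[OF t]]] .
    qed
    then show ?thesis by simp
  qed
  define Ls where "Ls y = {x \<in> A.stab y. fst x \<in> R}" for y
  \<comment> \<open>The effect of moving a point by \<open>(\<one>, z)\<close> on its stabilizer:
    second coordinates are conjugated by \<open>z\<close> and first coordinates stay.\<close>
  define cj where "cj z L = (\<lambda>x. (fst x, z \<otimes> snd x \<otimes> inv z)) ` L" for z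
    and L :: "('a \<times> 'a) set"
  have Ls_D: "Ls y \<subseteq> D" for y by (auto simp: Ls_def A.stab_def simp del: D_iff)
  have Ls_cj: "Ls (act (\<one>, z) y) = cj z (Ls y)" if z: "z \<in> N" and y: "y \<in> Y" for z y
  proof -
    have zc: "z \<in> carrier S" using z by (rule N_carrier)
    have Dz: "(\<one>, z) \<in> D" by (rule D_N[OF z])
    have iz: "inv\<^bsub>DG\<^esub> (\<one>, z) = (\<one>, inv z)" using inv_DG[OF Dz] by simp
    show ?thesis
    proof (intro equalityI subsetI)
      fix x assume "x \<in> Ls (act (\<one>, z) y)"
      then have x: "x \<in> A.stab (act (\<one>, z) y)" "fst x \<in> R" by (auto simp: Ls_def)
      obtain u v where uv: "x = (u, v)" by (cases x)
      have xs: "x \<in> D" "inv\<^bsub>DG\<^esub> (\<one>, z) \<otimes>\<^bsub>DG\<^esub> x \<otimes>\<^bsub>DG\<^esub> (\<one>, z) \<in> A.stab y"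
        using A.stab_act[OF y, of "(\<one>, z)" x] x(1) Dz by (simp_all del: D_iff)
      have c: "u \<in> carrier S" "v \<in> carrier S" using xs(1) uv by auto
      have "(u, inv z \<otimes> v \<otimes> z) \<in> A.stab y" using xs(2) c by (simp add: iz uv)
      then have "(u, inv z \<otimes> v \<otimes> z) \<in> Ls y" using x(2) uv by (simp add: Ls_def)
      moreover have "x = (fst (u, inv z \<otimes> v \<otimes> z), z \<otimes> snd (u, inv z \<otimes> v \<otimes> z) \<otimes> inv z)"
        using c zc uv by (simp add: m_assoc) (simp flip: m_assoc)
      ultimately show "x \<in> cj z (Ls y)" unfolding cj_def by (rule image_eqI[rotated])
    next
      fix x assume "x \<in> cj z (Ls y)"
      then obtain u v where uv: "(u, v) \<in> Ls y" "x = (u, z \<otimes> v \<otimes> inv z)" by (auto simp: cj_def)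
      have D: "(u, v) \<in> D" using uv(1) Ls_D by blast
      then have c: "u \<in> carrier S" "v \<in> carrier S" by auto
      have xD: "x \<in> D" unfolding uv(2)
        using D N.cg_trans[OF _ N.cg_sym[OF N.cg_conj_mem[OF z]], of u v] zc by simp
      have "inv z \<otimes> (z \<otimes> v \<otimes> inv z) \<otimes> z = v"
        using c zc by (simp add: m_assoc) (simp flip: m_assoc)
      then have "inv\<^bsub>DG\<^esub> (\<one>, z) \<otimes>\<^bsub>DG\<^esub> x \<otimes>\<^bsub>DG\<^esub> (\<one>, z) = (u, v)" using c by (simp add: iz uv(2))
      then have "x \<in> A.stab (act (\<one>, z) y)"
        using A.stab_act[OF y, of "(\<one>, z)" x] Dz xD uv(1) by (simp add: Ls_def del: D_iff)
      then show "x \<in> Ls (act (\<one>, z) y)" using uv by (simp add: Ls_def)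
    qed
  qed
  have Ls_graph: "\<exists>f s. linked R f s \<and> Ls y = graph R f" if y: "y \<in> Yf" for y
  proof -
    have yY: "y \<in> Y" using y by (simp add: Yf_def)
    obtain Q f s where L: "linked Q f s" "A.stab y = graph Q f"
      using stab_diagonals[OF yY] by (auto simp: diagonals_def)
    have RQ: "R \<subseteq> Q" using y L(2) by (auto simp: Yf_def graph_def)
    have "Ls y = graph R f" using RQ by (auto simp: Ls_def L(2) graph_def)
    then show ?thesis using linked_restrict[OF L(1) R RQ] by blast
  qed
  interpret NL: finite_action "S\<lparr>carrier := N\<rparr>" "Ls ` Yf" cj
  proof unfold_locales
    show "finite (carrier (S\<lparr>carrier := N\<rparr>))" using finite_N by simp
    show "finite (Ls ` Yf)" using A.finite_points by (simp add: Yf_def)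
    show "cj z L \<in> Ls ` Yf" if "z \<in> carrier (S\<lparr>carrier := N\<rparr>)" "L \<in> Ls ` Yf" for z L
    proof -
      obtain y where y: "y \<in> Yf" "L = Ls y" using \<open>L \<in> Ls ` Yf\<close> by blast
      have z: "z \<in> N" using that by simp
      have "cj z L = Ls (act (\<one>, z) y)" using Ls_cj[OF z] y by (simp add: Yf_def)
      then show ?thesis using Yf_N[OF z y(1)] by blast
    qed
    show "cj \<one>\<^bsub>S\<lparr>carrier := N\<rparr>\<^esub> L = L" if "L \<in> Ls ` Yf" for L
    proof -
      have "cj \<one> L = (\<lambda>x. x) ` L"
        unfolding cj_def using that Ls_D by (intro image_cong[OF refl]) fastforce
      then show ?thesis by simp
    qed
    show "cj (z \<otimes>\<^bsub>S\<lparr>carrier := N\<rparr>\<^esub> w) L = cj z (cj w L)"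
      if "z \<in> carrier (S\<lparr>carrier := N\<rparr>)" "w \<in> carrier (S\<lparr>carrier := N\<rparr>)" "L \<in> Ls ` Yf" for z w L
    proof -
      have zw: "z \<in> carrier S" "w \<in> carrier S" using that N_carrier by auto
      have LD: "L \<subseteq> D" using that(3) Ls_D by blast
      have "cj (z \<otimes> w) L = (\<lambda>x. (fst x, z \<otimes> (w \<otimes> snd x \<otimes> inv w) \<otimes> inv z)) ` L"
        unfolding cj_def using LD zw
        by (intro image_cong[OF refl]) (force simp: m_assoc inv_mult_group)
      then show ?thesis by (simp add: cj_def image_image)
    qed
  qed
  \<comment> \<open>An element of \<open>N\<close> that stabilizes the graph of a map
    \<open>f\<close> on \<open>R\<close> centralizes the image of \<open>f\<close>, so
    \<open>centralizing_lam\<close> places it in \<open>M\<close>.\<close>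
  have "[lam z = 0] (mod int p)" if L: "L \<in> Ls ` Yf" and z: "z \<in> NL.stab L" for L z
  proof -
    obtain y where y: "y \<in> Yf" "L = Ls y" using L by blast
    have zN: "z \<in> N" and zL: "cj z L = L" using z by (auto simp: NL.stab_def)
    have zc: "z \<in> carrier S" using zN by (rule N_carrier)
    obtain f s where f: "linked R f s" "L = graph R f" using Ls_graph[OF y(1)] y(2) by blast
    have cm: "z \<otimes> f u = f u \<otimes> z" if u: "u \<in> R" for u
    proof -
      have "(u, f u) \<in> L" using u f(2) by (simp add: graph_def)
      then have "(u, z \<otimes> f u \<otimes> inv z) \<in> cj z L" unfolding cj_def by force
      then have "(u, z \<otimes> f u \<otimes> inv z) \<in> graph R f" using zL f(2) by simp
      then have "z \<otimes> f u \<otimes> inv z = f u" by (auto simp: graph_def)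
      then show ?thesis using zc linked_closed[OF f(1) u] by (simp add: inv_solve_right')
    qed
    have "z \<in> M" by (rule centralizing_lam[OF f(1) fn _ zN]) (auto intro: C cm)
    then show ?thesis using lam_ker[OF zN] by blast
  qed
  then obtain \<xi> where \<xi>0: "\<forall>z\<in>carrier (S\<lparr>carrier := N\<rparr>). \<forall>L\<in>Ls ` Yf. [\<xi> (cj z L) = \<xi> L + lam z] (mod int p)"
    using NL.exists_potential[of lam "int p"] lam_mult by auto
  define \<omega> where "\<omega> y = \<pi> y - \<xi> (Ls y)" for y
  have \<omega>_N: "[\<omega> (act (\<one>, z) y) = \<omega> y] (mod int p)"
    if z: "z \<in> N" and y: "y \<in> Yf" for z y
  proof -
    have yY: "y \<in> Y" using y by (simp add: Yf_def)
    have "[\<xi> (cj z (Ls y)) = \<xi> (Ls y) + lam z] (mod int p)" using \<xi>0 z y by simp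
    moreover have "[\<pi> (act (\<one>, z) y) = \<pi> y + lam z] (mod int p)"
      using pot z yY by (simp add: potential_def)
    ultimately have "[\<omega> (act (\<one>, z) y) = (\<pi> y + lam z) - (\<xi> (Ls y) + lam z)] (mod int p)"
      unfolding \<omega>_def Ls_cj[OF z yY] by (intro cong_diff)
    then show ?thesis by (simp add: \<omega>_def)
  qed
  \<comment> \<open>\<open>g'\<close> commutes with all pairs over \<open>R\<close> and is
    injective, so it preserves which of them fix a point.\<close>
  have Ls_g': "Ls (g' y) = Ls y" if y: "y \<in> Y" for y
  proof -
    have "(u, v) \<in> A.stab (g' y) \<longleftrightarrow> (u, v) \<in> A.stab y" if u: "u \<in> R" for u v
    proof (cases "(u, v) \<in> D")
      case True
      have "act (u, v) (g' y) = g' y \<longleftrightarrow> g' (act (u, v) y) = g' y" using comm[OF True u y] by simp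
      also have "\<dots> \<longleftrightarrow> act (u, v) y = y"
        using sg1 act_D[OF True y] y by (auto simp: semilinear_def bij_betw_def inj_on_def)
      finally show ?thesis using True by (simp add: A.stab_def del: D_iff)
    next
      case False then show ?thesis by (simp add: A.stab_def del: D_iff)
    qed
    then show ?thesis by (auto simp: Ls_def)
  qed
  have g'_Yf: "g' y \<in> Yf" if y: "y \<in> Yf" for y
  proof -
    have yY: "y \<in> Y" using y by (simp add: Yf_def)
    have "\<exists>v. (u, v) \<in> A.stab (g' y)" if u: "u \<in> R" for u
    proof -
      obtain v where "(u, v) \<in> A.stab y" using y u by (auto simp: Yf_def)
      then have "(u, v) \<in> Ls y" using u by (simp add: Ls_def)
      then show ?thesis using Ls_g'[OF yY] by (auto simp: Ls_def)
    qed
    then show ?thesis using g'Y[OF yY] by (simp add: Yf_def)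
  qed
  have rep_Yf: "rep y \<in> T \<inter> Yf" if y: "y \<in> Yf" for y
  proof -
    have yY: "y \<in> Y" using y by (simp add: Yf_def)
    obtain z where z: "z \<in> N" "rep y = act (\<one>, z) y" using rep_E[OF yY] .
    have "rep y \<in> T" unfolding T_def using yY by (rule imageI)
    then show ?thesis using Yf_N[OF z(1) y] z(2) by simp
  qed
  have "(\<Sum>t\<in>T \<inter> Yf. h t) = (\<Sum>t\<in>T \<inter> Yf. \<omega> (g' t)) - (\<Sum>t\<in>T \<inter> Yf. \<omega> t)"
    using Ls_g' T_Y by (simp add: h_def \<omega>_def flip: sum_subtractf)
  moreover have "[(\<Sum>t\<in>T \<inter> Yf. \<omega> (g' t)) = (\<Sum>t\<in>T \<inter> Yf. \<omega> t)] (mod int p)"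
  proof (rule sum_reindex_T[OF sg1])
    show "rep (g' t) \<in> T \<inter> Yf" if "t \<in> T \<inter> Yf" for t using rep_Yf g'_Yf that by blast
    fix y z assume y: "y \<in> Y" and z: "z \<in> N" and ry: "rep y \<in> T \<inter> Yf"
    have "y \<in> NA.orb (rep y)" using NA.orb_refl[OF y] orb_rep[OF y] by simp
    then obtain w where w: "w \<in> N" "y = act (\<one>, w) (rep y)" by (auto simp: NA.orb_def)
    have "y \<in> Yf" using Yf_N[OF w(1), of "rep y"] w(2) ry by simp
    then show "[\<omega> (act (\<one>, z) y) = \<omega> y] (mod int p)" by (rule \<omega>_N[OF z])
  qed simp
  ultimately have "[(\<Sum>t\<in>T \<inter> Yf. h t) = 0] (mod int p)"
    using cong_diff[OF _ cong_refl, of "\<Sum>t\<in>T \<inter> Yf. \<omega> (g' t)" "\<Sum>t\<in>T \<inter> Yf. \<omega> t" "int p" "\<Sum>t\<in>T \<inter> Yf. \<omega> t"] by simp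
  then have "[tau \<pi> g' = 0] (mod int p)"
    using cong_trans[OF \<open>[(\<Sum>t\<in>T. h t) = (\<Sum>t\<in>RT.fixed R. h t)] (mod int p)\<close>]
    by (simp add: fixed_eq' tau_def h_def)
  then have "[int l * lam (inv n) = 0] (mod int p)" using cong_trans[OF cong_sym[OF tg']] by blast
  then have "inv n \<in> M" using l_cancel lam_ker n by blast
  then have "inv (inv n) \<in> M" by blast
  then show ?thesis using nc by simp
qed

text \<open>The second clause splits by whether \<open>N\<close> contains an element outside
  \<open>M\<close> that centralizes \<open>R\<close>. If not, \<open>label_in_M\<close> puts the
  factor \<open>n\<close> into \<open>M\<close>. Otherwise the powers of such an element represent
  all of N/M, and a suitable one is moved from \<open>n\<close> to the centralizing factor.\<close>

theorem controls_M: "controls M"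
  unfolding controls_def
proof (intro conjI allI impI ballI)
  show "M \<lhd> S" by (rule M_normal)
  show "f u \<otimes> inv (s \<otimes> u \<otimes> inv s) \<in> M" if "linked Q f s" "u \<in> Q" for Q f s u
    using linked_cg_M[OF that] by (simp add: M.cg_def)
  fix R s assume fn: "fully_normalized S F R" and s: "linked R (\<lambda>x. x) s"
  obtain n z where nz: "n \<in> N" "z \<in> centralizer S R" "s = n \<otimes> z" using label_identity[OF fn s] by blast
  have R: "subgroup R S" by (rule linked_subgroup[OF s])
  have c: "n \<in> carrier S" "z \<in> carrier S" using nz N_carrier by (auto simp: centralizer_def)
  show "\<exists>n\<in>M. \<exists>z\<in>centralizer S R. s = n \<otimes> z"
  proof (cases "\<forall>c\<in>N. c \<in> centralizer S R \<longrightarrow> c \<in> M")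
    case True
    have "linked R (\<lambda>x. x) z"
      using nz(2) c subgroup.mem_carrier[OF R] by (intro linked_conj[OF R]) (auto simp: centralizer_def m_assoc)
    from linked_labels[OF s this] have "linked R (\<lambda>x. x) n" using c by (simp add: nz(3) m_assoc)
    then have "n \<in> M" using label_in_M[OF fn _ nz(1)] True by blast
    then show ?thesis using nz by blast
  next
    case False
    then obtain d where d: "d \<in> N" "d \<in> centralizer S R" "d \<notin> M" by blast
    have dc: "d \<in> carrier S" using d(1) by (rule N_carrier)
    have pint: "Factorial_Ring.prime (int p)" using prime by simp
    have "\<not> int p dvd lam d" using lam_ker[OF d(1)] d(3) by (simp add: cong_0_iff)
    then have "coprime (lam d) (int p)" using pint by (metis coprime_commute prime_imp_coprime)
    \<comment> \<open>\<open>x\<close> inverts \<open>lam d\<close> modulo p, so with an exponent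
      congruent to \<open>x * lam n\<close> the power of \<open>d\<close> has the same
      \<open>lam\<close> as \<open>n\<close>.\<close>
    then obtain x where x: "[lam d * x = 1] (mod int p)" using cong_solve_coprime_int by blast
    define k where "k = nat ((x * lam n) mod int p)"
    have ppos: "int p > 0" using prime by (simp add: prime_gt_0_nat)
    have kx: "[int k = x * lam n] (mod int p)" using ppos by (simp add: k_def cong_def)
    have dk: "d [^] m \<in> N \<and> [lam (d [^] m) = int m * lam d] (mod int p) \<and> d [^] m \<in> centralizer S R" for m :: nat
    proof (induction m)
      case 0
      have "[lam \<one> = 0] (mod int p)" using lam_ker N.one_closed M.one_closed by blast
      then show ?case using subgroup.mem_carrier[OF R] by (simp add: centralizer_def)
    next
      case (Suc m)
      have "[lam (d [^] m \<otimes> d) = int m * lam d + lam d] (mod int p)"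
        using cong_trans[OF lam_mult cong_add[OF _ cong_refl]] Suc d(1) by blast
      moreover have "d [^] m \<otimes> d \<in> centralizer S R"
      proof -
        have "d [^] m \<otimes> d \<otimes> q = q \<otimes> (d [^] m \<otimes> d)" if q: "q \<in> R" for q
        proof -
          have qc: "q \<in> carrier S" using subgroup.mem_carrier[OF R q] .
          have 1: "d \<otimes> q = q \<otimes> d" "d [^] m \<otimes> q = q \<otimes> d [^] m"
            using Suc d(2) q by (auto simp: centralizer_def)
          have "d [^] m \<otimes> d \<otimes> q = (d [^] m \<otimes> q) \<otimes> d"
            using dc qc 1(1) by (simp add: m_assoc)
          then show ?thesis using dc qc 1(2) by (simp add: m_assoc)
        qed
        then show ?thesis using dc by (simp add: centralizer_def)
      qed
      ultimately show ?case using Suc d(1) by (simp add: algebra_simps)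
    qed
    let ?e = "d [^] k"
    have eN: "?e \<in> N" and eC: "?e \<in> centralizer S R" and ec: "?e \<in> carrier S" using dk dc by auto
    have "[lam ?e = lam n] (mod int p)"
    proof -
      have "[lam ?e = int k * lam d] (mod int p)" using dk by blast
      also have "[int k * lam d = x * lam n * lam d] (mod int p)" using kx by (intro cong_mult cong_refl)
      also have "x * lam n * lam d = (lam d * x) * lam n" by simp
      also have "[(lam d * x) * lam n = 1 * lam n] (mod int p)" using x by (intro cong_mult cong_refl)
      finally show ?thesis by simp
    qed
    moreover have "[lam n = lam (n \<otimes> inv ?e) + lam ?e] (mod int p)"
    proof -
      have "n \<otimes> inv ?e \<in> N" using nz(1) eN by blast
      from lam_mult[OF this eN] show ?thesis using c ec by (simp add: m_assoc)
    qed
    ultimately have "[lam (n \<otimes> inv ?e) + lam ?e = 0 + lam ?e] (mod int p)"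
      using cong_trans cong_sym by (metis add_0)
    then have "[lam (n \<otimes> inv ?e) = 0] (mod int p)" by (simp only: cong_add_rcancel)
    then have "n \<otimes> inv ?e \<in> M" using lam_ker nz(1) eN by blast
    moreover have "?e \<otimes> z \<in> centralizer S R"
    proof -
      have "?e \<otimes> z \<otimes> q = q \<otimes> (?e \<otimes> z)" if q: "q \<in> R" for q
      proof -
        have qc: "q \<in> carrier S" using subgroup.mem_carrier[OF R q] .
        have 1: "z \<otimes> q = q \<otimes> z" "?e \<otimes> q = q \<otimes> ?e"
          using nz(2) eC q by (auto simp: centralizer_def)
        have "?e \<otimes> z \<otimes> q = (?e \<otimes> q) \<otimes> z" using ec c qc 1(1) by (simp add: m_assoc)
        then show ?thesis using ec c qc 1(2) by (simp add: m_assoc)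
      qed
      then show ?thesis using ec c by (simp add: centralizer_def)
    qed
    moreover have "s = n \<otimes> inv ?e \<otimes> (?e \<otimes> z)" unfolding nz(3)
      using c ec by (simp add: m_assoc) (simp flip: m_assoc)
    ultimately show ?thesis by blast
  qed
qed

end

context central_step
begin

theorem controls_step: "controls M"
proof (rule exists_stable_weights)
  fix b l assume b: "supported b" "card (DG.weighted_cosets b) = l * card N" "\<not> p dvd l"
    "\<And>L L'. L \<in> diagonals \<Longrightarrow> L' \<in> diagonals \<Longrightarrow> fconj (fst ` L) (fst ` L') \<Longrightarrow> DG.total_mark b L = DG.total_mark b L'"
  interpret A: finite_action DG "DG.weighted_cosets b" DG.coset_act by (rule DG.weighted_action[OF finite_D])
  interpret central_step_set S p F N M lam "DG.weighted_cosets b" DG.coset_act l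
  proof unfold_locales
    fix y assume "y \<in> DG.weighted_cosets b"
    then obtain L x where "b L \<noteq> 0" "x \<in> carrier DG" "A.stab y = DG.conjugate x L"
      using DG.weighted_stab[OF finite_D] by blast
    moreover have "L \<in> diagonals" using b(1) calculation(1) by (auto simp: supported_def)
    ultimately show "A.stab y \<in> diagonals" using diagonals_same_order_conj by simp
  next
    fix L L' assume "L \<in> diagonals" "L' \<in> diagonals" "fconj (fst ` L) (fst ` L')"
    then show "card (A.fixed L) = card (A.fixed L')" using b(4) DG.card_weighted_fixed[OF finite_D] by simp
  qed (use b in auto)
  show ?thesis by (rule controls_M)
qed

end

section \<open>Descent along central extensions\<close>

text \<open>Both faces of a one-element tuple are the empty tuple, and they enter with opposite
  exponents. Hence a class in degree one is a singleton, and it can be treated as a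
  homomorphism.\<close>

lemma coboundaries_1:
  assumes A: "comm_group A"
  shows "coboundaries G A 1 = {\<one>\<^bsub>cochains G A 1\<^esub>}"
proof -
  interpret A: comm_group A by (rule A)
  have "coboundary G A 0 c = \<one>\<^bsub>cochains G A 1\<^esub>" if c: "c \<in> carrier (cochains G A 0)" for c
  proof -
    have "[] \<in> tuples G 0" by (simp add: tuples_def)
    then have a: "c [] \<in> carrier A" using c by (auto simp: cochains_def)
    have "(\<Otimes>\<^bsub>A\<^esub>i\<in>{0..0 + 1}. c (face G i xs) [^]\<^bsub>A\<^esub> ((-1) ^ i :: int)) = \<one>\<^bsub>A\<^esub>" if xs: "xs \<in> tuples G 1" for xs
    proof -
      obtain g where g: "xs = [g]" using xs by (auto simp: tuples_def length_Suc_conv)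
      have f: "face G 0 xs = []" "face G (Suc 0) xs = []" by (simp_all add: face_def g)
      have "(\<Otimes>\<^bsub>A\<^esub>i\<in>{0..0 + 1}. c (face G i xs) [^]\<^bsub>A\<^esub> ((-1) ^ i :: int)) =
        (\<Otimes>\<^bsub>A\<^esub>i\<in>{..Suc 0}. c [] [^]\<^bsub>A\<^esub> ((-1) ^ i :: int))"
        by (rule A.finprod_cong') (use a f in \<open>auto simp: le_Suc_eq\<close>)
      also have "\<dots> = c [] [^]\<^bsub>A\<^esub> (- 1 :: int) \<otimes>\<^bsub>A\<^esub> c []"
        using a by (subst A.finprod_Suc) (auto simp: A.int_pow_1)
      also have "\<dots> = \<one>\<^bsub>A\<^esub>" using a by (simp add: A.int_pow_neg A.int_pow_1)
      finally show ?thesis .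
    qed
    then show ?thesis by (auto simp: coboundary_def cochains_def product_group_def intro!: restrict_ext)
  qed
  moreover have "\<one>\<^bsub>cochains G A 0\<^esub> \<in> carrier (cochains G A 0)"
    by (auto simp: cochains_def product_group_def)
  ultimately show ?thesis by (auto simp: image_iff)
qed

lemma one_coset:
  assumes A: "comm_group A" and c: "c \<in> carrier (cochains G A n)"
  shows "{\<one>\<^bsub>cochains G A n\<^esub>} #>\<^bsub>cochains G A n\<^esub> c = {c}"
proof -
  interpret A: comm_group A by (rule A)
  have "group (cochains G A n)" unfolding cochains_def by (rule product_group) auto
  then interpret C: group "cochains G A n" .
  show ?thesis using c by (auto simp: r_coset_def)
qed

section \<open>Homomorphisms to Z/p and central steps of S\<close>

context fusion_system
begin

text \<open>Modulo p, \<open>\<mu>\<close> is a 1-cocycle \<open>c\<close>. The restriction map is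
  an inclusion, so being an isomorphism makes the two carriers equal and the class of
  \<open>c\<close> stable. Its pullbacks along \<open>\<phi>\<close> and along the inclusion
  therefore agree, and the claim is their value at the tuple \<open>[x]\<close>.\<close>

lemma stable_homomorphisms:
  fixes \<mu> :: "'a \<Rightarrow> int"
  assumes iso: "fusion_restriction S F (integer_mod_group p) 1
           \<in> iso (fusion_cohomology S F (integer_mod_group p) 1) (cohomology S (integer_mod_group p) 1)"
    and \<mu>: "\<And>x y. x \<in> carrier S \<Longrightarrow> y \<in> carrier S \<Longrightarrow> [\<mu> (x \<otimes> y) = \<mu> x + \<mu> y] (mod int p)"
    and \<phi>: "\<phi> \<in> F P (carrier S)" and x: "x \<in> P"
  shows "[\<mu> (\<phi> x) = \<mu> x] (mod int p)"
proof -
  let ?A = "integer_mod_group p"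
  interpret A: comm_group ?A by simp
  have p: "p > 0" using prime by (simp add: prime_gt_0_nat)
  have cA: "carrier ?A = {0..<int p}" using p by (simp add: carrier_integer_mod_group)
  define c where "c = (\<lambda>xs\<in>tuples S 1. \<mu> (hd xs) mod int p)"
  have c: "c \<in> carrier (cochains S ?A 1)" using p by (auto simp: c_def cochains_def cA)
  have "coboundary S ?A 1 c = \<one>\<^bsub>cochains S ?A 2\<^esub>"
  proof -
    have "(\<Otimes>\<^bsub>?A\<^esub>i\<in>{0..1 + 1}. c (face S i xs) [^]\<^bsub>?A\<^esub> ((-1) ^ i :: int)) = \<one>\<^bsub>?A\<^esub>" if xs: "xs \<in> tuples S 2" for xs
    proof -
      obtain g h where gh: "xs = [g, h]" "g \<in> carrier S" "h \<in> carrier S"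
        using xs by (auto simp: tuples_def length_Suc_conv numeral_2_eq_2)
      have t: "[g] \<in> tuples S 1" "[h] \<in> tuples S 1" "[g \<otimes> h] \<in> tuples S 1"
        using gh by (auto simp: tuples_def)
      have f: "face S 0 xs = [h]" "face S (Suc 0) xs = [g \<otimes> h]" "face S (Suc (Suc 0)) xs = [g]"
        by (simp_all add: face_def gh)
      have cl: "c (face S i xs) [^]\<^bsub>?A\<^esub> ((-1) ^ i :: int) \<in> carrier ?A" if "i \<le> Suc (Suc 0)" for i
      proof -
        have "c (face S i xs) \<in> carrier ?A" using that f t c by (auto simp: le_Suc_eq cochains_def PiE_mem)
        then show ?thesis by (rule A.int_pow_closed)
      qed
      have v: "c [g] = \<mu> g mod int p" "c [h] = \<mu> h mod int p" "c [g \<otimes> h] = \<mu> (g \<otimes> h) mod int p"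
        using t by (simp_all add: c_def)
      have "(\<Otimes>\<^bsub>?A\<^esub>i\<in>{..Suc (Suc 0)}. c (face S i xs) [^]\<^bsub>?A\<^esub> ((-1) ^ i :: int)) =
        c [g] [^]\<^bsub>?A\<^esub> (1::int) \<otimes>\<^bsub>?A\<^esub> (c [g \<otimes> h] [^]\<^bsub>?A\<^esub> (-1::int) \<otimes>\<^bsub>?A\<^esub> c [h] [^]\<^bsub>?A\<^esub> (1::int))"
      proof -
        let ?f = "\<lambda>i. c (face S i xs) [^]\<^bsub>?A\<^esub> ((-1) ^ i :: int)"
        have "?f \<in> {..Suc (Suc 0)} \<rightarrow> carrier ?A" "?f \<in> {..Suc 0} \<rightarrow> carrier ?A" "?f \<in> {0} \<rightarrow> carrier ?A"
          by (intro Pi_I cl; simp)+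
        from A.finprod_Suc[OF this(1)] A.finprod_Suc[OF this(2)] A.finprod_0[OF this(3)]
        show ?thesis by (simp only: f power_0 power_one_right power_Suc) simp
      qed
      also have "\<dots> = (\<mu> g + (- \<mu> (g \<otimes> h) + \<mu> h)) mod int p"
        by (simp add: v int_pow_integer_mod_group mod_simps)
      also have "\<dots> = 0"
      proof -
        have "[\<mu> g + \<mu> h - \<mu> (g \<otimes> h) = 0] (mod int p)"
          using cong_diff[OF cong_sym[OF \<mu>[OF gh(2,3)]] cong_refl[of "\<mu> (g \<otimes> h)"]] by simp
        then show ?thesis by (simp add: cong_def algebra_simps)
      qed
      finally show ?thesis by (simp add: atLeast0AtMost numeral_2_eq_2)
    qed
    then show ?thesis
      by (auto simp: coboundary_def cochains_def product_group_def numeral_2_eq_2 intro!: restrict_ext)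
  qed
  then have cc: "c \<in> cocycles S ?A 1" using c by (simp add: cocycles_def kernel_def numeral_2_eq_2)
  have z: "{c} \<in> carrier (cohomology S ?A 1)"
  proof -
    have "{c} = coboundaries S ?A 1 #>\<^bsub>cochains S ?A 1\<^esub> c"
      by (simp only: coboundaries_1[OF A.comm_group_axioms] one_coset[OF A.comm_group_axioms c])
    then show ?thesis using cc by (auto simp: cohomology_def FactGroup_def RCOSETS_def r_coset_def)
  qed
  have "carrier (fusion_cohomology S F ?A 1) = carrier (cohomology S ?A 1)"
    using iso by (auto simp: iso_def bij_betw_def fusion_restriction_def)
  then have "{c} \<in> carrier (fusion_cohomology S F ?A 1)" using z by simp
  then have eq: "pullback (S\<lparr>carrier := P\<rparr>) ?A 1 \<phi> {c} = pullback (S\<lparr>carrier := P\<rparr>) ?A 1 (\<lambda>x\<in>P. x) {c}"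
    using F_dom[OF \<phi>] \<phi> by (simp add: fusion_cohomology_def)
  have P: "subgroup P S" by (rule F_dom[OF \<phi>])
  \<comment> \<open>The only coboundary is the trivial cochain, so a pullback is again a singleton
    and equality of classes becomes equality of cochains.\<close>
  have pb: "pullback (S\<lparr>carrier := P\<rparr>) ?A 1 \<psi> {c} = {\<lambda>xs\<in>tuples (S\<lparr>carrier := P\<rparr>) 1. c (map \<psi> xs)}"
    if \<psi>: "\<And>u. u \<in> P \<Longrightarrow> \<psi> u \<in> carrier S" for \<psi>
  proof -
    have "(\<lambda>xs\<in>tuples (S\<lparr>carrier := P\<rparr>) 1. c (map \<psi> xs)) \<in> carrier (cochains (S\<lparr>carrier := P\<rparr>) ?A 1)"
    proof -
      have "map \<psi> xs \<in> tuples S 1" if "xs \<in> tuples (S\<lparr>carrier := P\<rparr>) 1" for xs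
        using that \<psi> by (auto simp: tuples_def)
      then show ?thesis using c by (auto simp: cochains_def PiE_mem)
    qed
    then show ?thesis
      unfolding pullback_def coboundaries_1[OF A.comm_group_axioms]
      by (simp del: One_nat_def add: one_coset[OF A.comm_group_axioms])
  qed
  have \<phi>c: "\<phi> u \<in> carrier S" if "u \<in> P" for u using F_into[OF \<phi>] that by blast
  have "(\<lambda>xs\<in>tuples (S\<lparr>carrier := P\<rparr>) 1. c (map \<phi> xs)) = (\<lambda>xs\<in>tuples (S\<lparr>carrier := P\<rparr>) 1. c (map (\<lambda>x\<in>P. x) xs))"
    using eq pb[of \<phi>] pb[of "\<lambda>x\<in>P. x"] \<phi>c subgroup.mem_carrier[OF P] by simp
  then have "(\<lambda>xs\<in>tuples (S\<lparr>carrier := P\<rparr>) 1. c (map \<phi> xs)) [x] = (\<lambda>xs\<in>tuples (S\<lparr>carrier := P\<rparr>) 1. c (map (\<lambda>x\<in>P. x) xs)) [x]"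
    by (rule fun_cong)
  moreover have "[x] \<in> tuples (S\<lparr>carrier := P\<rparr>) 1" using x by (simp add: tuples_def)
  moreover have "[\<phi> x] \<in> tuples S 1" "[x] \<in> tuples S 1"
    using x \<phi>c subgroup.mem_carrier[OF P] by (auto simp: tuples_def)
  ultimately have "\<mu> (\<phi> x) mod int p = \<mu> x mod int p" using x by (simp add: c_def)
  then show ?thesis by (simp add: cong_def)
qed

text \<open>A central element of order p in the p-group S/M, lifted to \<open>c\<close>, generates
  N/M. \<open>lam\<close> reads off the exponent of \<open>c\<close>, which is well defined modulo p
  because \<open>c [^] d\<close> lies in \<open>M\<close> exactly when p divides
  \<open>d\<close>.\<close>

lemma exists_central_step:
  assumes M: "M \<lhd> S" and ne: "M \<noteq> carrier S"
  shows "\<exists>N lam. N \<lhd> S \<and> M \<subset> N \<and>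
    (\<forall>x\<in>N. \<forall>y\<in>N. [lam (x \<otimes> y) = lam x + lam y] (mod int p)) \<and>
    (\<forall>s\<in>carrier S. \<forall>x\<in>N. [lam (s \<otimes> x \<otimes> inv s) = (lam x :: int)] (mod int p)) \<and>
    (\<forall>x\<in>N. [lam x = 0] (mod int p) \<longleftrightarrow> x \<in> M)"
proof -
  interpret M: normal M S by (rule M)
  interpret Q: group "S Mod M" by (rule M.factorgroup_is_group)
  have finQ: "finite (carrier (S Mod M))" using finite_S by (simp add: carrier_FactGroup)
  obtain n where n: "order S = p ^ n" using p_group by blast
  have lag: "order (S Mod M) * card M = p ^ n"
    using lagrange[OF M.subgroup_axioms] n by (simp add: order_def FactGroup_def)
  then obtain m where m: "order (S Mod M) = p ^ m" using divides_primepow_nat prime by (metis dvd_triv_left)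
  have "m \<noteq> 0"
  proof
    assume "m = 0"
    then have "card M = card (carrier S)" using lag m n by (simp add: order_def)
    then show False using ne card_subset_eq[OF finite_S M.subset] by simp
  qed
  then obtain y where y: "y \<in> carrier (S Mod M)" "y \<noteq> \<one>\<^bsub>S Mod M\<^esub>" "y [^]\<^bsub>S Mod M\<^esub> p = \<one>\<^bsub>S Mod M\<^esub>"
    "\<And>x. x \<in> carrier (S Mod M) \<Longrightarrow> x \<otimes>\<^bsub>S Mod M\<^esub> y \<otimes>\<^bsub>S Mod M\<^esub> inv\<^bsub>S Mod M\<^esub> x = y"
    using Q.p_group_central_element[OF finQ prime m] by blast
  obtain c where c: "c \<in> carrier S" "y = M #> c" using y(1) by (auto simp: carrier_FactGroup)
  interpret h: group_hom S "S Mod M" "\<lambda>x. M #> x"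
    using M.r_coset_hom_Mod Q.is_group is_group by (simp add: group_hom_def group_hom_axioms_def)
  have one: "\<one>\<^bsub>S Mod M\<^esub> = M" by (simp add: FactGroup_def)
  have coset_cg: "M #> a = M #> b \<longleftrightarrow> M.cg a b" if "a \<in> carrier S" "b \<in> carrier S" for a b
  proof -
    have "M #> a = M #> b \<longleftrightarrow> a \<in> M #> b"
      using that M.subgroup_axioms by (metis rcos_self repr_independence)
    also have "\<dots> \<longleftrightarrow> a \<otimes> inv b \<in> M" using M.rcos_module[OF is_group that(2,1)] .
    finally show ?thesis by (simp add: M.cg_def)
  qed
  have cM: "c \<notin> M" using y(2) c coset_join2[OF c(1) M.subgroup_axioms] by (auto simp: one)
  have cp: "c [^] p \<in> M"
  proof -
    have "M #> (c [^] p) = M #> \<one>" using y(3) h.hom_nat_pow[OF c(1)] c h.hom_one by simp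
    then show ?thesis using coset_cg[of "c [^] p" \<one>] M.cg_one_iff c(1) by simp
  qed
  have cc: "M.cg (s \<otimes> c \<otimes> inv s) c" if s: "s \<in> carrier S" for s
  proof -
    have "M #> (s \<otimes> c \<otimes> inv s) = M #> c"
      using y(4)[OF h.hom_closed[OF s]] h.hom_mult[of "s \<otimes> c" "inv s"] h.hom_mult[OF s c(1)] h.hom_inv[OF s] s c by simp
    then show ?thesis using iffD1[OF coset_cg[of "s \<otimes> c \<otimes> inv s" c]] s c(1) by blast
  qed
  have cpow: "M.cg (s \<otimes> c [^] i \<otimes> inv s) (c [^] i)" if s: "s \<in> carrier S" for s and i :: nat
  proof (induction i)
    case (Suc i)
    have "s \<otimes> c [^] Suc i \<otimes> inv s = (s \<otimes> c [^] i \<otimes> inv s) \<otimes> (s \<otimes> c \<otimes> inv s)"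
      using s c(1) by (simp add: m_assoc) (simp flip: m_assoc)
    then show ?case using M.cg_mult[OF Suc cc[OF s]] s c(1) by simp
  qed (use s in simp)
  have cpM: "c [^] (p * k) \<in> M" for k
  proof -
    have "(c [^] p) [^] k \<in> M" using cp by (induction k) auto
    then show ?thesis using c(1) by (simp add: nat_pow_pow)
  qed
  have pow_M: "c [^] d \<in> M \<longleftrightarrow> p dvd d" for d :: nat
  proof
    assume dM: "c [^] d \<in> M"
    show "p dvd d"
    proof (rule ccontr)
      assume "\<not> p dvd d"
      then have "coprime d p" using prime by (metis coprime_commute prime_imp_coprime)
      \<comment> \<open>If \<open>d\<close> were invertible modulo p, the powers of \<open>c\<close>
        with exponents \<open>d * x\<close> and the multiples of p, all in \<open>M\<close>, would
        put \<open>c\<close> itself into \<open>M\<close>.\<close>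
      then obtain x where "[d * x = 1] (mod p)" using cong_solve_coprime_nat[of d p] by auto
      then obtain q1 q2 where q: "d * x + p * q1 = 1 + p * q2"
        by (metis cong_iff_lin_nat mult.commute)
      have "c [^] (d * x) \<in> M"
      proof -
        have "(c [^] d) [^] x \<in> M" using dM by (induction x) auto
        then show ?thesis using c(1) by (simp add: nat_pow_pow)
      qed
      then have "c [^] (d * x) \<otimes> c [^] (p * q1) \<in> M" using cpM by blast
      then have "c [^] (d * x + p * q1) \<in> M" using c(1) by (simp add: nat_pow_mult)
      then have "c [^] (p * q2) \<otimes> c \<in> M" using q by simp
      then have "inv (c [^] (p * q2)) \<otimes> (c [^] (p * q2) \<otimes> c) \<in> M" using cpM by blast
      then show False using c(1) cM by (simp flip: m_assoc)
    qed
  qed (use cpM in auto)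
  have uniq: "[int i = int j] (mod int p)"
    if "M.cg x (c [^] i)" "M.cg x (c [^] j)" "x \<in> carrier S" for x and i j :: nat
  proof -
    have *: "[int i = int j] (mod int p)" if "M.cg (c [^] i) (c [^] j)" "i \<le> j" for i j :: nat
    proof -
      have "c [^] j = c [^] i \<otimes> c [^] (j - i)" using c(1) that(2) by (simp add: nat_pow_mult)
      moreover have "M.cg (inv (c [^] i) \<otimes> c [^] j) (inv (c [^] i) \<otimes> c [^] i)"
        using M.cg_sym[OF that(1)] c(1) by (intro M.cg_mult M.cg_refl) auto
      ultimately have "M.cg (c [^] (j - i)) \<one>" using c(1) by (simp flip: m_assoc)
      then have "p dvd j - i" using pow_M M.cg_one_iff c(1) by simp
      then have "int p dvd int j - int i" using that(2) by (metis of_nat_diff of_nat_dvd_iff)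
      then show ?thesis by (simp add: cong_iff_dvd_diff dvd_diff_commute)
    qed
    have a: "M.cg (c [^] i) (c [^] j)" using M.cg_trans[OF M.cg_sym[OF that(1)] that(2)] that(3) c(1) by simp
    show ?thesis
    proof (cases "i \<le> j")
      case True then show ?thesis using * a by blast
    next
      case False
      then show ?thesis using *[OF M.cg_sym[OF a]] c(1) cong_sym by simp
    qed
  qed
  define N where "N = {x \<in> carrier S. \<exists>i::nat. M.cg x (c [^] i)}"
  \<comment> \<open>The exponent is an arbitrary choice; \<open>uniq\<close> makes it irrelevant
    modulo p, and \<open>lamI\<close> then allows any exponent to be used.\<close>
  define lam where "lam x = int (SOME i::nat. M.cg x (c [^] i))" for x
  have lamD: "\<exists>i. lam x = int i \<and> M.cg x (c [^] i)" if "x \<in> N" for x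
  proof -
    have "M.cg x (c [^] (SOME i::nat. M.cg x (c [^] i)))"
      by (rule someI_ex[of "\<lambda>i. M.cg x (c [^] i)"]) (use that in \<open>simp add: N_def\<close>)
    then show ?thesis unfolding lam_def by blast
  qed
  have lamI: "[lam x = int i] (mod int p)" if "M.cg x (c [^] i)" "x \<in> carrier S" for x and i :: nat
  proof -
    have "x \<in> N" using that by (auto simp: N_def)
    then obtain j where "lam x = int j" "M.cg x (c [^] j)" using lamD by blast
    then show ?thesis using uniq that by simp
  qed
  have NS: "N \<subseteq> carrier S" by (auto simp: N_def)
  have MN: "x \<in> N" if "x \<in> M" for x using that M.cg_one[OF that] by (auto simp: N_def intro!: exI[of _ 0])
  have mult: "M.cg (x \<otimes> y) (c [^] (i + j))"
    if "M.cg x (c [^] i)" "M.cg y (c [^] j)" "x \<in> carrier S" "y \<in> carrier S" for x y and i j :: nat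
    using M.cg_mult[OF that(1,2)] that c(1) by (simp add: nat_pow_mult)
  have conj: "M.cg (s \<otimes> x \<otimes> inv s) (c [^] i)"
    if "M.cg x (c [^] i)" "x \<in> carrier S" "s \<in> carrier S" for x s and i :: nat
    using M.cg_trans[OF M.cg_conj[OF M.cg_refl that(1)] cpow[OF that(3)]] that c(1) by simp
  have sN: "subgroup N S"
  proof (rule finite_mult_closed_subgroup[OF finite_S NS])
    show "N \<noteq> {}" using MN M.one_closed by blast
    show "a \<otimes> b \<in> N" if "a \<in> N" "b \<in> N" for a b using that mult by (auto simp: N_def) blast
  qed
  have "N \<lhd> S"
    unfolding normal_inv_iff using sN conj by (auto simp: N_def)
  moreover have "c \<in> N" using c(1) by (auto simp: N_def intro!: exI[of _ "1::nat"])
  then have "M \<subset> N" using MN cM by blast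
  moreover have "\<forall>x\<in>N. \<forall>y\<in>N. [lam (x \<otimes> y) = lam x + lam y] (mod int p)"
  proof (intro ballI)
    fix x y assume "x \<in> N" "y \<in> N"
    then obtain i j where "lam x = int i" "M.cg x (c [^] i)" "lam y = int j" "M.cg y (c [^] j)" "x \<in> carrier S" "y \<in> carrier S"
      using lamD NS by (metis subsetD)
    then show "[lam (x \<otimes> y) = lam x + lam y] (mod int p)" using lamI[OF mult] by simp
  qed
  moreover have "\<forall>s\<in>carrier S. \<forall>x\<in>N. [lam (s \<otimes> x \<otimes> inv s) = lam x] (mod int p)"
  proof (intro ballI)
    fix s x assume "s \<in> carrier S" "x \<in> N"
    moreover from lamD[OF this(2)] obtain i where "lam x = int i" "M.cg x (c [^] i)" by blast
    ultimately show "[lam (s \<otimes> x \<otimes> inv s) = lam x] (mod int p)" using lamI[OF conj] NS by auto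
  qed
  moreover have "\<forall>x\<in>N. [lam x = 0] (mod int p) \<longleftrightarrow> x \<in> M"
  proof
    fix x assume x: "x \<in> N"
    have xc: "x \<in> carrier S" using x NS by blast
    obtain i where i: "lam x = int i" "M.cg x (c [^] i)" using lamD[OF x] by blast
    show "[lam x = 0] (mod int p) \<longleftrightarrow> x \<in> M"
    proof
      assume "[lam x = 0] (mod int p)"
      then have "c [^] i \<in> M" using i(1) pow_M by (simp add: cong_0_iff)
      then have "M.cg x \<one>" using M.cg_trans[OF i(2) M.cg_one] xc c(1) by simp
      then show "x \<in> M" using M.cg_one_iff xc by blast
    next
      assume "x \<in> M"
      then show "[lam x = 0] (mod int p)" using lamI[of x 0] M.cg_one xc by simp
    qed
  qed
  ultimately show ?thesis by blast
qed

end

context saturated_fusion_system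
begin

lemma controls_normal:
  assumes stable: "\<And>(\<mu> :: 'a \<Rightarrow> int) \<phi> P x. \<lbrakk>\<And>x y. x \<in> carrier S \<Longrightarrow> y \<in> carrier S \<Longrightarrow> [\<mu> (x \<otimes> y) = \<mu> x + \<mu> y] (mod int p);
      \<phi> \<in> F P (carrier S); x \<in> P\<rbrakk> \<Longrightarrow> [\<mu> (\<phi> x) = \<mu> x] (mod int p)"
    and M: "M \<lhd> S"
  shows "controls M"
proof -
  show ?thesis using M
  proof (induction "card (carrier S) - card M" arbitrary: M rule: less_induct)
    case (less M)
    show ?case
    proof (cases "M = carrier S")
      case True
      \<comment> \<open>The start of the descent: the label itself is the factor in the normal
        subgroup, and the centralizing factor is one.\<close>
      have "\<exists>n\<in>carrier S. \<exists>z\<in>centralizer S Q. s = n \<otimes> z"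
        if "linked Q (\<lambda>x. x) s" for Q s
        using linked_label[OF that] subgroup.mem_carrier[OF linked_subgroup[OF that]]
        by (intro bexI[of _ s] bexI[of _ \<one>]) (auto simp: centralizer_def)
      moreover have "f u \<otimes> inv (s \<otimes> u \<otimes> inv s) \<in> carrier S"
        if "linked Q f s" "u \<in> Q" for Q f s u
        using linked_closed[OF that] linked_label[OF that(1)] subgroup.mem_carrier[OF linked_subgroup[OF that(1)] that(2)] by simp
      ultimately show ?thesis using less.prems True by (auto simp: controls_def)
    next
      case False
      then obtain N lam where N: "N \<lhd> S" "M \<subset> N"
        "\<forall>x\<in>N. \<forall>y\<in>N. [lam (x \<otimes> y) = lam x + lam y] (mod int p)"
        "\<forall>s\<in>carrier S. \<forall>x\<in>N. [lam (s \<otimes> x \<otimes> inv s) = lam x] (mod int p)"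
        "\<forall>x\<in>N. [lam x = 0] (mod int p) \<longleftrightarrow> x \<in> M"
        using exists_central_step[OF less.prems] by blast
      have sN: "N \<subseteq> carrier S" using normal_imp_subgroup[OF N(1)] subgroup.subset by blast
      have "card M < card N" "card N \<le> card (carrier S)"
        using psubset_card_mono[OF finite_subset[OF sN finite_S] N(2)] card_mono[OF finite_S sN] by auto
      then have "controls N" using less.hyps[OF _ N(1)] by (meson diff_less_mono2 less_le_trans)
      then interpret controlled S p F N by unfold_locales
      interpret central_step S p F N M lam
      proof (intro central_step.intro central_step_axioms.intro controlled_axioms)
        show "M \<lhd> S" by (rule less.prems)
        show "M \<subseteq> N" using N(2) by blast
        show "[lam (x \<otimes> y) = lam x + lam y] (mod int p)" if "x \<in> N" "y \<in> N" for x y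
          using N(3) that by blast
        show "[lam (s \<otimes> x \<otimes> inv s) = lam x] (mod int p)" if "s \<in> carrier S" "x \<in> N" for s x
          using N(4) that by blast
        show "[lam x = 0] (mod int p) \<longleftrightarrow> x \<in> M" if "x \<in> N" for x using N(5) that by blast
      qed (rule stable)
      show ?thesis by (rule controls_step)
    qed
  qed
qed

end

theorem corollary1p2:
  fixes S :: "('a, 'b) monoid_scheme" and p :: nat and F :: "'a hom_sets"
  assumes "saturated_fusion_system S p F"
    and "fusion_restriction S F (integer_mod_group p) 1
           \<in> iso (fusion_cohomology S F (integer_mod_group p) 1) (cohomology S (integer_mod_group p) 1)"
  shows "F = trivial_fusion S"
proof -
  interpret saturated_fusion_system S p F by (rule assms(1))
  have c: "controls {\<one>\<^bsub>S\<^esub>}"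
  proof (rule controls_normal)
    fix \<mu> :: "'a \<Rightarrow> int" and \<phi> P x
    assume "\<And>x y. x \<in> carrier S \<Longrightarrow> y \<in> carrier S \<Longrightarrow> [\<mu> (x \<otimes>\<^bsub>S\<^esub> y) = \<mu> x + \<mu> y] (mod int p)"
      and "\<phi> \<in> F P (carrier S)" "x \<in> P"
    then show "[\<mu> (\<phi> x) = \<mu> x] (mod int p)" by (rule stable_homomorphisms[OF assms(2)])
  qed (rule one_is_normal)
  have "F P Q \<subseteq> trivial_fusion S P Q" for P Q
  proof
    fix \<phi> assume \<phi>: "\<phi> \<in> F P Q"
    have P: "subgroup P S" and Q: "subgroup Q S" using F_dom F_cod \<phi> by auto
    \<comment> \<open>Labels are available for morphisms into S; the target \<open>Q\<close> returns
      at the end through the image of \<open>\<phi>\<close>.\<close>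
    have \<phi>S: "\<phi> \<in> F P (carrier S)"
      using F_corestrict[OF \<phi> subgroup_self] F_into[OF \<phi>] subgroup.subset[OF Q] by blast
    obtain s where s: "linked P \<phi> s" using every_morphism_linked[OF \<phi>S] by blast
    have sc: "s \<in> carrier S" by (rule linked_label[OF s])
    have "\<phi> = conj_map S s P"
    proof (rule extensionalityI[OF F_ext[OF \<phi>]])
      show "conj_map S s P \<in> extensional P" by (simp add: conj_map_def)
      fix u assume u: "u \<in> P"
      have uc: "u \<in> carrier S" "\<phi> u \<in> carrier S"
        using subgroup.mem_carrier[OF P u] linked_closed[OF s u] by auto
      have "\<phi> u \<otimes>\<^bsub>S\<^esub> inv\<^bsub>S\<^esub> (s \<otimes>\<^bsub>S\<^esub> u \<otimes>\<^bsub>S\<^esub> inv\<^bsub>S\<^esub> s) = \<one>\<^bsub>S\<^esub>"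
        using c s u by (auto simp: controls_def)
      then have "\<phi> u = s \<otimes>\<^bsub>S\<^esub> u \<otimes>\<^bsub>S\<^esub> inv\<^bsub>S\<^esub> s"
        using uc sc inv_solve_right'[of "\<one>\<^bsub>S\<^esub>" "\<phi> u" "s \<otimes>\<^bsub>S\<^esub> u \<otimes>\<^bsub>S\<^esub> inv\<^bsub>S\<^esub> s"] by simp
      then show "\<phi> u = conj_map S s P u" using u by (simp add: conj_map_def)
    qed
    then show "\<phi> \<in> trivial_fusion S P Q" using P Q sc F_into[OF \<phi>] by (auto simp: trivial_fusion_def)
  qed
  then show ?thesis using contains_trivial by (intro ext equalityI)
qed

end
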